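(* Let $1<p<\infty$, let $p'$ be the conjugate exponent of $p$, $\frac1p+\frac1{p'}=1$, let $\omega\in\widehat{\mathcal{D}}$ and let $\nu$ be a radial weight on $\mathbb{D}$. Then $H_\omega:L^p_{\widehat{\nu},[0,1)}\to A^p_\nu$ is bounded if and only if $$\sup_{0<r<1}\left(1+\int_0^r\frac{\widehat{\nu}(t)}{\widehat{\omega}(t)^p}\,dt\right)^{\frac1p}\left(\int_r^1\left(\frac{\omega(t)}{\widehat{\nu}(t)^{\frac1p}}\right)^{p'}dt\right)^{\frac1{p'}}<\infty.$$ In particular, if this condition holds, then $H_\omega:A^p_\nu\to A^p_\nu$ is bounded.
   Context: $\mathbb{D}=\{z\in\mathbb{C}:|z|<1\}$, and $dA=\frac{dx\,dy}{\pi}$ is the normalized area measure. $\mathcal{H}(\mathbb{D})$ is the space of analytic functions on $\mathbb{D}$. A radial weight is a nonnegative function $\omega\in L^1_{[0,1)}$, extended to $\mathbb{D}$ by $\omega(z)=\omega(|z|)$; it is assumed throughout, for every radial weight, that $\widehat{\omega}(z)=\int_{|z|}^1\omega(s)\,ds>0$ for all $z\in\mathbb{D}$. A radial weight $\omega$ belongs to $\widehat{\mathcal{D}}$ if there is a constant $C=C(\omega)\ge1$ with $\widehat{\omega}(r)\le C\,\widehat{\omega}\left(\frac{1+r}{2}\right)$ for all $0\le r<1$. The weighted Bergman space $A^p_\nu$ consists of the $f\in\mathcal{H}(\mathbb{D})$ with $\|f\|_{A^p_\nu}^p=\int_{\mathbb{D}}|f(z)|^p\nu(z)\,dA(z)<\infty$.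 $L^p_{\widehat{\nu},[0,1)}$ is the space of measurable functions on $[0,1)$ with $\int_0^1|f(t)|^p\widehat{\nu}(t)\,dt<\infty$. The reproducing kernels $B^\omega_z\in A^2_\omega$ satisfy $f(z)=\int_{\mathbb{D}}f(\zeta)\overline{B^\omega_z(\zeta)}\,\omega(\zeta)\,dA(\zeta)$ for all $f\in A^2_\omega$. Explicitly, $B^\omega_z(\zeta)=\sum_{n=0}^\infty\frac{(\overline{z}\zeta)^n}{2\omega_{2n+1}}$, where $\omega_x=\int_0^1r^x\omega(r)\,dr$ for $x\ge0$. The Hilbert-type operator is $$H_\omega(f)(z)=\int_0^1 f(t)\left(\frac1z\int_0^zB^\omega_t(\zeta)\,d\zeta\right)\omega(t)\,dt,$$ where the kernel $\frac1z\int_0^zB^\omega_t(\zeta)\,d\zeta$ is extended analytically to $z=0$. A function on $\mathbb{D}$ is evaluated in this formula through its restriction to $[0,1)$. Boundedness of $H_\omega:X\to Y$ means that $H_\omega(f)$ is well defined and belongs to $Y$ for every $f\in X$, with $\|H_\omega(f)\|_Y\le C\|f\|_X$ for a constant $C$ independent of $f$. *)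

theory Defs
  imports "HOL-Complex_Analysis.Complex_Analysis"
begin

abbreviation unit_disc :: "complex set" where
  "unit_disc \<equiv> ball 0 1"

definition area_measure :: "complex measure" where
  "area_measure = scale_measure (ennreal (1 / pi)) lebesgue"

text \<open>A radial weight is given by its profile on \<open>[0,1)\<close>; its value at a point \<open>z\<close> of the disc
  is \<open>\<omega> (cmod z)\<close>. Values of the profile outside \<open>[0,1)\<close> play no role.\<close>

definition weight_hat :: "(real \<Rightarrow> real) \<Rightarrow> real \<Rightarrow> real" where
  "weight_hat \<omega> r = (LINT s:{r..<1}|lebesgue. \<omega> s)"

definition radial_weight :: "(real \<Rightarrow> real) \<Rightarrow> bool" where
  "radial_weight \<omega> \<longleftrightarrow>
     (\<forall>r\<in>{0..<1}. 0 \<le> \<omega> r) \<and>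
     set_integrable lebesgue {0..<1} \<omega> \<and>
     (\<forall>r\<in>{0..<1}. 0 < weight_hat \<omega> r)"

definition D_hat :: "(real \<Rightarrow> real) set" where
  "D_hat = {\<omega>. radial_weight \<omega> \<and>
     (\<exists>C\<ge>1. \<forall>r\<in>{0..<1}. weight_hat \<omega> r \<le> C * weight_hat \<omega> ((1 + r) / 2))}"

definition weight_moment :: "(real \<Rightarrow> real) \<Rightarrow> real \<Rightarrow> real" where
  "weight_moment \<omega> x = (LINT r:{0..<1}|lebesgue. r powr x * \<omega> r)"

text \<open>Powers of extended nonnegative reals, meant for a positive exponent.\<close>

definition ennreal_powr :: "ennreal \<Rightarrow> real \<Rightarrow> ennreal" where
  "ennreal_powr x a = (if x = \<infinity> then \<infinity> else ennreal (enn2real x powr a))"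

text \<open>The norms take the value \<open>\<infinity>\<close> off the corresponding space.\<close>

definition bergman_norm :: "real \<Rightarrow> (real \<Rightarrow> real) \<Rightarrow> (complex \<Rightarrow> complex) \<Rightarrow> ennreal" where
  "bergman_norm p \<nu> f =
     ennreal_powr (\<integral>\<^sup>+z\<in>unit_disc. ennreal (cmod (f z) powr p * \<nu> (cmod z)) \<partial>area_measure) (1 / p)"

definition bergman_space :: "real \<Rightarrow> (real \<Rightarrow> real) \<Rightarrow> (complex \<Rightarrow> complex) set" where
  "bergman_space p \<nu> = {f. f holomorphic_on unit_disc \<and> bergman_norm p \<nu> f < \<infinity>}"

definition Lp_hat_norm :: "real \<Rightarrow> (real \<Rightarrow> real) \<Rightarrow> (real \<Rightarrow> complex) \<Rightarrow> ennreal" where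
  "Lp_hat_norm p \<nu> f =
     ennreal_powr (\<integral>\<^sup>+t\<in>{0..<1}. ennreal (cmod (f t) powr p * weight_hat \<nu> t) \<partial>lebesgue) (1 / p)"

definition Lp_hat_space :: "real \<Rightarrow> (real \<Rightarrow> real) \<Rightarrow> (real \<Rightarrow> complex) set" where
  "Lp_hat_space p \<nu> =
     {f. f \<in> borel_measurable (lebesgue_on {0..<1}) \<and> Lp_hat_norm p \<nu> f < \<infinity>}"

definition bergman_kernel :: "(real \<Rightarrow> real) \<Rightarrow> complex \<Rightarrow> complex \<Rightarrow> complex" where
  "bergman_kernel \<omega> z \<zeta> =
     (\<Sum>n. (cnj z * \<zeta>) ^ n / complex_of_real (2 * weight_moment \<omega> (2 * real n + 1)))"

definition hilbert_kernel :: "(real \<Rightarrow> real) \<Rightarrow> real \<Rightarrow> complex \<Rightarrow> complex" where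
  "hilbert_kernel \<omega> t z =
     (let K = (\<lambda>w. 1 / w * contour_integral (linepath 0 w) (bergman_kernel \<omega> (complex_of_real t)))
      in if z = 0 then Lim (at 0) K else K z)"

definition hilbert_integrand ::
    "(real \<Rightarrow> real) \<Rightarrow> (real \<Rightarrow> complex) \<Rightarrow> complex \<Rightarrow> real \<Rightarrow> complex" where
  "hilbert_integrand \<omega> f z t = f t * hilbert_kernel \<omega> t z * complex_of_real (\<omega> t)"

definition hilbert_op :: "(real \<Rightarrow> real) \<Rightarrow> (real \<Rightarrow> complex) \<Rightarrow> complex \<Rightarrow> complex" where
  "hilbert_op \<omega> f z = (LINT t:{0..<1}|lebesgue. hilbert_integrand \<omega> f z t)"

definition hilbert_well_defined :: "(real \<Rightarrow> real) \<Rightarrow> (real \<Rightarrow> complex) \<Rightarrow> bool" where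
  "hilbert_well_defined \<omega> f \<longleftrightarrow>
     (\<forall>z\<in>unit_disc. set_integrable lebesgue {0..<1} (hilbert_integrand \<omega> f z))"

definition restrict_to_radius :: "(complex \<Rightarrow> complex) \<Rightarrow> real \<Rightarrow> complex" where
  "restrict_to_radius f t = f (complex_of_real t)"

text \<open>Boundedness of the operator from a space \<open>X\<close> to a space \<open>Y\<close> with norms \<open>nX\<close> and \<open>nY\<close>.
  The map \<open>\<rho>\<close> turns an element of \<open>X\<close> into a function on \<open>[0,1)\<close>: it is the identity when \<open>X\<close>
  consists of such functions, and restriction when \<open>X\<close> consists of functions on the disc.\<close>

definition hilbert_bounded ::
    "(real \<Rightarrow> real) \<Rightarrow> ('a \<Rightarrow> real \<Rightarrow> complex) \<Rightarrow> 'a set \<Rightarrow> ('a \<Rightarrow> ennreal) \<Rightarrow>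
     (complex \<Rightarrow> complex) set \<Rightarrow> ((complex \<Rightarrow> complex) \<Rightarrow> ennreal) \<Rightarrow> bool" where
  "hilbert_bounded \<omega> \<rho> X nX Y nY \<longleftrightarrow>
     (\<exists>C::real. 0 \<le> C \<and>
       (\<forall>f\<in>X. hilbert_well_defined \<omega> (\<rho> f) \<and> hilbert_op \<omega> (\<rho> f) \<in> Y \<and>
              nY (hilbert_op \<omega> (\<rho> f)) \<le> ennreal C * nX f))"

definition muckenhoupt_sup :: "real \<Rightarrow> real \<Rightarrow> (real \<Rightarrow> real) \<Rightarrow> (real \<Rightarrow> real) \<Rightarrow> ennreal" where
  "muckenhoupt_sup p p' \<omega> \<nu> =
     (SUP r\<in>{0<..<1}.
        ennreal_powr
          (1 + (\<integral>\<^sup>+t\<in>{0..r}. ennreal (weight_hat \<nu> t / weight_hat \<omega> t powr p) \<partial>lebesgue)) (1 / p) *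
        ennreal_powr
          (\<integral>\<^sup>+t\<in>{r..<1}. ennreal ((\<omega> t / weight_hat \<nu> t powr (1 / p)) powr p') \<partial>lebesgue) (1 / p'))"

end

theory Submission
  imports Defs
begin

text \<open>
  Write \<open>K\<close> for the function with \<open>hilbert_kernel \<omega> t z = K (t * z)\<close>; it has positive Taylor coefficients
  \<open>1 / (2 * (n + 1) * \<omega>_{2n+1})\<close>. The theorem rests on two facts about \<open>K\<close>, both consequences of the doubling condition.

  Off the radius (\<open>norm_kern_le_hilb\<close>), \<open>K\<close> at radius \<open>x\<close> and angle \<open>\<theta>\<close> is at most a constant times
  \<open>1 + \<integral> 1 / (weight_hat \<omega> y * max (1 - y) \<bar>\<theta>\<bar>) dy\<close>, integrated over \<open>[0, x]\<close>. Indeed, doubling of the tails implies doubling of the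
  moments (\<open>moment_doubling\<close>), so that the coefficients vary slowly, and one summation by parts against the Dirichlet
  kernel does the rest. Hence on the circle of radius \<open>s\<close> the image of \<open>f\<close> is dominated by the mass of \<open>f * \<omega>\<close> plus a Hilbert-type
  transform, with kernel \<open>1 / max\<close>, of the quotient of the tails of \<open>f * \<omega>\<close> and of \<open>\<omega>\<close> on \<open>[0, s]\<close>. This transform is bounded on \<open>L^p\<close>
  (\<open>Hilbert_max_kernel_bound\<close>). Integrating over all circles against \<open>\<nu>\<close> turns \<open>\<nu>\<close> into its tail, and boundedness of
  the operator is reduced to a weighted Hardy inequality for tails. Muckenhoupt's condition is sufficient for that inequality
  (\<open>weighted_Hardy\<close>), and the summand \<open>1\<close> in the condition takes care of the mass.

  On the radius (\<open>kern_lower\<close>), \<open>K\<close> is at least a constant times \<open>1 / weight_hat \<omega>\<close>. In Cauchy's formula the distance between a point of the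
  radius and one of the circle is again comparable with \<open>max (1 - x) \<bar>\<theta>\<bar>\<close>, so that the same Hilbert inequality yields an inequality of
  Fejer and Riesz (\<open>Fejer_Riesz_circle\<close>) and, after integration against \<open>\<nu>\<close>, a bounded restriction map from \<open>A^p_\<nu>\<close> to the space on the
  radius with weight \<open>weight_hat \<nu>\<close> (\<open>radial_embedding\<close>). Testing a bounded operator on the extremal functions of Hoelder's
  inequality and reading off the images on the radius gives the necessity of the condition (\<open>hilbert_op_lower_bound\<close>). The
  boundedness on \<open>A^p_\<nu>\<close> follows by composing with the restriction map.
\<close>

section \<open>Powers, Hoelder's inequality and Hilbert's inequality for extended nonnegative functions\<close>

lemma ennreal_powr_ennreal [simp]: "0 \<le> x \<Longrightarrow> ennreal_powr (ennreal x) a = ennreal (x powr a)"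
  by (simp add: ennreal_powr_def)

lemma ennreal_powr_top [simp]: "ennreal_powr top a = top"
  by (simp add: ennreal_powr_def)

lemma ennreal_powr_zero [simp]: "ennreal_powr 0 a = 0"
  by (simp add: ennreal_powr_def)

lemma ennreal_powr_eq_0_iff [simp]: "ennreal_powr x a = 0 \<longleftrightarrow> x = 0"
  by (cases x) auto

lemma ennreal_powr_less_top_iff [simp]: "ennreal_powr x a < top \<longleftrightarrow> x < top"
  by (cases x) auto

lemma ennreal_powr_mono: "0 < a \<Longrightarrow> x \<le> y \<Longrightarrow> ennreal_powr x a \<le> ennreal_powr y a"
  by (cases x; cases y) (auto intro!: ennreal_leI powr_mono2 simp: top_unique)

lemma ennreal_powr_mult: "ennreal_powr (x * y) a = ennreal_powr x a * ennreal_powr y a"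
proof (cases "x = 0 \<or> y = 0")
  case False
  then show ?thesis
    by (cases x; cases y)
      (auto simp: ennreal_mult[symmetric] powr_mult ennreal_mult_top ennreal_top_mult)
qed auto

lemma ennreal_powr_powr: "ennreal_powr (ennreal_powr x a) b = ennreal_powr x (a * b)"
  by (cases x) (auto simp: powr_powr)

lemma ennreal_powr_one [simp]: "ennreal_powr x 1 = x"
  by (cases x) auto

text \<open>A crude substitute for convexity: the larger summand is at least half the sum.\<close>

lemma ennreal_powr_add_le:
  assumes "0 < a"
  shows "ennreal_powr (x + y) a \<le> ennreal (2 powr a) * (ennreal_powr x a + ennreal_powr y a)"
proof -
  have "ennreal_powr (x + y) a \<le> ennreal_powr (2 * max x y) a"
    by (intro ennreal_powr_mono assms) (metis add_mono max.cobounded1 max.cobounded2 mult_2)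
  also have "\<dots> = ennreal (2 powr a) * ennreal_powr (max x y) a"
    using ennreal_powr_ennreal[of 2 a] by (simp add: ennreal_powr_mult)
  also have "ennreal_powr (max x y) a \<le> ennreal_powr x a + ennreal_powr y a"
    by (cases "x \<le> y") (auto simp: max_def add_increasing add_increasing2)
  finally show ?thesis by (simp add: mult_left_mono)
qed

lemma borel_measurable_ennreal_powr [measurable (raw)]:
  "f \<in> borel_measurable M \<Longrightarrow> (\<lambda>x. ennreal_powr (f x) a) \<in> borel_measurable M"
  unfolding ennreal_powr_def[abs_def] by simp

lemma Young_ennreal:
  assumes "1 < p" "1 < q" "1 / p + 1 / q = 1" 
  shows "x * y \<le> ennreal_powr x p * ennreal (1 / p) + ennreal_powr y q * ennreal (1 / q)"
proof (cases "x = top \<or> y = top")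
  case True
  have "ennreal (1/p) \<noteq> 0" "ennreal (1/q) \<noteq> 0" using assms by auto
  then show ?thesis using True by (auto simp: ennreal_top_mult)
next
  case False
  then obtain a b where "x = ennreal a" "a \<ge> 0" "y = ennreal b" "b \<ge> 0"
    by (metis enn2real_nonneg ennreal_cases)
  then show ?thesis
    using Youngs_inequality[of p q a b] assms
    by (simp add: ennreal_mult[symmetric] ennreal_plus[symmetric] del: ennreal_plus)
qed

text \<open>Young's inequality after normalising both factors. When one of the norms is \<open>0\<close>, the product vanishes almost
  everywhere, which is what makes the convention \<open>0 * \<infinity> = 0\<close> on the right-hand side harmless.\<close>

lemma Holder_nn_integral:
  fixes f g :: "'a \<Rightarrow> ennreal"
  assumes p: "1 < p" "1 < q" "1 / p + 1 / q = 1"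
    and [measurable]: "f \<in> borel_measurable M" "g \<in> borel_measurable M"
  shows "(\<integral>\<^sup>+x. f x * g x \<partial>M) \<le>
    ennreal_powr (\<integral>\<^sup>+x. ennreal_powr (f x) p \<partial>M) (1 / p) *
    ennreal_powr (\<integral>\<^sup>+x. ennreal_powr (g x) q \<partial>M) (1 / q)"
    (is "?L \<le> ennreal_powr ?A _ * ennreal_powr ?B _")
proof (cases "?A = 0 \<or> ?B = 0")
  case True
  then have "AE x in M. f x * g x = 0"
    by (auto simp: nn_integral_0_iff_AE elim: eventually_mono)
  then have "?L = 0" by (simp add: nn_integral_0_iff_AE)
  then show ?thesis by simp
next
  case nz: False
  show ?thesis
  proof (cases "?A = top \<or> ?B = top")
    case True
    then have "ennreal_powr ?A (1/p) * ennreal_powr ?B (1/q) = top"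
      using nz by (auto simp: ennreal_top_mult ennreal_mult_top)
    then show ?thesis by simp
  next
    case False
    then obtain a b where ab: "?A = ennreal a" "?B = ennreal b" "0 < a" "0 < b"
      using nz by (metis ennreal_cases ennreal_eq_0_iff ennreal_less_zero_iff less_le not_less)
    let ?\<alpha> = "a powr (1/p)" and ?\<beta> = "b powr (1/q)"
    have pos: "?\<alpha> > 0" "?\<beta> > 0" using ab by auto
    have pt: "f x * g x \<le> ennreal (?\<alpha> * ?\<beta>) * (ennreal_powr (f x) p * ennreal (1 / (a * p))
        + ennreal_powr (g x) q * ennreal (1 / (b * q)))" for x
    proof -
      have one: "ennreal (?\<alpha> * ?\<beta>) * (ennreal (1 / ?\<alpha>) * ennreal (1/?\<beta>)) = 1"
        using pos by (simp add: ennreal_mult[symmetric])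
      have "f x * g x = ennreal (?\<alpha> * ?\<beta>) * ((ennreal (1 / ?\<alpha>) * f x) * (ennreal (1/?\<beta>) * g x))"
        using one by (metis (no_types, opaque_lifting) mult.assoc mult.left_commute mult_1)
      also have "(ennreal (1 / ?\<alpha>) * f x) * (ennreal (1/?\<beta>) * g x) \<le> 
         ennreal_powr (ennreal (1 / ?\<alpha>) * f x) p * ennreal (1 / p) +
         ennreal_powr (ennreal (1 / ?\<beta>) * g x) q * ennreal (1 / q)"
        by (rule Young_ennreal[OF p])
      also have "ennreal_powr (ennreal (1 / ?\<alpha>) * f x) p = ennreal (1 / a) * ennreal_powr (f x) p"
        using pos ab p by (simp add: ennreal_powr_mult powr_divide powr_powr)
      also have "ennreal_powr (ennreal (1 / ?\<beta>) * g x) q = ennreal (1 / b) * ennreal_powr (g x) q"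
        using pos ab p by (simp add: ennreal_powr_mult powr_divide powr_powr)
      also have "ennreal (1 / a) * ennreal_powr (f x) p * ennreal (1 / p)
        = ennreal_powr (f x) p * ennreal (1 / (a * p))"
        using p ab by (simp add: ennreal_mult[symmetric] mult.commute mult.left_commute)
      also have "ennreal (1 / b) * ennreal_powr (g x) q * ennreal (1 / q)
        = ennreal_powr (g x) q * ennreal (1 / (b * q))"
        using p ab by (simp add: ennreal_mult[symmetric] mult.commute mult.left_commute)
      finally show ?thesis by (simp add: mult_left_mono)
    qed
    have "?L \<le> (\<integral>\<^sup>+x. ennreal (?\<alpha> * ?\<beta>) * (ennreal_powr (f x) p * ennreal (1 / (a * p))
        + ennreal_powr (g x) q * ennreal (1 / (b * q))) \<partial>M)"
      by (intro nn_integral_mono pt)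
    also have "\<dots> = ennreal (?\<alpha> * ?\<beta>) * (?A * ennreal (1 / (a * p)) + ?B * ennreal (1 / (b * q)))"
      by (simp add: nn_integral_cmult nn_integral_add nn_integral_multc)
    also have "?A * ennreal (1 / (a * p)) + ?B * ennreal (1 / (b * q)) = 1"
      using ab p by (simp add: ennreal_mult[symmetric] ennreal_plus[symmetric] del: ennreal_plus)
    finally show ?thesis using ab by (simp add: ennreal_mult)
  qed
qed

text \<open>The Schur test integral for the kernel \<open>1 / max x y\<close>, which is homogeneous of degree \<open>-1\<close>: the power
  \<open>y powr (-a)\<close> is an eigenfunction up to a constant, the interval \<open>y \<le> x\<close> and the half-line \<open>y \<ge> x\<close> giving one summand each.\<close>

lemma nn_integral_powr_over_max:
  assumes a: "0 < a" "a < 1" and x: "0 < x"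
  shows "(\<integral>\<^sup>+y\<in>{0<..}. ennreal (y powr (-a) / max x y) \<partial>lborel)
    \<le> ennreal (x powr (-a) * (1 / (1 - a) + 1 / a))"
proof -
  have i1: "(\<integral>\<^sup>+y. ennreal (y powr (-a)) * indicator {0..x} y \<partial>lborel) = ennreal (x powr (1-a) / (1-a))"
  proof -
    have h: "((\<lambda>y. y powr (-a)) has_integral (x powr (- a + 1) / (- a + 1))) {0..x}"
      using a x by (intro has_integral_powr_from_0) auto
    show ?thesis
      using nn_integral_has_integral_lebesgue'[OF _ h] a x
      by simp
  qed
  have i2: "(\<integral>\<^sup>+y. ennreal (y powr (-a-1)) * indicator {x..} y \<partial>lborel) = ennreal (x powr (-a) / a)"
  proof -
    have h: "((\<lambda>y. y powr (-a-1)) has_integral (x powr (-a) / a)) {x..}"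
      using has_integral_powr_to_inf[of "-a-1" x] a x by (simp add: divide_simps)
    show ?thesis
      using nn_integral_has_integral_lebesgue'[OF _ h] a x
      by simp
  qed
  have "(\<integral>\<^sup>+y\<in>{0<..}. ennreal (y powr (-a) / max x y) \<partial>lborel) \<le> 
    (\<integral>\<^sup>+y. ennreal (1 / x) * (ennreal (y powr (-a)) * indicator {0..x} y) + 
        ennreal (y powr (-a-1)) * indicator {x..} y \<partial>lborel)"
  proof (intro nn_integral_mono)
    fix y :: real
    show "ennreal (y powr (-a) / max x y) * indicator {0<..} y \<le> 
      ennreal (1 / x) * (ennreal (y powr (-a)) * indicator {0..x} y) + 
        ennreal (y powr (-a-1)) * indicator {x..} y"
    proof (cases "y \<le> 0")
      case False
      then show ?thesis using x
        by (cases "y \<le> x") (auto simp: indicator_def max_def ennreal_mult[symmetric] powr_diff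
            intro!: ennreal_leI add_increasing2)
    qed auto
  qed
  also have "\<dots> = ennreal (1 / x) * ennreal (x powr (1-a) / (1-a)) + ennreal (x powr (-a) / a)"
    by (simp add: nn_integral_add nn_integral_cmult i1 i2)
  also have "\<dots> = ennreal (x powr (-a) * (1 / (1 - a) + 1 / a))"
    using a x by (simp add: ennreal_mult[symmetric] ennreal_plus[symmetric] powr_diff powr_minus
        field_simps del: ennreal_plus)
  finally show ?thesis .
qed

text \<open>Hilbert's inequality for the kernel \<open>1 / max x y\<close>, by Schur's test with a power weight. It is used twice, in opposite
  directions: from the distance \<open>1 - y\<close> to the angle for the upper estimate of the operator, and from the angle
  to the distance for the embedding of the Bergman space into a space on the radius.\<close>

theorem Hilbert_max_kernel_bound:
  fixes h :: "real \<Rightarrow> ennreal"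
  assumes p: "1 < p" "1 < q" "1 / p + 1 / q = 1"
    and [measurable]: "h \<in> borel_measurable borel"
  shows "(\<integral>\<^sup>+x\<in>{0<..}. ennreal_powr (\<integral>\<^sup>+y\<in>{0<..}. h y * ennreal (1 / max x y) \<partial>lborel) p \<partial>lborel)
    \<le> ennreal ((p + q) powr p) * (\<integral>\<^sup>+y\<in>{0<..}. ennreal_powr (h y) p \<partial>lborel)"
proof -
  \<comment> \<open>The Schur weight \<open>y powr c\<close>: both test integrals then have exponents \<open>1 / p\<close> and \<open>1 / q\<close> in \<open>(0, 1)\<close>.\<close>
  define c where "c = 1 / (p * q)"
  have pq: "1 / (1 - 1/p) = q" "1 / (1 - 1/q) = p" "1/p = 1 - 1/q" using p by (auto simp: field_simps)
  have pp: "0 < 1/p" "1/p < 1" "0 < 1/q" "1/q < 1" using p by auto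
  have B: "(\<integral>\<^sup>+y\<in>{0<..}. ennreal (y powr (-(1/p)) / max x y) \<partial>lborel) \<le> ennreal (x powr (-(1/p)) * (p + q))"
    if "0 < x" for x
    using nn_integral_powr_over_max[of "1/p" x] pp that pq by (simp add: add.commute)
  have B': "(\<integral>\<^sup>+y\<in>{0<..}. ennreal (y powr (-(1/q)) / max x y) \<partial>lborel) \<le> ennreal (x powr (-(1/q)) * (p + q))"
    if "0 < x" for x
    using nn_integral_powr_over_max[of "1/q" x] pp that pq by (simp add: add.commute)
  have inner: "ennreal_powr (\<integral>\<^sup>+y\<in>{0<..}. h y * ennreal (1 / max x y) \<partial>lborel) p \<le>
     ennreal (x powr (-(1/q)) * (p + q) powr (p / q)) *
     (\<integral>\<^sup>+y\<in>{0<..}. ennreal_powr (h y) p * ennreal (y powr (1/q) / max x y) \<partial>lborel)"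
    if x: "0 < x" for x
  proof -
    let ?f = "\<lambda>y. h y * ennreal (y powr c * (1 / max x y) powr (1/p)) * indicator {0<..} y"
    let ?g = "\<lambda>y. ennreal (y powr (-c) * (1 / max x y) powr (1/q)) * indicator {0<..} y"
    have fg: "h y * ennreal (1 / max x y) * indicator {0<..} y = ?f y * ?g y" for y :: real
    proof (cases "y > 0")
      case True
      have "y powr c * (1 / max x y) powr (1/p) * (y powr (-c) * (1 / max x y) powr (1/q))
        = (y powr c * y powr (-c)) * ((1 / max x y) powr (1/p) * (1 / max x y) powr (1/q))"
        by (simp only: mult_ac)
      also have "\<dots> = 1 / max x y"
        using True x p by (simp add: powr_add[symmetric])
      finally have "ennreal (1 / max x y) = ennreal (y powr c * (1 / max x y) powr (1/p)) *
          ennreal (y powr (-c) * (1 / max x y) powr (1/q))"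
        by (simp add: ennreal_mult[symmetric])
      then show ?thesis using True by (simp add: mult.assoc)
    qed auto
    have fp: "ennreal_powr (?f y) p = ennreal_powr (h y) p * ennreal (y powr (1/q) / max x y) * indicator {0<..} y"
      for y
    proof (cases "y > 0")
      case True
      have "(y powr c * (1 / max x y) powr (1/p)) powr p = y powr (1/q) / max x y"
        using True x p by (simp add: powr_mult powr_powr c_def)
      then show ?thesis using True by (simp add: ennreal_powr_mult)
    qed auto
    have gq: "ennreal_powr (?g y) q = ennreal (y powr (-(1/p)) / max x y) * indicator {0<..} y"
      for y
    proof (cases "y > 0")
      case True
      have "(y powr (-c) * (1 / max x y) powr (1/q)) powr q = y powr (-(1/p)) / max x y"
        using True x p by (simp add: powr_mult powr_powr c_def)
      then show ?thesis using True by (simp add: ennreal_powr_mult)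
    qed auto
    let ?A = "\<integral>\<^sup>+y\<in>{0<..}. ennreal_powr (h y) p * ennreal (y powr (1/q) / max x y) \<partial>lborel"
    have "(\<integral>\<^sup>+y\<in>{0<..}. h y * ennreal (1 / max x y) \<partial>lborel) = (\<integral>\<^sup>+y. ?f y * ?g y \<partial>lborel)"
      by (simp only: fg)
    also have "\<dots> \<le> ennreal_powr (\<integral>\<^sup>+y. ennreal_powr (?f y) p \<partial>lborel) (1/p) *
        ennreal_powr (\<integral>\<^sup>+y. ennreal_powr (?g y) q \<partial>lborel) (1/q)"
      by (intro Holder_nn_integral p) measurable
    also have "\<dots> = ennreal_powr ?A (1/p) * 
        ennreal_powr (\<integral>\<^sup>+y\<in>{0<..}. ennreal (y powr (-(1/p)) / max x y) \<partial>lborel) (1/q)"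
      by (simp only: fp gq)
    also have "\<dots> \<le> ennreal_powr ?A (1/p) * ennreal_powr (ennreal (x powr (-(1/p)) * (p + q))) (1/q)"
      using p by (intro mult_left_mono ennreal_powr_mono B x) auto
    finally have "ennreal_powr (\<integral>\<^sup>+y\<in>{0<..}. h y * ennreal (1 / max x y) \<partial>lborel) p \<le>
      ennreal_powr (ennreal_powr ?A (1/p) * ennreal_powr (ennreal (x powr (-(1/p)) * (p + q))) (1/q)) p"
      using p by (intro ennreal_powr_mono) auto
    also have "\<dots> = ?A * ennreal ((x powr (-(1/p)) * (p + q)) powr (p/q))"
      using p by (simp add: ennreal_powr_mult ennreal_powr_powr powr_powr)
    also have "(x powr (-(1/p)) * (p + q)) powr (p/q) = x powr (-(1/q)) * (p + q) powr (p / q)"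
      using p x by (simp add: powr_mult powr_powr)
    finally show ?thesis by (simp add: mult.commute)
  qed
  have "(\<integral>\<^sup>+x\<in>{0<..}. ennreal_powr (\<integral>\<^sup>+y\<in>{0<..}. h y * ennreal (1 / max x y) \<partial>lborel) p \<partial>lborel)
    \<le> (\<integral>\<^sup>+x\<in>{0<..}. ennreal (x powr (-(1/q)) * (p + q) powr (p / q)) *
     (\<integral>\<^sup>+y\<in>{0<..}. ennreal_powr (h y) p * ennreal (y powr (1/q) / max x y) \<partial>lborel) \<partial>lborel)"
  proof (intro nn_integral_mono)
    fix x :: real
    show "ennreal_powr (\<integral>\<^sup>+y\<in>{0<..}. h y * ennreal (1 / max x y) \<partial>lborel) p * indicator {0<..} x
      \<le> ennreal (x powr (-(1/q)) * (p + q) powr (p / q)) *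
     (\<integral>\<^sup>+y\<in>{0<..}. ennreal_powr (h y) p * ennreal (y powr (1/q) / max x y) \<partial>lborel) * indicator {0<..} x"
      using inner[of x] by (cases "x > 0") auto
  qed
  also have "\<dots> = (\<integral>\<^sup>+x. (\<integral>\<^sup>+y. ennreal ((p + q) powr (p / q)) * (ennreal_powr (h y) p * ennreal (y powr (1/q)) *
         (ennreal (x powr (-(1/q)) / max y x) * indicator {0<..} x) * indicator {0<..} y) \<partial>lborel) \<partial>lborel)"
  proof (intro nn_integral_cong)
    fix x :: real
    have "ennreal (x powr (-(1/q)) * (p + q) powr (p / q)) *
       (\<integral>\<^sup>+y\<in>{0<..}. ennreal_powr (h y) p * ennreal (y powr (1/q) / max x y) \<partial>lborel) * indicator {0<..} x
      = (\<integral>\<^sup>+y. (ennreal (x powr (-(1/q)) * (p + q) powr (p / q)) * indicator {0<..} x) *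
       (ennreal_powr (h y) p * ennreal (y powr (1/q) / max x y) * indicator {0<..} y) \<partial>lborel)"
      by (subst nn_integral_cmult) (auto simp: mult_ac)
    also have "\<dots> = (\<integral>\<^sup>+y. ennreal ((p + q) powr (p / q)) * (ennreal_powr (h y) p * ennreal (y powr (1/q)) *
         (ennreal (x powr (-(1/q)) / max y x) * indicator {0<..} x) * indicator {0<..} y) \<partial>lborel)"
    proof (intro nn_integral_cong)
      fix y :: real
      have *: "ennreal (x powr (-(1/q)) * (p + q) powr (p / q)) * ennreal (y powr (1/q) / max x y)
        = ennreal ((p + q) powr (p / q)) * (ennreal (y powr (1/q)) * ennreal (x powr (-(1/q)) / max y x))"
        if "x > 0" "y > 0"
      proof -
        have "max x y \<ge> 0" using that by auto
        then show ?thesis using that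
        by (simp add: ennreal_mult[symmetric] max.commute)
      qed
      show "ennreal (x powr (-(1/q)) * (p + q) powr (p / q)) * indicator {0<..} x *
       (ennreal_powr (h y) p * ennreal (y powr (1/q) / max x y) * indicator {0<..} y) =
        ennreal ((p + q) powr (p / q)) * (ennreal_powr (h y) p * ennreal (y powr (1/q)) *
         (ennreal (x powr (-(1/q)) / max y x) * indicator {0<..} x) * indicator {0<..} y)"
      proof (cases "x > 0 \<and> y > 0")
        case True
        then have "ennreal (x powr (-(1/q)) * (p + q) powr (p / q)) * indicator {0<..} x *
         (ennreal_powr (h y) p * ennreal (y powr (1/q) / max x y) * indicator {0<..} y)
          = ennreal_powr (h y) p * (ennreal (x powr (-(1/q)) * (p + q) powr (p / q)) * ennreal (y powr (1/q) / max x y))"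
          by (simp add: mult_ac)
        also have "\<dots> = ennreal_powr (h y) p *
           (ennreal ((p + q) powr (p / q)) * (ennreal (y powr (1/q)) * ennreal (x powr (-(1/q)) / max y x)))"
          using * True by simp
        finally show ?thesis using True by (simp add: mult_ac)
      qed auto
    qed
    finally show "ennreal (x powr (-(1/q)) * (p + q) powr (p / q)) *
       (\<integral>\<^sup>+y\<in>{0<..}. ennreal_powr (h y) p * ennreal (y powr (1/q) / max x y) \<partial>lborel) * indicator {0<..} x
      = \<dots>" .
  qed
  also have "\<dots> = (\<integral>\<^sup>+y. (\<integral>\<^sup>+x. ennreal ((p + q) powr (p / q)) * (ennreal_powr (h y) p * ennreal (y powr (1/q)) *
         (ennreal (x powr (-(1/q)) / max y x) * indicator {0<..} x) * indicator {0<..} y) \<partial>lborel) \<partial>lborel)"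
    by (rule lborel_pair.Fubini') measurable
  also have "\<dots> = (\<integral>\<^sup>+y. ennreal ((p + q) powr (p / q)) * (ennreal_powr (h y) p * ennreal (y powr (1/q)) *
         (\<integral>\<^sup>+x\<in>{0<..}. ennreal (x powr (-(1/q)) / max y x) \<partial>lborel) * indicator {0<..} y) \<partial>lborel)"
    by (simp add: nn_integral_cmult nn_integral_multc)
  also have "\<dots> \<le> (\<integral>\<^sup>+y. ennreal ((p + q) powr p) * (ennreal_powr (h y) p * indicator {0<..} y) \<partial>lborel)"
  proof (intro nn_integral_mono)
    fix y :: real
    show "ennreal ((p + q) powr (p / q)) * (ennreal_powr (h y) p * ennreal (y powr (1/q)) *
         (\<integral>\<^sup>+x\<in>{0<..}. ennreal (x powr (-(1/q)) / max y x) \<partial>lborel) * indicator {0<..} y)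
      \<le> ennreal ((p + q) powr p) * (ennreal_powr (h y) p * indicator {0<..} y)"
    proof (cases "y > 0")
      case True
      have e: "p / q + 1 = p" using p by (simp add: field_simps)
      have "ennreal ((p + q) powr (p / q)) * (ennreal_powr (h y) p * ennreal (y powr (1/q)) *
         (\<integral>\<^sup>+x\<in>{0<..}. ennreal (x powr (-(1/q)) / max y x) \<partial>lborel))
         \<le> ennreal ((p + q) powr (p / q)) * (ennreal_powr (h y) p * ennreal (y powr (1/q)) *
         ennreal (y powr (-(1/q)) * (p + q)))"
        by (intro mult_left_mono B' True) auto
      also have "\<dots> = ennreal_powr (h y) p * ((ennreal ((p + q) powr (p / q)) *(ennreal (y powr (1/q)) *
         ennreal (y powr (-(1/q)) * (p + q)))))" by (simp add: mult_ac)
      also have "(ennreal ((p + q) powr (p / q)) *(ennreal (y powr (1/q)) *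
         ennreal (y powr (-(1/q)) * (p + q)))) = ennreal ((p + q) powr (p / q) *(y powr (1/q) *
          (y powr (-(1/q)) * (p + q))))"
        using p by (simp add: ennreal_mult)
      also have "(p + q) powr (p / q) *(y powr (1/q) * (y powr (-(1/q)) * (p + q))) = (p+q) powr (p/q + 1)"
      proof -
        have "y powr (1/q) * y powr (-(1/q)) = 1" using True by (simp add: powr_minus field_simps)
        then have "y powr (1/q) * (y powr (-(1/q)) * (p + q)) = p + q" by (metis mult.assoc mult_1)
        then show ?thesis using p by (simp add: powr_add)
      qed
      also have "\<dots> = (p + q) powr p" by (simp only: e)
      finally show ?thesis using True by (simp add: mult_ac)
    qed auto
  qed
  also have "\<dots> = ennreal ((p + q) powr p) * (\<integral>\<^sup>+y\<in>{0<..}. ennreal_powr (h y) p \<partial>lborel)"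
    by (simp add: nn_integral_cmult)
  finally show ?thesis .
qed

section \<open>A weighted Hardy inequality\<close>

text \<open>Tonelli on the region \<open>h y \<le> s\<close>. With \<open>h y = y\<close> it converts integrals against \<open>\<nu>\<close> into integrals against the
  tail \<open>weight_hat \<nu>\<close>, which is how the weight \<open>weight_hat \<nu>\<close> of the statement arises from \<open>\<nu>\<close>.\<close>

lemma nn_integral_triangle:
  fixes f g :: "real \<Rightarrow> ennreal" and h :: "real \<Rightarrow> real"
  assumes [measurable]: "f \<in> borel_measurable borel" "g \<in> borel_measurable borel" "h \<in> borel_measurable borel"
  shows borel_measurable_nn_integral_above:
      "(\<lambda>y. \<integral>\<^sup>+s. g s * indicator {h y..} s \<partial>lborel) \<in> borel_measurable borel" (is ?above)
    and borel_measurable_nn_integral_below: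
      "(\<lambda>s. \<integral>\<^sup>+y. f y * indicator {y. h y \<le> s} y \<partial>lborel) \<in> borel_measurable borel" (is ?below)
    and nn_integral_triangle_swap:
      "(\<integral>\<^sup>+y. f y * (\<integral>\<^sup>+s. g s * indicator {h y..} s \<partial>lborel) \<partial>lborel) =
       (\<integral>\<^sup>+s. g s * (\<integral>\<^sup>+y. f y * indicator {y. h y \<le> s} y \<partial>lborel) \<partial>lborel)" (is ?swap)
proof -
  have "{z \<in> space (borel \<Otimes>\<^sub>M borel :: (real \<times> real) measure). h (fst z) \<le> snd z} \<in> sets (borel \<Otimes>\<^sub>M borel)"
    "{z \<in> space (borel \<Otimes>\<^sub>M borel :: (real \<times> real) measure). h (snd z) \<le> fst z} \<in> sets (borel \<Otimes>\<^sub>M borel)"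
    by measurable
  then have ind: "indicator {z. h (fst z) \<le> snd z} \<in> borel_measurable (lborel \<Otimes>\<^sub>M lborel)"
    "indicator {z. h (snd z) \<le> fst z} \<in> borel_measurable (lborel \<Otimes>\<^sub>M lborel)"
    by (auto intro!: borel_measurable_indicator simp: space_pair_measure)
  have joint: "(\<lambda>(y, s). G y s * indicator {h y..} s) \<in> borel_measurable (lborel \<Otimes>\<^sub>M lborel)"
    "(\<lambda>(s, y). G y s * indicator {h y..} s) \<in> borel_measurable (lborel \<Otimes>\<^sub>M lborel)"
    if [measurable]: "(\<lambda>z. G (fst z) (snd z)) \<in> borel_measurable (lborel \<Otimes>\<^sub>M lborel)"
      "(\<lambda>z. G (snd z) (fst z)) \<in> borel_measurable (lborel \<Otimes>\<^sub>M lborel)" for G :: "real \<Rightarrow> real \<Rightarrow> ennreal"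
  proof -
    have "(\<lambda>(y, s). G y s * indicator {h y..} s) = (\<lambda>z. G (fst z) (snd z) * indicator {z. h (fst z) \<le> snd z} z)"
      "(\<lambda>(s, y). G y s * indicator {h y..} s) = (\<lambda>z. G (snd z) (fst z) * indicator {z. h (snd z) \<le> fst z} z)"
      by (auto simp: indicator_def)
    then show "(\<lambda>(y, s). G y s * indicator {h y..} s) \<in> borel_measurable (lborel \<Otimes>\<^sub>M lborel)"
      "(\<lambda>(s, y). G y s * indicator {h y..} s) \<in> borel_measurable (lborel \<Otimes>\<^sub>M lborel)"
      using ind by simp_all
  qed
  have below: "indicator {y. h y \<le> s} y = (indicator {h y..} s :: ennreal)" for y s
    by (simp add: indicator_def)
  have "(\<lambda>y. \<integral>\<^sup>+s. g s * indicator {h y..} s \<partial>lborel) \<in> borel_measurable lborel"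
    by (rule lborel.borel_measurable_nn_integral[OF joint(1)]) measurable
  then show ?above by simp
  have "(\<lambda>s. \<integral>\<^sup>+y. f y * indicator {h y..} s \<partial>lborel) \<in> borel_measurable lborel"
    by (rule lborel.borel_measurable_nn_integral[OF joint(2)]) measurable
  then show ?below by (simp add: below)
  have sets [measurable]: "{y. h y \<le> s} \<in> sets borel" for s
  proof -
    have "{y \<in> space borel. h y \<le> s} \<in> sets borel" by measurable
    then show ?thesis by simp
  qed
  have "(\<integral>\<^sup>+y. f y * (\<integral>\<^sup>+s. g s * indicator {h y..} s \<partial>lborel) \<partial>lborel) =
      (\<integral>\<^sup>+y. \<integral>\<^sup>+s. f y * g s * indicator {h y..} s \<partial>lborel \<partial>lborel)"
    by (simp add: nn_integral_cmult mult.assoc)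
  also have "\<dots> = (\<integral>\<^sup>+s. \<integral>\<^sup>+y. f y * g s * indicator {h y..} s \<partial>lborel \<partial>lborel)"
    by (rule lborel_pair.Fubini') (rule joint(2); measurable)
  also have "\<dots> = (\<integral>\<^sup>+s. \<integral>\<^sup>+y. g s * (f y * indicator {y. h y \<le> s} y) \<partial>lborel \<partial>lborel)"
    by (simp add: below mult_ac)
  also have "\<dots> = (\<integral>\<^sup>+s. g s * (\<integral>\<^sup>+y. f y * indicator {y. h y \<le> s} y \<partial>lborel) \<partial>lborel)"
    by (simp add: nn_integral_cmult)
  finally show ?swap .
qed

lemma tail_integral_split:
  fixes \<phi> :: "real \<Rightarrow> real"
  assumes int: "set_integrable lborel {0..1} \<phi>" and nn: "\<And>x. 0 \<le> \<phi> x"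
    and "0 \<le> x" "x \<le> y" "y \<le> 1"
  shows "(LINT t:{x..1}|lborel. \<phi> t) = (LINT t:{x..y}|lborel. \<phi> t) + (LINT t:{y..1}|lborel. \<phi> t)"
proof -
  have i: "set_integrable lborel {a..b} \<phi>" if "0 \<le> a" "b \<le> 1" for a b
    by (rule set_integrable_subset[OF int]) (use that in auto)
  have "\<phi> integrable_on {a..b}" if "0 \<le> a" "b \<le> 1" for a b
    using set_borel_integral_eq_integral(1)[OF i[OF that]] .
  moreover have "(LINT t:{a..b}|lborel. \<phi> t) = integral {a..b} \<phi>" if "0 \<le> a" "b \<le> 1" for a b
    using set_borel_integral_eq_integral(2)[OF i[OF that]] .
  ultimately show ?thesis
    using Henstock_Kurzweil_Integration.integral_combine[of x y 1 \<phi>] assms by simp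
qed

lemma continuous_on_tail_integral:
  fixes \<phi> :: "real \<Rightarrow> real"
  assumes int: "set_integrable lborel {0..1} \<phi>"
  shows "continuous_on {0..1} (\<lambda>x. LINT t:{x..1}|lborel. \<phi> t)"
proof -
  have i: "set_integrable lborel {a..1} \<phi>" if "0 \<le> a" for a
    by (rule set_integrable_subset[OF int]) (use that in auto)
  have "continuous_on {0..1} (\<lambda>x. integral {x..1} \<phi>)"
    using indefinite_integral_continuous_1'[OF set_borel_integral_eq_integral(1)[OF int]] .
  moreover have "(LINT t:{x..1}|lborel. \<phi> t) = integral {x..1} \<phi>" if "x \<in> {0..1}" for x
    using set_borel_integral_eq_integral(2)[OF i] that by simp
  ultimately show ?thesis by (subst continuous_on_cong[OF refl]) auto
qed

text \<open>A weighted Hardy inequality for tails, without differentiation. Choose points where the tail integral \<open>\<Phi>\<close> of \<open>\<phi>\<close> has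
  fallen to \<open>T / 2 ^ k\<close>. On the level between two consecutive values, \<open>\<Phi>\<close> is at most four times the integral of
  \<open>\<phi>\<close> over the interval between the next two points, and there the hypothesis applies; these intervals are disjoint,
  so that the bounds add up. Muckenhoupt's condition yields the hypothesis through Hoelder's inequality.\<close>

theorem Hardy_inequality_of_two_interval_condition:
  fixes \<phi> :: "real \<Rightarrow> real" and u \<psi> :: "real \<Rightarrow> ennreal"
  assumes int: "set_integrable lborel {0..1} \<phi>" and nn: "\<And>x. 0 \<le> \<phi> x"
    and [measurable]: "u \<in> borel_measurable borel" "\<psi> \<in> borel_measurable borel"
    and p: "0 < p"
    and cond: "\<And>r s. \<lbrakk>0 < r; r < s; s < 1\<rbrakk> \<Longrightarrow>
      (\<integral>\<^sup>+x\<in>{0..r}. u x \<partial>lborel) * ennreal ((LINT t:{r..s}|lborel. \<phi> t) powr p)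
        \<le> M * (\<integral>\<^sup>+t\<in>{r..<s}. \<psi> t \<partial>lborel)"
  shows "(\<integral>\<^sup>+x\<in>{0..<1}. u x * ennreal ((LINT t:{x..1}|lborel. \<phi> t) powr p) \<partial>lborel)
    \<le> ennreal (4 powr p) * M * (\<integral>\<^sup>+t\<in>{0..<1}. \<psi> t \<partial>lborel)"
proof -
  define \<Phi> where "\<Phi> x = (LINT t:{x..1}|lborel. \<phi> t)" for x
  define T where "T = \<Phi> 0"
  have nonneg: "0 \<le> (LINT t:{x..y}|lborel. \<phi> t)" for x y
    unfolding set_lebesgue_integral_def by (rule integral_nonneg_AE) (simp add: nn)
  have split: "\<Phi> x = (LINT t:{x..y}|lborel. \<phi> t) + \<Phi> y" if "0 \<le> x" "x \<le> y" "y \<le> 1" for x y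
    unfolding \<Phi>_def using tail_integral_split[OF int nn that] .
  have anti: "\<Phi> y \<le> \<Phi> x" if "0 \<le> x" "x \<le> y" "y \<le> 1" for x y
    using split[OF that] nonneg[of x y] by simp
  have \<Phi>0: "0 \<le> \<Phi> x" for x unfolding \<Phi>_def by (rule nonneg)
  have \<Phi>1: "\<Phi> 1 = 0"
  proof -
    have "(LINT t:{1..1}|lborel. \<phi> t) = 0"
      using split[of 1 1] by (simp add: \<Phi>_def)
    then show ?thesis by (simp add: \<Phi>_def)
  qed
  have cont: "continuous_on {0..1} \<Phi>"
    unfolding \<Phi>_def by (rule continuous_on_tail_integral[OF int])
  show ?thesis
  proof (cases "T = 0")
    case True
    have "\<Phi> x = 0" if "x \<in> {0..<1}" for x
      using anti[of 0 x] \<Phi>0[of x] that True by (simp add: T_def)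
    then have "(\<integral>\<^sup>+x\<in>{0..<1}. u x * ennreal ((LINT t:{x..1}|lborel. \<phi> t) powr p) \<partial>lborel)
      = (\<integral>\<^sup>+x. 0 \<partial>(lborel::real measure))"
      by (intro nn_integral_cong) (auto simp: \<Phi>_def indicator_def)
    then show ?thesis by simp
  next
    case False
    then have T: "T > 0" using \<Phi>0[of 0] by (simp add: T_def)
    have "\<exists>x. 0 \<le> x \<and> x \<le> 1 \<and> \<Phi> x = T / 2 ^ k" for k :: nat
      using T IVT2'[of \<Phi> 1 "T / 2 ^ k" 0] cont
      by (auto simp: \<Phi>1 T_def field_simps \<Phi>0 one_le_power mult_left_le)
    then obtain X where X: "\<And>k. 0 \<le> X k" "\<And>k. X k \<le> 1" "\<And>k::nat. \<Phi> (X k) = T / 2 ^ k"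
      by metis
    have Xless: "X k < X (Suc k)" for k
    proof (rule ccontr)
      assume "\<not> X k < X (Suc k)"
      then have "\<Phi> (X k) \<le> \<Phi> (X (Suc k))" using X by (intro anti) auto
      then show False using T by (simp add: X field_simps)
    qed
    then have Xmono: "strict_mono X" by (simp add: strict_mono_Suc_iff)
    have Xlt1: "X k < 1" for k using Xless[of k] X(2)[of "Suc k"] by linarith
    have Xgt0: "0 < X (Suc k)" for k using Xless[of k] X(1)[of k] by linarith
    let ?u = "\<lambda>k x. ennreal ((T / 2 ^ k) powr p) * (u x * indicator {0..X (Suc k)} x)"
    let ?\<psi> = "\<lambda>k t. \<psi> t * indicator {X (Suc k)..<X (Suc (Suc k))} t"
    have "(\<integral>\<^sup>+x\<in>{0..<1}. u x * ennreal (\<Phi> x powr p) \<partial>lborel) \<le> (\<integral>\<^sup>+x. (\<Sum>k. ?u k x) \<partial>lborel)"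
    proof (intro nn_integral_mono)
      fix x :: real
      show "u x * ennreal (\<Phi> x powr p) * indicator {0..<1} x \<le> (\<Sum>k. ?u k x)"
      proof (cases "x \<in> {0..<1} \<and> 0 < \<Phi> x")
        case True
        have "\<exists>k::nat. T / 2 ^ k < \<Phi> x"
        proof -
          have "(\<lambda>k. T * (1/2) ^ k) \<longlonglongrightarrow> T * 0" by (intro tendsto_intros) auto
          then have "eventually (\<lambda>k. T * (1/2) ^ k < \<Phi> x) sequentially"
            using True by (intro order_tendstoD(2)) auto
          then show ?thesis by (auto simp: eventually_sequentially power_one_over field_simps)
        qed
        define k where "k = (LEAST k::nat. T / 2 ^ k < \<Phi> x)"
        have k: "T / 2 ^ k < \<Phi> x" unfolding k_def by (rule LeastI_ex) fact
        have "k \<noteq> 0" using k anti[of 0 x] True by (cases k) (auto simp: T_def)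
        then obtain j where j: "k = Suc j" by (cases k) auto
        have le: "\<Phi> x \<le> T / 2 ^ j"
          using not_less_Least[of j "\<lambda>k. T / 2 ^ k < \<Phi> x"] j by (auto simp: k_def not_less)
        have xX: "x \<le> X (Suc j)"
        proof (rule ccontr)
          assume "\<not> x \<le> X (Suc j)"
          then have "\<Phi> x \<le> \<Phi> (X (Suc j))" using X(1)[of "Suc j"] True by (intro anti) auto
          then show False using k j by (simp add: X)
        qed
        have "u x * ennreal (\<Phi> x powr p) \<le> u x * ennreal ((T / 2 ^ j) powr p)"
          using le \<Phi>0[of x] p by (intro mult_left_mono ennreal_leI powr_mono2) auto
        also have "\<dots> = ?u j x" using xX True by (simp add: mult.commute)
        also have "\<dots> = (\<Sum>k\<in>{j}. ?u k x)" by simp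
        also have "\<dots> \<le> (\<Sum>k. ?u k x)" by (intro sum_le_suminf) auto
        finally show ?thesis using True by simp
      next
        case False
        then show ?thesis using \<Phi>0[of x] p by (auto simp: indicator_def not_less)
      qed
    qed
    also have "\<dots> = (\<Sum>k. \<integral>\<^sup>+x. ?u k x \<partial>lborel)"
      by (rule nn_integral_suminf) measurable
    also have "\<dots> \<le> (\<Sum>k. ennreal (4 powr p) * M * (\<integral>\<^sup>+t. ?\<psi> k t \<partial>lborel))"
    proof (intro suminf_le)
      fix k
      let ?I = "LINT t:{X (Suc k)..X (Suc (Suc k))}|lborel. \<phi> t"
      have "?I = \<Phi> (X (Suc k)) - \<Phi> (X (Suc (Suc k)))"
        using split[of "X (Suc k)" "X (Suc (Suc k))"] X Xless[of "Suc k"] by simp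
      \<comment> \<open>\<open>T / 2 ^ (k + 1) - T / 2 ^ (k + 2) = (T / 2 ^ k) / 4\<close>, one level below the one being estimated.\<close>
      then have I: "T / 2 ^ k = 4 * ?I" by (simp add: X)
      have "(\<integral>\<^sup>+x. ?u k x \<partial>lborel) = ennreal ((4 * ?I) powr p) * (\<integral>\<^sup>+x\<in>{0..X (Suc k)}. u x \<partial>lborel)"
        by (subst nn_integral_cmult) (auto simp: I)
      also have "\<dots> = ennreal (4 powr p) * ((\<integral>\<^sup>+x\<in>{0..X (Suc k)}. u x \<partial>lborel) * ennreal (?I powr p))"
        using nonneg[of "X (Suc k)" "X (Suc (Suc k))"] by (simp add: powr_mult ennreal_mult mult_ac)
      also have "\<dots> \<le> ennreal (4 powr p) * (M * (\<integral>\<^sup>+t. ?\<psi> k t \<partial>lborel))"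
        by (intro mult_left_mono cond Xgt0 Xless Xlt1) auto
      finally show "(\<integral>\<^sup>+x. ?u k x \<partial>lborel) \<le> ennreal (4 powr p) * M * (\<integral>\<^sup>+t. ?\<psi> k t \<partial>lborel)"
        by (simp add: mult.assoc)
    qed auto
    also have "\<dots> = ennreal (4 powr p) * M * (\<Sum>k. \<integral>\<^sup>+t. ?\<psi> k t \<partial>lborel)"
      by (rule ennreal_suminf_cmult)
    also have "(\<Sum>k. \<integral>\<^sup>+t. ?\<psi> k t \<partial>lborel) = (\<integral>\<^sup>+t. (\<Sum>k. ?\<psi> k t) \<partial>lborel)"
      by (rule nn_integral_suminf[symmetric]) measurable
    also have "\<dots> \<le> (\<integral>\<^sup>+t\<in>{0..<1}. \<psi> t \<partial>lborel)"
    proof (intro nn_integral_mono)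
      fix t :: real
      have disj: "disjoint_family (\<lambda>k. {X (Suc k)..<X (Suc (Suc k))})"
        unfolding disjoint_family_on_def
      proof (intro ballI impI)
        fix m n :: nat assume "m \<noteq> n"
        then consider "m < n" | "n < m" by linarith
        then show "{X (Suc m)..<X (Suc (Suc m))} \<inter> {X (Suc n)..<X (Suc (Suc n))} = {}"
          by cases (use strict_mono_leD[OF Xmono, of "Suc (Suc m)" "Suc n"]
              strict_mono_leD[OF Xmono, of "Suc (Suc n)" "Suc m"] in auto)
      qed
      have "(\<Sum>k. ?\<psi> k t) = \<psi> t * (\<Sum>k. indicator {X (Suc k)..<X (Suc (Suc k))} t)"
        by (rule ennreal_suminf_cmult)
      also have "(\<Sum>k. indicator {X (Suc k)..<X (Suc (Suc k))} t :: ennreal) =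
          indicator (\<Union>k. {X (Suc k)..<X (Suc (Suc k))}) t"
        by (rule suminf_indicator[OF disj])
      also have "\<dots> \<le> indicator {0..<1} t"
        using X(1) Xlt1 by (auto simp: indicator_def intro: order_trans less_trans)
      finally show "(\<Sum>k. ?\<psi> k t) \<le> \<psi> t * indicator {0..<1} t" by (simp add: mult_left_mono)
    qed
    finally show ?thesis by (simp add: \<Phi>_def mult_left_mono)
  qed
qed

section \<open>Polar coordinates in the unit disc\<close>

lemma lborel_complex_eq:
  "(lborel :: complex measure) = distr (lborel \<Otimes>\<^sub>M lborel) borel (\<lambda>(x, y). Complex x y)"
proof (rule lborel_eqI)
  have meas [measurable]: "(\<lambda>(x, y). Complex x y) \<in> borel_measurable (lborel \<Otimes>\<^sub>M lborel)"
    unfolding case_prod_unfold Complex_eq by measurable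
  fix l u :: complex
  assume lu: "\<And>b. b \<in> Basis \<Longrightarrow> l \<bullet> b \<le> u \<bullet> b"
  have le: "Re l \<le> Re u" "Im l \<le> Im u"
    using lu[of 1] lu[of \<i>] by (simp_all add: Basis_complex_def inner_complex_def)
  have eq: "(\<lambda>(x, y). Complex x y) -` box l u \<inter> space (lborel \<Otimes>\<^sub>M lborel) = {Re l<..<Re u} \<times> {Im l<..<Im u}"
    by (auto simp: box_def Basis_complex_def inner_complex_def space_pair_measure)
  have "emeasure (distr (lborel \<Otimes>\<^sub>M lborel) borel (\<lambda>(x, y). Complex x y)) (box l u) =
     emeasure (lborel \<Otimes>\<^sub>M lborel) ({Re l<..<Re u} \<times> {Im l<..<Im u})"
    by (subst emeasure_distr[OF meas]) (auto simp: eq)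
  also have "\<dots> = ennreal (Re u - Re l) * ennreal (Im u - Im l)"
    using le by (subst lborel.emeasure_pair_measure_Times) auto
  also have "\<dots> = ennreal (\<Prod>b\<in>Basis. (u - l) \<bullet> b)"
    using le by (simp add: Basis_complex_def inner_complex_def ennreal_mult complex_eq_iff)
  finally show "emeasure (distr (lborel \<Otimes>\<^sub>M lborel) borel (\<lambda>(x, y). Complex x y)) (box l u) =
      ennreal (\<Prod>b\<in>Basis. (u - l) \<bullet> b)" .
qed simp

lemma nn_integral_complex:
  fixes h :: "complex \<Rightarrow> ennreal"
  assumes [measurable]: "h \<in> borel_measurable borel"
  shows "(\<integral>\<^sup>+z. h z \<partial>lborel) = (\<integral>\<^sup>+x. \<integral>\<^sup>+y. h (Complex x y) \<partial>lborel \<partial>lborel)"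
    and "(\<integral>\<^sup>+z. h z \<partial>lborel) = (\<integral>\<^sup>+y. \<integral>\<^sup>+x. h (Complex x y) \<partial>lborel \<partial>lborel)"
proof -
  have meas [measurable]: "(\<lambda>z. Complex (fst z) (snd z)) \<in> borel_measurable (lborel \<Otimes>\<^sub>M lborel)"
      "(\<lambda>z. Complex (snd z) (fst z)) \<in> borel_measurable (lborel \<Otimes>\<^sub>M lborel)"
    unfolding Complex_eq by measurable
  have "(\<integral>\<^sup>+z. h z \<partial>lborel) = (\<integral>\<^sup>+z. h (Complex (fst z) (snd z)) \<partial>(lborel \<Otimes>\<^sub>M lborel))"
    by (subst lborel_complex_eq, subst nn_integral_distr) (auto simp: case_prod_unfold)
  also have "\<dots> = (\<integral>\<^sup>+x. \<integral>\<^sup>+y. h (Complex x y) \<partial>lborel \<partial>lborel)"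
    by (subst lborel.nn_integral_fst[symmetric]) auto
  finally show 1: "(\<integral>\<^sup>+z. h z \<partial>lborel) = (\<integral>\<^sup>+x. \<integral>\<^sup>+y. h (Complex x y) \<partial>lborel \<partial>lborel)" .
  also have "\<dots> = (\<integral>\<^sup>+y. \<integral>\<^sup>+x. h (Complex x y) \<partial>lborel \<partial>lborel)"
    by (rule lborel_pair.Fubini') (simp add: case_prod_unfold, measurable)
  finally show "(\<integral>\<^sup>+z. h z \<partial>lborel) = (\<integral>\<^sup>+y. \<integral>\<^sup>+x. h (Complex x y) \<partial>lborel \<partial>lborel)" .
qed

lemma nn_integral_shift:
  fixes k :: "real \<Rightarrow> ennreal"
  assumes [measurable]: "k \<in> borel_measurable borel"
  shows "(\<integral>\<^sup>+x. k (x + c) \<partial>lborel) = (\<integral>\<^sup>+x. k x \<partial>lborel)"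
  using nn_integral_real_affine[of k 1 c] by (simp add: add.commute)

lemma nn_integral_horizontal_shear:
  fixes h :: "complex \<Rightarrow> ennreal"
  assumes [measurable]: "h \<in> borel_measurable borel"
  shows "(\<integral>\<^sup>+z. h (Complex (Re z + a * Im z) (Im z)) \<partial>lborel) = (\<integral>\<^sup>+z. h z \<partial>lborel)"
proof -
  have [measurable]: "(\<lambda>z. Complex (Re z + a * Im z) (Im z)) \<in> borel_measurable borel"
    "(\<lambda>x. Complex x y) \<in> borel_measurable borel" for y
    unfolding Complex_eq by measurable
  show ?thesis
    by (simp add: nn_integral_complex(2)[of h] nn_integral_complex(2)[of "\<lambda>z. h (Complex (Re z + a * Im z) (Im z))"]
      nn_integral_shift[of "\<lambda>x. h (Complex x y)" for y])
qed

lemma nn_integral_vertical_shear: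
  fixes h :: "complex \<Rightarrow> ennreal"
  assumes [measurable]: "h \<in> borel_measurable borel"
  shows "(\<integral>\<^sup>+z. h (Complex (Re z) (Im z + a * Re z)) \<partial>lborel) = (\<integral>\<^sup>+z. h z \<partial>lborel)"
proof -
  have [measurable]: "(\<lambda>z. Complex (Re z) (Im z + a * Re z)) \<in> borel_measurable borel"
    "Complex x \<in> borel_measurable borel" for x
    unfolding Complex_eq[abs_def] by measurable
  show ?thesis
    by (simp add: nn_integral_complex(1)[of h] nn_integral_complex(1)[of "\<lambda>z. h (Complex (Re z) (Im z + a * Re z))"]
      nn_integral_shift[of "\<lambda>y. h (Complex x y)" for x])
qed

text \<open>A rotation by an angle other than \<open>\<pi>\<close> is a product of three shears, and the half turn is the square of a quarter turn; shears preserve area by Fubini and translation invariance.\<close>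

lemma nn_integral_rotation:
  fixes h :: "complex \<Rightarrow> ennreal"
  assumes [measurable]: "h \<in> borel_measurable borel" and w: "cmod w = 1"
  shows "(\<integral>\<^sup>+z. h (w * z) \<partial>lborel) = (\<integral>\<^sup>+z. h z \<partial>lborel)"
proof -
  have shears: "(\<integral>\<^sup>+z. h (w * z) \<partial>lborel) = (\<integral>\<^sup>+z. h z \<partial>lborel)"
    if [measurable]: "h \<in> borel_measurable borel" and w: "cmod w = 1" and nz: "Im w \<noteq> 0"
    for w and h :: "complex \<Rightarrow> ennreal"
  proof -
    define c s where "c = Re w" and "s = Im w"
    have cs: "c * c + s * s = 1"
      using w cmod_power2[of w] by (simp add: c_def s_def power2_eq_square)
    \<comment> \<open>This is \<open>- tan (\<theta> / 2)\<close> for the rotation by \<open>\<theta>\<close>.\<close>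
    define a where "a = (c - 1) / s"
    have as: "a * s = c - 1" using nz by (simp add: a_def s_def)
    have as': "a * (1 + c) = - s"
    proof -
      have "a * (1 + c) * s = (c - 1) * (1 + c)" by (simp add: as[symmetric])
      also have "\<dots> = - s * s" using cs by (simp add: algebra_simps)
      finally have "a * (1 + c) * s = - s * s" .
      then show ?thesis using nz unfolding s_def[symmetric] by (metis mult_right_cancel)
    qed
    define X where "X z = Complex (Re z + a * Im z) (Im z)" for z
    define Y where "Y z = Complex (Re z) (Im z + s * Re z)" for z
    have [measurable]: "X \<in> borel_measurable borel" "Y \<in> borel_measurable borel"
      unfolding X_def[abs_def] Y_def[abs_def] Complex_eq by measurable
    have "w * z = X (Y (X z))" for z
    proof (rule complex_eqI)
      have "Re (X (Y (X z))) = Re z * (1 + a * s) + Im z * (a * (1 + (1 + a * s)))"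
        by (simp add: X_def Y_def algebra_simps)
      also have "\<dots> = Re z * c - Im z * s" using as as' by (simp add: algebra_simps)
      finally show "Re (w * z) = Re (X (Y (X z)))" by (simp add: c_def s_def algebra_simps)
      have "Im (X (Y (X z))) = Im z * (1 + a * s) + s * Re z"
        by (simp add: X_def Y_def algebra_simps)
      also have "\<dots> = Im z * c + s * Re z" using as by simp
      finally show "Im (w * z) = Im (X (Y (X z)))" by (simp add: c_def s_def algebra_simps)
    qed
    then have "(\<integral>\<^sup>+z. h (w * z) \<partial>lborel) = (\<integral>\<^sup>+z. h (X (Y (X z))) \<partial>lborel)" by simp
    also have "\<dots> = (\<integral>\<^sup>+z. h (X (Y z)) \<partial>lborel)"
      by (rule nn_integral_horizontal_shear[of "\<lambda>z. h (X (Y z))" a, folded X_def]) measurable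
    also have "\<dots> = (\<integral>\<^sup>+z. h (X z) \<partial>lborel)"
      by (rule nn_integral_vertical_shear[of "\<lambda>z. h (X z)" s, folded Y_def]) measurable
    also have "\<dots> = (\<integral>\<^sup>+z. h z \<partial>lborel)"
      by (rule nn_integral_horizontal_shear[of h a, folded X_def]) measurable
    finally show ?thesis .
  qed
  show ?thesis
  proof (cases "Im w = 0")
    case False
    then show ?thesis using shears assms by simp
  next
    case True
    then have "w = 1 \<or> w = -1"
      using w by (auto simp: cmod_eq_Re complex_eq_iff)
    then show ?thesis
    proof
      assume "w = -1"
      then have "(\<integral>\<^sup>+z. h (w * z) \<partial>lborel) = (\<integral>\<^sup>+z. h (\<i> * (\<i> * z)) \<partial>lborel)" 
        by (simp add: mult.assoc[symmetric])
      also have "\<dots> = (\<integral>\<^sup>+z. h (\<i> * z) \<partial>lborel)"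
        using shears[of "\<lambda>z. h (\<i> * z)" \<i>] by simp
      also have "\<dots> = (\<integral>\<^sup>+z. h z \<partial>lborel)" using shears[of h \<i>] by simp
      finally show ?thesis .
    qed simp
  qed
qed

text \<open>Both measures give \<open>\<pi> - \<pi> a\<^sup>2\<close> to \<open>{a<..}\<close>, by the formula for the area of a disc.\<close>

lemma distr_cmod_unit_disc:
  "distr (density lborel (indicator (ball (0::complex) 1))) borel cmod =
   density lborel (\<lambda>s. ennreal (2 * pi * s) * indicator {0..<1} s)" (is "?M = ?N")
proof (rule measure_eqI_lessThan)
  have [measurable]: "ball (0::complex) 1 \<in> sets borel" by simp
  have M: "emeasure ?M {x<..} = emeasure lborel {z::complex. cmod z < 1 \<and> x < cmod z}" for x
  proof -
    have "emeasure ?M {x<..} = emeasure (density lborel (indicator (ball (0::complex) 1))) {z. x < cmod z}"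
      by (subst emeasure_distr) (auto simp: vimage_def)
    also have "\<dots> = (\<integral>\<^sup>+z. indicator (ball (0::complex) 1) z * indicator {z. x < cmod z} z \<partial>lborel)"
      by (rule emeasure_density) measurable
    also have "\<dots> = (\<integral>\<^sup>+z. indicator {z::complex. cmod z < 1 \<and> x < cmod z} z \<partial>lborel)"
      by (intro nn_integral_cong) (simp add: indicator_def of_bool_conj)
    also have "\<dots> = emeasure lborel {z::complex. cmod z < 1 \<and> x < cmod z}"
      by (rule nn_integral_indicator) measurable
    finally show ?thesis .
  qed
  have pi2: "unit_ball_vol 2 = pi" by (rule unit_ball_vol_2)
  have N: "emeasure ?N {x<..} = (\<integral>\<^sup>+s. ennreal (2 * pi * s) * indicator {max 0 x<..<1} s \<partial>lborel)" for x
  proof -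
    have "emeasure ?N {x<..} = (\<integral>\<^sup>+s. ennreal (2 * pi * s) * indicator {0..<1} s * indicator {x<..} s \<partial>lborel)"
      by (subst emeasure_density) auto
    also have "\<dots> = (\<integral>\<^sup>+s. ennreal (2 * pi * s) * indicator {max 0 x<..<1} s \<partial>lborel)"
    proof (intro nn_integral_cong_AE)
      show "AE s in lborel. ennreal (2 * pi * s) * indicator {0..<1} s * indicator {x<..} s =
          ennreal (2 * pi * s) * indicator {max 0 x<..<1} s"
        using AE_lborel_singleton[of 0] by eventually_elim (auto simp: indicator_def)
    qed
    finally show ?thesis .
  qed
  have N': "(\<integral>\<^sup>+s. ennreal (2 * pi * s) * indicator {a<..<1} s \<partial>lborel) = ennreal (pi - pi * a\<^sup>2)"
    if "0 \<le> a" "a \<le> 1" for a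
  proof -
    have "(\<integral>\<^sup>+s. ennreal (2 * pi * s) * indicator {a<..<1} s \<partial>lborel) = 
      (\<integral>\<^sup>+s. ennreal (2 * pi * s) * indicator {a..1} s \<partial>lborel)"
    proof (intro nn_integral_cong_AE)
      show "AE s in lborel. ennreal (2 * pi * s) * indicator {a<..<1} s = ennreal (2 * pi * s) * indicator {a..1} s"
        using AE_lborel_singleton[of 1] AE_lborel_singleton[of a]
        by eventually_elim (auto simp: indicator_def)
    qed
    also have "\<dots> = ennreal (pi * 1\<^sup>2 - pi * a\<^sup>2)"
      using that by (intro nn_integral_FTC_Icc) (auto intro!: derivative_eq_intros)
    finally show ?thesis by simp
  qed
  have M': "emeasure lborel {z::complex. cmod z < 1 \<and> a < cmod z} = ennreal (pi - pi * a\<^sup>2)"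
    if "0 \<le> a" "a \<le> 1" for a
  proof -
    have set: "{z::complex. cmod z < 1 \<and> a < cmod z} = ball 0 1 - (cball 0 a \<inter> ball 0 1)" by auto
    have "emeasure lborel (cball (0::complex) a \<inter> ball 0 1) = ennreal (pi * a\<^sup>2)"
    proof (cases "a = 1")
      case True
      then have "cball (0::complex) a \<inter> ball 0 1 = ball 0 1" by auto
      then show ?thesis using True emeasure_ball[of 1 "0::complex"] pi2 by simp
    next
      case False
      then have "cball (0::complex) a \<inter> ball 0 1 = cball 0 a" using that by auto
      then show ?thesis using emeasure_cball[of a "0::complex"] pi2 that by simp
    qed
    moreover have "emeasure lborel (ball (0::complex) 1) = ennreal pi"
      using emeasure_ball[of 1 "0::complex"] pi2 by simp
    ultimately show ?thesis
      unfolding set by (subst emeasure_Diff) (auto simp: ennreal_minus)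
  qed
  show "emeasure ?M {x<..} = emeasure ?N {x<..}" for x
  proof -
    consider "x < 0" | "0 \<le> x" "x \<le> 1" | "x > 1" by linarith
    then show ?thesis
    proof cases
      case 1
      have "x < cmod z" for z :: complex using 1 norm_ge_zero[of z] by linarith
      then have "{z::complex. cmod z < 1 \<and> x < cmod z} = ball 0 1" by auto
      then have "emeasure ?M {x<..} = ennreal pi"
        using M[of x] emeasure_ball[of 1 "0::complex"] pi2 by simp
      then show ?thesis using N[of x] N'[of 0] 1 by simp
    next
      case 2
      then show ?thesis using M N N' M' by simp
    next
      case 3
      then have "{z::complex. cmod z < 1 \<and> x < cmod z} = {}" by auto
      then have "emeasure lborel {z::complex. cmod z < 1 \<and> x < cmod z} = 0" by (simp only: emeasure_empty)
      moreover have "{max 0 x<..<1} = {}" using 3 by auto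
      ultimately show ?thesis using M[of x] N[of x] by simp
    qed
  qed
  show "emeasure ?M {x<..} < \<infinity>" for x
  proof -
    have "emeasure ?M {x<..} \<le> emeasure lborel (ball (0::complex) 1)"
      unfolding M by (intro emeasure_mono) auto
    also have "\<dots> < \<infinity>" using emeasure_ball[of 1 "0::complex"] by simp
    finally show ?thesis .
  qed
qed auto

lemma nn_integral_radial_unit_disc:
  fixes k :: "real \<Rightarrow> ennreal"
  assumes [measurable]: "k \<in> borel_measurable borel"
  shows "(\<integral>\<^sup>+z\<in>ball 0 1. k (cmod z) \<partial>lborel) = (\<integral>\<^sup>+s\<in>{0..<1}. k s * ennreal (2 * pi * s) \<partial>lborel)"
proof -
  have [measurable]: "ball (0::complex) 1 \<in> sets borel" by simp
  have "(\<integral>\<^sup>+z\<in>ball 0 1. k (cmod z) \<partial>lborel) = (\<integral>\<^sup>+z. k (cmod z) \<partial>density lborel (indicator (ball 0 1)))"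
    by (subst nn_integral_density) (auto simp: mult.commute)
  also have "\<dots> = (\<integral>\<^sup>+s. k s \<partial>distr (density lborel (indicator (ball (0::complex) 1))) borel cmod)"
    by (subst nn_integral_distr) auto
  also have "\<dots> = (\<integral>\<^sup>+s\<in>{0..<1}. k s * ennreal (2 * pi * s) \<partial>lborel)"
    unfolding distr_cmod_unit_disc by (subst nn_integral_density) (auto simp: mult_ac)
  finally show ?thesis .
qed

lemma nn_integral_period:
  fixes k :: "real \<Rightarrow> ennreal"
  assumes [measurable]: "k \<in> borel_measurable borel" and per: "\<And>x. k (x + 2 * pi) = k x"
    and b: "0 \<le> b" "b \<le> 2 * pi"
  shows "(\<integral>\<^sup>+x\<in>{-pi..<pi}. k (x + b) \<partial>lborel) = (\<integral>\<^sup>+x\<in>{-pi..<pi}. k x \<partial>lborel)"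
proof -
  have "(\<integral>\<^sup>+x\<in>{-pi..<pi}. k (x + b) \<partial>lborel) = (\<integral>\<^sup>+x. k (x + b) * indicator {b-pi..<b+pi} (x + b) \<partial>lborel)"
    by (intro nn_integral_cong) (auto simp: indicator_def)
  also have "\<dots> = (\<integral>\<^sup>+x. k x * indicator {b-pi..<b+pi} x \<partial>lborel)"
    by (rule nn_integral_shift) measurable
  also have "\<dots> = (\<integral>\<^sup>+x. k x * indicator {b-pi..<pi} x + k x * indicator {pi..<b+pi} x \<partial>lborel)"
    using b by (intro nn_integral_cong) (auto simp: indicator_def)
  also have "\<dots> = (\<integral>\<^sup>+x. k x * indicator {b-pi..<pi} x \<partial>lborel) + (\<integral>\<^sup>+x. k x * indicator {pi..<b+pi} x \<partial>lborel)"
    by (rule nn_integral_add) measurable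
  also have "(\<integral>\<^sup>+x. k x * indicator {pi..<b+pi} x \<partial>lborel) = 
      (\<integral>\<^sup>+x. k (x + 2 * pi) * indicator {pi..<b+pi} (x + 2 * pi) \<partial>lborel)"
    by (rule nn_integral_shift[symmetric]) measurable
  also have "\<dots> = (\<integral>\<^sup>+x. k x * indicator {-pi..<b-pi} x \<partial>lborel)"
    by (intro nn_integral_cong) (auto simp: indicator_def per)
  also have "(\<integral>\<^sup>+x. k x * indicator {b-pi..<pi} x \<partial>lborel) + \<dots> = 
     (\<integral>\<^sup>+x. k x * indicator {b-pi..<pi} x + k x * indicator {-pi..<b-pi} x \<partial>lborel)"
    by (rule nn_integral_add[symmetric]) measurable
  also have "\<dots> = (\<integral>\<^sup>+x\<in>{-pi..<pi}. k x \<partial>lborel)"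
    using b by (intro nn_integral_cong) (auto simp: indicator_def)
  finally show ?thesis .
qed

text \<open>Averaging over all rotations replaces the integrand by its mean over circles, which is radial; what is left is the
  distribution of \<open>cmod\<close>.\<close>

theorem nn_integral_polar:
  fixes g :: "complex \<Rightarrow> ennreal"
  assumes [measurable]: "g \<in> borel_measurable borel"
  shows "(\<integral>\<^sup>+z\<in>ball 0 1. g z \<partial>lborel) =
    (\<integral>\<^sup>+s\<in>{0..<1}. ennreal s * (\<integral>\<^sup>+a\<in>{-pi..<pi}. g (of_real s * cis a) \<partial>lborel) \<partial>lborel)"
proof -
  let ?D = "ball (0::complex) 1"
  have [measurable]: "?D \<in> sets borel" by simp
  have cis_meas [measurable]: "cis \<in> borel_measurable borel"
    by (intro borel_measurable_continuous_onI continuous_intros)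
  define G where "G s = (\<integral>\<^sup>+a\<in>{-pi..<pi}. g (of_real s * cis a) \<partial>lborel)" for s
  have G [measurable]: "G \<in> borel_measurable borel"
    unfolding G_def[abs_def] by measurable
  have radial: "(\<integral>\<^sup>+a\<in>{-pi..<pi}. g (cis a * z) \<partial>lborel) = G (cmod z)" for z
  proof -
    obtain r b :: real where z: "z = of_real r * (cos b + \<i> * sin b)" "0 \<le> r" "0 \<le> b" "b < 2 * pi"
      by (rule complex_split_polar[of z]) blast
    then have z': "z = of_real r * cis b" by (simp add: cis.code Complex_eq)
    have "(\<integral>\<^sup>+a\<in>{-pi..<pi}. g (cis a * z) \<partial>lborel) = (\<integral>\<^sup>+a\<in>{-pi..<pi}. g (of_real r * cis (a + b)) \<partial>lborel)"
      by (intro nn_integral_cong) (simp add: z' cis_mult[symmetric] mult_ac)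
    also have "\<dots> = (\<integral>\<^sup>+a\<in>{-pi..<pi}. g (of_real r * cis a) \<partial>lborel)"
      using z by (intro nn_integral_period) (auto simp: cis_mult[symmetric] complex_eq_iff)
    finally show ?thesis using z' z(2) by (simp add: G_def norm_mult)
  qed
  have "ennreal (2 * pi) * (\<integral>\<^sup>+z\<in>?D. g z \<partial>lborel) = (\<integral>\<^sup>+a. (\<integral>\<^sup>+z\<in>?D. g z \<partial>lborel) * indicator {-pi..<pi} a \<partial>lborel)"
    by (subst nn_integral_cmult_indicator) (auto simp: mult.commute)
  also have "\<dots> = (\<integral>\<^sup>+a. (\<integral>\<^sup>+z. g (cis a * z) * indicator ?D z * indicator {-pi..<pi} a \<partial>lborel) \<partial>lborel)"
  proof (intro nn_integral_cong)
    fix a :: real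
    have "(\<integral>\<^sup>+z\<in>?D. g z \<partial>lborel) = (\<integral>\<^sup>+z. g (cis a * z) * indicator ?D (cis a * z) \<partial>lborel)"
      by (rule nn_integral_rotation[symmetric]) auto
    also have "\<dots> = (\<integral>\<^sup>+z. g (cis a * z) * indicator ?D z \<partial>lborel)"
      by (intro nn_integral_cong) (simp add: indicator_def norm_mult)
    finally show "(\<integral>\<^sup>+z\<in>?D. g z \<partial>lborel) * indicator {-pi..<pi} a =
        (\<integral>\<^sup>+z. g (cis a * z) * indicator ?D z * indicator {-pi..<pi} a \<partial>lborel)"
      by (simp add: nn_integral_multc)
  qed
  also have "\<dots> = (\<integral>\<^sup>+z. (\<integral>\<^sup>+a. g (cis a * z) * indicator ?D z * indicator {-pi..<pi} a \<partial>lborel) \<partial>lborel)"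
    by (rule lborel_pair.Fubini') measurable
  also have "\<dots> = (\<integral>\<^sup>+z. G (cmod z) * indicator ?D z \<partial>lborel)"
  proof (intro nn_integral_cong)
    fix z :: complex
    have "(\<integral>\<^sup>+a. g (cis a * z) * indicator ?D z * indicator {-pi..<pi} a \<partial>lborel) =
      (\<integral>\<^sup>+a. (g (cis a * z) * indicator {-pi..<pi} a) * indicator ?D z \<partial>lborel)"
      by (simp add: mult_ac)
    also have "\<dots> = G (cmod z) * indicator ?D z"
      by (subst nn_integral_multc) (auto simp: radial)
    finally show "(\<integral>\<^sup>+a. g (cis a * z) * indicator ?D z * indicator {-pi..<pi} a \<partial>lborel) = G (cmod z) * indicator ?D z" .
  qed
  also have "\<dots> = (\<integral>\<^sup>+s\<in>{0..<1}. G s * ennreal (2 * pi * s) \<partial>lborel)"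
    by (rule nn_integral_radial_unit_disc) measurable
  also have "\<dots> = (\<integral>\<^sup>+s. ennreal (2 * pi) * (ennreal s * G s * indicator {0..<1} s) \<partial>lborel)"
    by (intro nn_integral_cong) (auto simp: indicator_def ennreal_mult mult_ac)
  also have "\<dots> = ennreal (2 * pi) * (\<integral>\<^sup>+s\<in>{0..<1}. ennreal s * G s \<partial>lborel)"
    by (rule nn_integral_cmult) measurable
  finally show ?thesis
    by (simp add: G_def ennreal_mult_cancel_left)
qed

text \<open>Null sets of radii give null sets in the disc, so that a radial weight may be changed on a null set of its profile.\<close>

lemma AE_cmod:
  assumes "AE s in lborel. P s"
  shows "AE z in lborel. z \<in> ball 0 1 \<longrightarrow> P (cmod z)"
proof -
  obtain N where N: "\<And>s. s \<in> space lborel - N \<Longrightarrow> P s" "N \<in> null_sets lborel"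
    using AE_E3[OF assms] by blast
  have N' [measurable]: "N \<in> sets borel" using N(2) by (metis null_setsD2 sets_lborel)
  have [measurable]: "ball (0::complex) 1 \<in> sets borel" by simp
  have ae: "AE s in lborel. indicator N s * ennreal (2 * pi * s) * indicator {0..<1} s = 0"
    using AE_not_in[OF N(2)] by eventually_elim simp
  have "(\<integral>\<^sup>+z. indicator N (cmod z) * indicator (ball 0 1) z \<partial>(lborel :: complex measure)) =
      (\<integral>\<^sup>+s. indicator N s * ennreal (2 * pi * s) * indicator {0..<1} s \<partial>lborel)"
    by (rule nn_integral_radial_unit_disc) measurable
  also have "\<dots> = 0"
    by (subst nn_integral_0_iff_AE) (measurable, rule ae)
  finally have "AE z in (lborel :: complex measure). (indicator N (cmod z) * indicator (ball 0 1) z :: ennreal) = 0"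
    by (subst (asm) nn_integral_0_iff_AE) measurable
  then show ?thesis
  proof eventually_elim
    case (elim z)
    then show ?case using N(1)[of "cmod z"] by (cases "cmod z \<in> N") (simp_all add: indicator_eq_0_iff)
  qed
qed

section \<open>Tails and moments of radial weights\<close>

lemma nn_integral_powr_deriv:
  assumes "0 < x" "0 \<le> r"
  shows "(\<integral>\<^sup>+s. ennreal (x * s powr (x - 1)) * indicator {0..r} s \<partial>lborel) = ennreal (r powr x)"
proof -
  have h: "((\<lambda>s. s powr (x-1)) has_integral (r powr (x - 1 + 1) / (x - 1 + 1))) {0..r}"
    using assms by (intro has_integral_powr_from_0) auto
  have "(\<integral>\<^sup>+s. ennreal (s powr (x - 1)) * indicator {0..r} s \<partial>lborel) = ennreal (r powr x / x)"
    using nn_integral_has_integral_lebesgue'[OF _ h] assms by simp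
  then have "ennreal x * (\<integral>\<^sup>+s. ennreal (s powr (x - 1)) * indicator {0..r} s \<partial>lborel) = ennreal x * ennreal (r powr x / x)"
    by simp
  then show ?thesis
    using assms by (simp add: nn_integral_cmult[symmetric] ennreal_mult mult.assoc)
      (simp add: ennreal_mult[symmetric])
qed

text \<open>This is where a difference of moments gains a factor \<open>1 / a\<close>: the mass of \<open>r powr a\<close> sits at distance about \<open>1 / a\<close> from \<open>1\<close>.\<close>

lemma powr_times_one_minus_le: 
  fixes r a :: real
  assumes "0 \<le> r" "r \<le> 1" "0 < a" shows "r powr a * (1 - r) \<le> 1 / a"
proof (cases "r = 0")
  case False
  then have "r powr a = exp (a * ln r)" using assms by (simp add: powr_def)
  also have "\<dots> \<le> exp (- (a * (1 - r)))"
  proof -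
    have "a * ln r \<le> a * (r - 1)" using ln_le_minus_one[of r] False assms by (intro mult_left_mono) auto
    then show ?thesis by (simp add: algebra_simps)
  qed
  also have "\<dots> = inverse (exp (a * (1 - r)))" by (rule exp_minus)
  also have "\<dots> \<le> inverse (1 + a * (1 - r))"
    using assms exp_ge_add_one_self[of "a * (1-r)"] by (intro le_imp_inverse_le) (auto intro: add_pos_nonneg)
  finally have "r powr a * (1 - r) \<le> inverse (1 + a * (1 - r)) * (1 - r)"
    using assms by (intro mult_right_mono) auto
  also have "\<dots> \<le> 1 / a"
  proof -
    have "0 < 1 + a * (1 - r)" using assms by (intro add_pos_nonneg) auto
    then show ?thesis using assms by (simp add: field_simps)
  qed
  finally show ?thesis .
qed (use assms in auto)

text \<open>A radial weight with a Borel profile that vanishes off \<open>[0,1)\<close>. Tonelli's theorem can then be used with the Borel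
  measure, and the integrals need no restriction to \<open>[0,1)\<close>. A general radial weight agrees almost everywhere with such a profile.\<close>

locale borel_weight =
  fixes w :: "real \<Rightarrow> real"
  assumes borel [measurable]: "w \<in> borel_measurable borel"
    and nonneg [simp]: "\<And>x. 0 \<le> w x"
    and support: "\<And>x. x \<notin> {0..<1} \<Longrightarrow> w x = 0"
    and integrable: "integrable lborel w"
    and hat_pos: "\<And>r. \<lbrakk>0 \<le> r; r < 1\<rbrakk> \<Longrightarrow> 0 < weight_hat w r"
begin

lemma set_integrable_w: "A \<in> sets borel \<Longrightarrow> set_integrable lborel A w"
  unfolding set_integrable_def using integrable by (intro integrable_mult_indicator) auto

lemma hat_lborel: "weight_hat w r = (LINT s:{r..<1}|lborel. w s)"
  unfolding weight_hat_def set_lebesgue_integral_def by (rule integral_completion) measurable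

lemma hat_lborel_closed: "weight_hat w r = (LINT s:{r..1}|lborel. w s)"
  unfolding hat_lborel set_lebesgue_integral_def
  by (intro Bochner_Integration.integral_cong) (auto simp: support split: split_indicator)

lemma hat_nn: "ennreal (weight_hat w r) = (\<integral>\<^sup>+s. ennreal (w s) * indicator {r..} s \<partial>lborel)"
proof -
  have "ennreal (weight_hat w r) = (\<integral>\<^sup>+s. ennreal (indicator {r..<1} s *\<^sub>R w s) \<partial>lborel)"
    unfolding hat_lborel set_lebesgue_integral_def
    using set_integrable_w[of "{r..<1}"] unfolding set_integrable_def
    by (intro nn_integral_eq_integral[symmetric]) auto
  also have "\<dots> = (\<integral>\<^sup>+s. ennreal (w s) * indicator {r..} s \<partial>lborel)"
    by (intro nn_integral_cong) (auto simp: support split: split_indicator)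
  finally show ?thesis .
qed

lemma hat_nonneg [simp]: "0 \<le> weight_hat w r"
  unfolding hat_lborel set_lebesgue_integral_def by (rule integral_nonneg_AE) simp

lemma hat_antimono: "r \<le> s \<Longrightarrow> weight_hat w s \<le> weight_hat w r"
proof -
  assume "r \<le> s"
  then have "ennreal (weight_hat w s) \<le> ennreal (weight_hat w r)"
    unfolding hat_nn by (intro nn_integral_mono) (auto simp: indicator_def)
  then show ?thesis by simp
qed

lemma hat_measurable [measurable]: "weight_hat w \<in> borel_measurable borel"
proof -
  have "(\<lambda>r. - weight_hat w r) \<in> borel_measurable borel"
    by (rule borel_measurable_mono) (auto simp: mono_def hat_antimono)
  then show ?thesis by (subst borel_measurable_uminus_eq[symmetric])
qed

lemma integrable_powr: "0 \<le> x \<Longrightarrow> integrable lborel (\<lambda>r. r powr x * w r)"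
proof (rule Bochner_Integration.integrable_bound[OF integrable])
  assume x: "0 \<le> x"
  show "AE r in lborel. norm (r powr x * w r) \<le> norm (w r)"
  proof (rule AE_I2)
    fix r
    show "norm (r powr x * w r) \<le> norm (w r)"
    proof (cases "r \<in> {0..<1}")
      case True
      then have "r powr x \<le> 1" using x by (simp add: powr_le1)
      then show ?thesis by (simp add: abs_mult mult_left_le_one_le)
    qed (simp add: support)
  qed
qed simp

lemma moment_lborel: "weight_moment w x = (LINT r|lborel. r powr x * w r)"
proof -
  have "weight_moment w x = (LINT r|lebesgue. r powr x * w r)"
    unfolding weight_moment_def set_lebesgue_integral_def
    by (intro Bochner_Integration.integral_cong) (auto simp: support split: split_indicator)
  then show ?thesis by (simp add: integral_completion)
qed

lemma moment_nn: "0 \<le> x \<Longrightarrow> ennreal (weight_moment w x) = (\<integral>\<^sup>+r. ennreal (r powr x * w r) \<partial>lborel)"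
  unfolding moment_lborel using integrable_powr by (intro nn_integral_eq_integral[symmetric]) auto

lemma moment_nonneg [simp]: "0 \<le> weight_moment w x"
  unfolding moment_lborel by (rule integral_nonneg_AE) simp

text \<open>The part of the moment beyond \<open>\<rho>\<close>.\<close>

lemma powr_hat_le_moment:
  assumes "0 \<le> \<rho>" "0 \<le> x"
  shows "\<rho> powr x * weight_hat w \<rho> \<le> weight_moment w x"
proof -
  have "ennreal (\<rho> powr x * weight_hat w \<rho>) = ennreal (\<rho> powr x) * (\<integral>\<^sup>+s. ennreal (w s) * indicator {\<rho>..} s \<partial>lborel)"
    by (simp add: ennreal_mult hat_nn)
  also have "\<dots> = (\<integral>\<^sup>+s. ennreal (\<rho> powr x) * (ennreal (w s) * indicator {\<rho>..} s) \<partial>lborel)"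
    by (rule nn_integral_cmult[symmetric]) measurable
  also have "\<dots> \<le> (\<integral>\<^sup>+r. ennreal (r powr x * w r) \<partial>lborel)"
    using assms by (intro nn_integral_mono)
      (auto simp: indicator_def ennreal_mult[symmetric] intro!: ennreal_leI mult_right_mono powr_mono2)
  also have "\<dots> = ennreal (weight_moment w x)" using assms by (simp add: moment_nn)
  finally show ?thesis by simp
qed

lemma moment_pos: "0 \<le> x \<Longrightarrow> 0 < weight_moment w x"
proof -
  assume x: "0 \<le> x"
  have "0 < (1/2::real) powr x * weight_hat w (1/2)" by (intro mult_pos_pos hat_pos) auto
  then show ?thesis using powr_hat_le_moment[of "1/2" x] x by linarith
qed

lemma moment_antimono: "0 \<le> x \<Longrightarrow> x \<le> y \<Longrightarrow> weight_moment w y \<le> weight_moment w x"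
proof -
  assume xy: "0 \<le> x" "x \<le> y"
  have "weight_moment w y \<le> weight_moment w x"
    unfolding moment_lborel
  proof (rule integral_mono)
    fix r
    show "r powr y * w r \<le> r powr x * w r"
    proof (cases "r \<in> {0..<1}")
      case True
      have "r powr y \<le> r powr x"
        using True xy by (cases "r = 0") (auto intro!: powr_mono')
      then show ?thesis by (rule mult_right_mono) simp
    qed (simp add: support)
  qed (use xy integrable_powr in auto)
  then show ?thesis .
qed

end

locale doubling_weight = borel_weight +
  fixes C :: real
  assumes C: "1 \<le> C"
    and doubling: "\<And>r. \<lbrakk>0 \<le> r; r < 1\<rbrakk> \<Longrightarrow> weight_hat w r \<le> C * weight_hat w ((1 + r) / 2)"
begin

text \<open>Write \<open>r powr x\<close> as the integral of its derivative, so that the moment becomes an average of tails; apply the doubling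
  condition to the tails, and undo the first step. This turns \<open>r\<close> into \<open>2 * u - 1 \<le> u\<^sup>2\<close>, and \<open>(u\<^sup>2) powr x\<close> is the
  integrand of the moment of order \<open>2 * x\<close>.\<close>

lemma moment_doubling:
  assumes x: "0 < x"
  shows "weight_moment w x \<le> C * weight_moment w (2 * x)"
proof -
  define k where "k s = ennreal (x * s powr (x - 1)) * indicator {0..} s" for s
  have [measurable]: "k \<in> borel_measurable borel" unfolding k_def[abs_def] by measurable
  have k: "(\<integral>\<^sup>+s. k s * indicator {s. s \<le> r} s \<partial>lborel) = ennreal (r powr x)" if "0 \<le> r" for r
    unfolding k_def nn_integral_powr_deriv[OF x that, symmetric]
    by (intro nn_integral_cong) (auto simp: indicator_def)
  have "ennreal (weight_moment w x) = (\<integral>\<^sup>+r. ennreal (w r) * (\<integral>\<^sup>+s. k s * indicator {s. s \<le> r} s \<partial>lborel) \<partial>lborel)"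
    unfolding moment_nn[OF less_imp_le[OF x]]
  proof (intro nn_integral_cong)
    fix r
    show "ennreal (r powr x * w r) = ennreal (w r) * (\<integral>\<^sup>+s. k s * indicator {s. s \<le> r} s \<partial>lborel)"
      by (cases "r \<in> {0..<1}") (auto simp: k support ennreal_mult mult.commute)
  qed
  also have "\<dots> = (\<integral>\<^sup>+s. k s * ennreal (weight_hat w s) \<partial>lborel)"
    unfolding hat_nn by (rule nn_integral_triangle_swap[symmetric]) measurable
  also have "\<dots> \<le> (\<integral>\<^sup>+s. ennreal C * (k s * ennreal (weight_hat w ((1 + s) / 2))) \<partial>lborel)"
  proof (intro nn_integral_mono)
    fix s
    have "weight_hat w s \<le> C * weight_hat w ((1 + s) / 2)" if "0 \<le> s"
    proof (cases "s < 1")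
      case False
      then have "ennreal (weight_hat w s) = 0"
        unfolding hat_nn by (subst nn_integral_0_iff_AE) (auto simp: indicator_def support)
      then have "weight_hat w s = 0" using hat_nonneg[of s] by (simp add: ennreal_eq_0_iff)
      then show ?thesis using C by simp
    qed (use doubling that in auto)
    then have "k s * ennreal (weight_hat w s) \<le> k s * ennreal (C * weight_hat w ((1 + s) / 2))"
      by (cases "0 \<le> s") (auto simp: k_def intro!: mult_left_mono ennreal_leI)
    also have "\<dots> = ennreal C * (k s * ennreal (weight_hat w ((1 + s) / 2)))"
      using C by (simp add: ennreal_mult mult_ac)
    finally show "k s * ennreal (weight_hat w s) \<le> \<dots>" .
  qed
  also have "\<dots> = ennreal C * (\<integral>\<^sup>+s. k s * ennreal (weight_hat w ((1 + s) / 2)) \<partial>lborel)"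
    by (rule nn_integral_cmult) measurable
  also have "(\<integral>\<^sup>+s. k s * ennreal (weight_hat w ((1 + s) / 2)) \<partial>lborel) =
      (\<integral>\<^sup>+u. ennreal (w u) * (\<integral>\<^sup>+s. k s * indicator {s. (1 + s) / 2 \<le> u} s \<partial>lborel) \<partial>lborel)"
    unfolding hat_nn by (rule nn_integral_triangle_swap) measurable
  also have "ennreal C * \<dots> \<le> ennreal C * (\<integral>\<^sup>+u. ennreal (u powr (2 * x) * w u) \<partial>lborel)"
  proof (intro mult_left_mono nn_integral_mono)
    fix u :: real
    let ?m = "max 0 (2 * u - 1)"
    have "(\<integral>\<^sup>+s. k s * indicator {s. (1 + s) / 2 \<le> u} s \<partial>lborel) \<le> (\<integral>\<^sup>+s. k s * indicator {s. s \<le> ?m} s \<partial>lborel)"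
      by (intro nn_integral_mono) (auto simp: indicator_def)
    also have "\<dots> \<le> ennreal ((u\<^sup>2) powr x)"
    proof -
      have "0 \<le> (u - 1)\<^sup>2" by simp
      then have "?m \<le> u\<^sup>2" by (simp add: power2_eq_square algebra_simps)
      then show ?thesis using x by (subst k) (auto intro!: ennreal_leI powr_mono2)
    qed
    finally have "ennreal (w u) * (\<integral>\<^sup>+s. k s * indicator {s. (1 + s) / 2 \<le> u} s \<partial>lborel) \<le> ennreal (w u) * ennreal ((u\<^sup>2) powr x)"
      by (rule mult_left_mono) simp
    also have "\<dots> = ennreal (u powr (2 * x) * w u)"
    proof (cases "u \<in> {0..<1}")
      case True
      have "(u\<^sup>2) powr x = (u powr 2) powr x" using True by simp
      also have "\<dots> = u powr (2 * x)" by (simp only: powr_powr)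
      finally have "(u\<^sup>2) powr x = u powr (2 * x)" .
      then show ?thesis by (simp add: ennreal_mult mult_ac)
    qed (simp add: support)
    finally show "ennreal (w u) * (\<integral>\<^sup>+s. k s * indicator {s. (1 + s) / 2 \<le> u} s \<partial>lborel) \<le> ennreal (u powr (2 * x) * w u)" .
  qed simp
  also have "\<dots> = ennreal (C * weight_moment w (2 * x))"
    using x C by (simp add: ennreal_mult moment_nn)
  finally show ?thesis using C by (simp add: ennreal_le_iff)
qed

lemma moment_doubling_iterate:
  assumes x: "0 < x"
  shows "weight_moment w x \<le> C ^ k * weight_moment w (2 ^ k * x)"
proof (induction k)
  case (Suc k)
  have "weight_moment w x \<le> C ^ k * weight_moment w (2 ^ k * x)" by fact
  also have "\<dots> \<le> C ^ k * (C * weight_moment w (2 * (2 ^ k * x)))"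
    using C x by (intro mult_left_mono moment_doubling) auto
  finally show ?case by (simp add: mult_ac)
qed simp

text \<open>The tail at \<open>\<rho>\<close> dominates the moment as soon as \<open>\<rho> powr x\<close> is small. Doubling the order \<open>k\<close> times costs \<open>C ^ k\<close>,
  while on \<open>[0, \<rho>]\<close> it gains \<open>exp (- (2 ^ k - 1))\<close>; for large \<open>k\<close> the gain wins, and this part of the moment can be absorbed.\<close>

lemma moment_le_hat:
  obtains A where "0 < A" "\<And>x \<rho>. \<lbrakk>0 < x; 0 \<le> \<rho>; \<rho> < 1; \<rho> powr x \<le> exp (- 1)\<rbrakk> \<Longrightarrow>
    weight_moment w x \<le> A * weight_hat w \<rho>"
proof -
  obtain k :: nat where k: "C ^ k * exp (- ((2::real) ^ k - 1)) \<le> 1 / 2"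
  proof -
    obtain j :: nat where j: "2 * ln C + 2 \<le> real j" using real_arch_simple by blast
    have j1: "1 \<le> real j" using j C by (smt (verit) ln_ge_zero)
    have "real j < 2 ^ j" by (rule of_nat_less_two_power)
    then have "real j * real j \<le> 2 ^ j * 2 ^ j" by (intro mult_mono) auto
    then have jj: "real j * real j \<le> 2 ^ (2 * j)" by (simp add: power_mult power2_eq_square power_mult_distrib[symmetric])
    have "real j * (2 * ln C + 2) \<le> real j * real j" using j by (intro mult_left_mono) auto
    then have "real (2 * j) * ln C - (2 ^ (2 * j) - 1) \<le> - 1"
      using jj j1 by (simp add: algebra_simps)
    then have "exp (real (2 * j) * ln C - (2 ^ (2 * j) - 1)) \<le> exp (- 1)" by (simp only: exp_le_cancel_iff)
    moreover have "exp (real (2 * j) * ln C) = C ^ (2 * j)" using C by (simp only: exp_of_nat_mult) simp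
    moreover have "exp (- 1) \<le> (1 / 2 :: real)"
      using exp_ge_add_one_self[of 1] by (simp add: exp_minus field_simps)
    moreover have split: "exp (a - b) = exp a * exp (- b)" for a b :: real
      by (simp add: mult_exp_exp)
    ultimately have "C ^ (2 * j) * exp (- ((2::real) ^ (2 * j) - 1)) \<le> 1 / 2"
      using split[of "real (2 * j) * ln C" "2 ^ (2 * j) - 1"] by simp
    then show ?thesis by (rule that)
  qed
  show ?thesis
  proof (rule that[of "2 * C ^ k"])
    show "0 < 2 * C ^ k" using C by simp
    fix x \<rho> :: real assume x: "0 < x" and \<rho>: "0 \<le> \<rho>" "\<rho> < 1" and small: "\<rho> powr x \<le> exp (- 1)"
    let ?e = "exp (- ((2::real) ^ k - 1))"
    have k1: "(1::real) \<le> 2 ^ k" by simp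
    have split: "weight_moment w (2 ^ k * x) \<le> ?e * weight_moment w x + weight_hat w \<rho>"
    proof -
      have "ennreal (weight_moment w (2 ^ k * x)) = (\<integral>\<^sup>+r. ennreal (r powr (2 ^ k * x) * w r) \<partial>lborel)"
        using x by (intro moment_nn) auto
      also have "\<dots> \<le> (\<integral>\<^sup>+r. ennreal ?e * ennreal (r powr x * w r) + ennreal (w r) * indicator {\<rho>..} r \<partial>lborel)"
      proof (intro nn_integral_mono)
        fix r
        consider "r \<notin> {0..<1}" | "0 \<le> r" "r < \<rho>" | "\<rho> \<le> r" "r < 1" "0 \<le> r" using \<rho> by fastforce
        then show "ennreal (r powr (2 ^ k * x) * w r) \<le> ennreal ?e * ennreal (r powr x * w r) + ennreal (w r) * indicator {\<rho>..} r"
        proof cases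
          case 1
          then show ?thesis by (simp add: support)
        next
          case 2
          have "r powr ((2 ^ k - 1) * x) = (r powr x) powr (2 ^ k - 1)"
            by (simp add: powr_powr mult.commute)
          also have "\<dots> \<le> (exp (- 1)) powr (2 ^ k - 1)"
          proof (rule powr_mono2)
            have "r powr x \<le> \<rho> powr x" using 2 x by (intro powr_mono2) auto
            then show "r powr x \<le> exp (- 1)" using small by linarith
          qed (use k1 in auto)
          also have "\<dots> = ?e" by (simp add: exp_powr_real algebra_simps)
          finally have le: "r powr ((2 ^ k - 1) * x) \<le> ?e" .
          have "r powr (2 ^ k * x) = r powr ((2 ^ k - 1) * x) * r powr x"
            by (simp add: powr_add[symmetric] algebra_simps)
          also have "\<dots> \<le> ?e * r powr x" using le by (intro mult_right_mono) auto
          finally have "r powr (2 ^ k * x) * w r \<le> ?e * r powr x * w r" by (rule mult_right_mono) simp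
          then show ?thesis using 2 by (simp add: ennreal_mult[symmetric] mult_ac ennreal_leI)
        next
          case 3
          then have "r powr (2 ^ k * x) \<le> 1" using x by (intro powr_le1) auto
          then have "r powr (2 ^ k * x) * w r \<le> w r" by (simp add: mult_left_le_one_le)
          then show ?thesis using 3 by (auto intro!: add_increasing ennreal_leI)
        qed
      qed
      also have "\<dots> = ennreal ?e * ennreal (weight_moment w x) + ennreal (weight_hat w \<rho>)"
        using x by (subst nn_integral_add) (auto simp: nn_integral_cmult hat_nn moment_nn)
      also have "\<dots> = ennreal (?e * weight_moment w x + weight_hat w \<rho>)"
        by (simp add: ennreal_mult[symmetric] ennreal_plus[symmetric] del: ennreal_plus)
      finally show ?thesis by (subst (asm) ennreal_le_iff) auto
    qed
    have "weight_moment w x \<le> C ^ k * weight_moment w (2 ^ k * x)" by (rule moment_doubling_iterate[OF x])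
    also have "\<dots> \<le> C ^ k * (?e * weight_moment w x + weight_hat w \<rho>)"
      using C by (intro mult_left_mono split) auto
    also have "\<dots> = (C ^ k * ?e) * weight_moment w x + C ^ k * weight_hat w \<rho>" by (simp add: algebra_simps)
    also have "\<dots> \<le> 1 / 2 * weight_moment w x + C ^ k * weight_hat w \<rho>"
      using k by (intro add_right_mono mult_right_mono) auto
    finally show "weight_moment w x \<le> 2 * C ^ k * weight_hat w \<rho>" by simp
  qed
qed

text \<open>The Taylor coefficients of the kernel of the operator, that is, of the Bergman kernel after averaging.\<close>

definition kap :: "nat \<Rightarrow> real" where
  "kap n = 1 / (2 * (real n + 1) * weight_moment w (2 * real n + 1))"

lemma kap_pos: "0 < kap n"
  unfolding kap_def using moment_pos[of "2 * real n + 1"] by simp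

lemma moment_diff_le:
  "weight_moment w (2 * real n + 1) - weight_moment w (2 * real n + 3) \<le>
    4 * C / (2 * real n + 1) * weight_moment w (2 * real n + 1)"
proof -
  let ?m = "2 * real n + 1"
  have m: "0 < ?m" by simp
  have "weight_moment w ?m - weight_moment w (2 * real n + 3) =
     (LINT r|lborel. r powr ?m * w r - r powr (2 * real n + 3) * w r)"
    unfolding moment_lborel by (rule Bochner_Integration.integral_diff[symmetric]) (auto intro!: integrable_powr)
  also have "\<dots> \<le> (LINT r|lborel. 4 / ?m * (r powr (?m / 2) * w r))"
  proof (rule integral_mono)
    fix r
    show "r powr ?m * w r - r powr (2 * real n + 3) * w r \<le> 4 / ?m * (r powr (?m / 2) * w r)"
    proof (cases "r \<in> {0..<1}")
      case True
      have e: "r powr ?m = r powr (?m/2) * r powr (?m/2)" by (simp add: powr_add[symmetric])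
      have "r powr (2 * real n + 3) = r powr ?m * r\<^sup>2"
      proof -
        have "2 * real n + 3 = ?m + 2" by simp
        then have "r powr (2 * real n + 3) = r powr ?m * r powr 2" by (simp only: powr_add)
        then show ?thesis using True by simp
      qed
      then have "r powr ?m - r powr (2 * real n + 3) = r powr ?m * (1 - r\<^sup>2)" by (simp add: algebra_simps)
      then have "r powr ?m - r powr (2 * real n + 3) = r powr (?m/2) * (r powr (?m/2) * (1 - r)) * (1 + r)"
        unfolding e by (simp add: power2_eq_square algebra_simps)
      also have "\<dots> \<le> r powr (?m/2) * (r powr (?m/2) * (1 - r)) * 2"
        using True by (intro mult_left_mono) auto
      also have "\<dots> \<le> r powr (?m/2) * (1 / (?m/2)) * 2"
        using True by (intro mult_right_mono mult_left_mono powr_times_one_minus_le) auto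
      finally have "r powr ?m - r powr (2 * real n + 3) \<le> 4 / ?m * r powr (?m/2)" by (simp add: field_simps)
      then have "(r powr ?m - r powr (2 * real n + 3)) * w r \<le> 4 / ?m * r powr (?m/2) * w r"
        by (rule mult_right_mono) simp
      then show ?thesis by (simp add: algebra_simps)
    qed (simp add: support)
  qed (auto intro!: integrable_powr Bochner_Integration.integrable_diff integrable_divide integrable_mult_right)
  also have "\<dots> = 4 / ?m * weight_moment w (?m / 2)"
    unfolding moment_lborel by simp
  also have "\<dots> \<le> 4 / ?m * (C * weight_moment w ?m)"
  proof (rule mult_left_mono)
    have "2 * (?m / 2) = ?m" by simp
    then show "weight_moment w (?m / 2) \<le> C * weight_moment w ?m"
      using moment_doubling[of "?m / 2"] by (metis m half_gt_zero)
  qed simp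
  finally show ?thesis by simp
qed

text \<open>The coefficients vary slowly on the scale of \<open>n\<close>: both \<open>n + 1\<close> and the moments change by a relative amount \<open>O(1 / n)\<close>
  between neighbours. This is what makes one summation by parts effective in the kernel estimate.\<close>

lemma kap_diff_le:
  "\<bar>kap n - kap (Suc n)\<bar> \<le> (1 + 4 * C) * C\<^sup>2 * (kap n / (real n + 1))"
proof -
  let ?a = "weight_moment w (2 * real n + 1)" and ?b = "weight_moment w (2 * real n + 3)"
  have pos: "0 < ?a" "0 < ?b" by (auto intro!: moment_pos)
  have ba: "?b \<le> ?a" by (rule moment_antimono) auto
  have ab: "?a \<le> C\<^sup>2 * ?b"
  proof -
    have "?a \<le> C ^ 2 * weight_moment w (2 ^ 2 * (2 * real n + 1))" by (rule moment_doubling_iterate) simp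
    also have "\<dots> \<le> C ^ 2 * ?b" using C by (intro mult_left_mono moment_antimono) auto
    finally show ?thesis .
  qed
  let ?N = "real n + 1"
  have K: "kap n = 1 / (2 * (?N * ?a))" "kap (Suc n) = 1 / (2 * ((?N + 1) * ?b))"
    by (simp_all add: kap_def algebra_simps)
  have "?N * (?a - ?b) \<le> ?N * (4 * C / (2 * real n + 1) * ?a)"
    by (intro mult_left_mono moment_diff_le) auto
  also have "\<dots> = 4 * C * ?a * (?N / (2 * real n + 1))" by (simp add: field_simps)
  also have "\<dots> \<le> 4 * C * ?a * 1" using C pos by (intro mult_left_mono) (auto simp: field_simps)
  finally have "?N * (?a - ?b) \<le> 4 * C * ?a" by simp
  moreover have "0 \<le> ?N * (?a - ?b)" using ba by simp
  ultimately have num: "\<bar>(?N + 1) * ?b - ?N * ?a\<bar> \<le> (1 + 4 * C) * ?a"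
    using ba pos C by (simp add: algebra_simps abs_le_iff)
  have "1 / (2 * P) - 1 / (2 * Q) = 1 / (2 * P) * ((Q - P) / Q)" if "0 < P" "0 < Q" for P Q :: real
    using that by (simp add: divide_simps)
  then have "kap n - kap (Suc n) = kap n * (((?N + 1) * ?b - ?N * ?a) / ((?N + 1) * ?b))"
    unfolding K using pos by simp
  then have "\<bar>kap n - kap (Suc n)\<bar> = kap n * (\<bar>(?N + 1) * ?b - ?N * ?a\<bar> / ((?N + 1) * ?b))"
    using kap_pos[of n] pos by (simp add: abs_mult abs_divide)
  also have "\<dots> \<le> kap n * ((1 + 4 * C) * (C\<^sup>2 * ?b) / (?N * ?b))"
  proof (intro mult_left_mono frac_le)
    show "\<bar>(?N + 1) * ?b - ?N * ?a\<bar> \<le> (1 + 4 * C) * (C\<^sup>2 * ?b)"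
      using num ab C by (intro order_trans[OF num] mult_left_mono) auto
  qed (use kap_pos[of n] pos C in auto)
  also have "\<dots> = (1 + 4 * C) * C\<^sup>2 * (kap n / ?N) * (?b / ?b)" by (simp only: times_divide_times_eq times_divide_eq_right times_divide_eq_left divide_divide_eq_left mult_ac)
  also have "\<dots> = (1 + 4 * C) * C\<^sup>2 * (kap n / ?N)" using pos by simp
  finally show ?thesis .
qed

text \<open>Lowering the order by three doublings makes the loss in the power of \<open>x\<close> small compared with \<open>x powr a\<close>. It bounds
  the reciprocals of the moments by nearly the reciprocal of the tail.\<close>

lemma hat_powr_le_moment:
  assumes "0 \<le> x" "0 < a"
  shows "weight_hat w x * x powr (a / 8) \<le> C ^ 3 * weight_moment w a"
proof -
  have "x powr (a / 8) * weight_hat w x \<le> weight_moment w (a / 8)"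
    using assms by (intro powr_hat_le_moment) auto
  also have "\<dots> \<le> C ^ 3 * weight_moment w (2 ^ 3 * (a / 8))"
    using assms by (intro moment_doubling_iterate) auto
  finally show ?thesis by (simp add: mult.commute)
qed

end

section \<open>The size of the kernel\<close>

text \<open>For \<open>\<bar>t\<bar> \<ge> pi / 2\<close> the distance is at least \<open>1\<close>; otherwise it is at least \<open>\<bar>sin t\<bar>\<close>, which is compared with \<open>t\<close> through
  \<open>\<bar>t\<bar> \<le> \<bar>tan t\<bar>\<close> as long as the cosine is at least \<open>1 / 2\<close>.\<close>

lemma norm_cis_minus_of_real_ge:
  fixes x t :: real
  assumes t: "\<bar>t\<bar> \<le> pi" and x: "0 \<le> x"
  shows "\<bar>t\<bar> / pi \<le> cmod (cis t - of_real x)"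
proof -
  have tpi: "\<bar>t\<bar> / pi \<le> 1" using t by simp
  have sq: "(cmod (cis t - of_real x))\<^sup>2 = (cos t - x)\<^sup>2 + (sin t)\<^sup>2" by (simp add: cmod_power2)
  show ?thesis
  proof (cases "\<bar>t\<bar> < pi / 2")
    case False
    have "cos t \<le> 0"
    proof -
      have "cos \<bar>t\<bar> \<le> cos (pi / 2)" using t False by (intro cos_monotone_0_pi_le) auto
      then show ?thesis by simp
    qed
    then have "x * cos t \<le> 0" using x by (intro mult_nonneg_nonpos) auto
    moreover have "(cos t - x)\<^sup>2 + (sin t)\<^sup>2 = 1 - 2 * (x * cos t) + x\<^sup>2"
      by (simp add: power2_diff sin_squared_eq)
    moreover have "0 \<le> x\<^sup>2" by simp
    ultimately have "(cos t - x)\<^sup>2 + (sin t)\<^sup>2 \<ge> 1" by linarith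
    then have "1 \<le> (cmod (cis t - of_real x))\<^sup>2" by (simp add: sq)
    then have "1 \<le> cmod (cis t - of_real x)"
      by (metis norm_ge_zero one_power2 power2_le_imp_le)
    then show ?thesis using tpi by linarith
  next
    case True
    have "\<bar>sin t\<bar> \<le> cmod (cis t - of_real x)"
      using abs_Im_le_cmod[of "cis t - of_real x"] by simp
    moreover have "\<bar>t\<bar> / pi \<le> \<bar>sin t\<bar>"
    proof (cases "\<bar>t\<bar> \<le> pi / 3")
      case small: True
      have c: "1 / 2 \<le> cos t"
      proof -
        have "cos (pi / 3) \<le> cos \<bar>t\<bar>" using small by (intro cos_monotone_0_pi_le) auto
        then show ?thesis by (simp add: cos_60)
      qed
      have "\<bar>t\<bar> \<le> \<bar>tan t\<bar>" using True by (rule abs_tan_ge)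
      then have "\<bar>t\<bar> * cos t \<le> \<bar>sin t\<bar>" using c by (simp add: tan_def abs_divide field_simps)
      moreover have "\<bar>t\<bar> / pi \<le> \<bar>t\<bar> * (1 / 2)"
        using pi_gt3 mult_right_mono[of 2 pi "\<bar>t\<bar>"] by (simp add: field_simps)
      moreover have "\<bar>t\<bar> * (1 / 2) \<le> \<bar>t\<bar> * cos t" using c by (intro mult_left_mono) auto
      ultimately show ?thesis by linarith
    next
      case large: False
      have "sin (pi / 3) \<le> sin \<bar>t\<bar>" using large True by (intro sin_monotone_2pi_le) auto
      then have "sqrt 3 / 2 \<le> \<bar>sin t\<bar>" by (simp add: sin_60 abs_if split: if_splits)
      moreover have "\<bar>t\<bar> / pi \<le> 1 / 2" using True by (simp add: field_simps)
      moreover have "1 \<le> sqrt 3" by simp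
      ultimately show ?thesis by linarith
    qed
    ultimately show ?thesis by linarith
  qed
qed

text \<open>The Dirichlet kernel is bounded by its number of terms and by the reciprocal of the angle.\<close>

lemma norm_geometric_sum_cis_le:
  assumes t: "\<bar>t\<bar> \<le> pi" and nz: "t \<noteq> 0" and m: "0 < m"
  shows "cmod (\<Sum>k<m. cis t ^ k) \<le> 2 * pi / max (1 / real m) \<bar>t\<bar>"
proof -
  have "cmod (\<Sum>k<m. cis t ^ k) \<le> (\<Sum>k<m. cmod (cis t ^ k))" by (rule norm_sum)
  then have 1: "cmod (\<Sum>k<m. cis t ^ k) \<le> real m" by (simp add: norm_power)
  have pos: "0 < cmod (cis t - 1)" and lb: "\<bar>t\<bar> / pi \<le> cmod (cis t - 1)"
  proof -
    show lb: "\<bar>t\<bar> / pi \<le> cmod (cis t - 1)" using norm_cis_minus_of_real_ge[OF t, of 1] by simp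
    have "0 < \<bar>t\<bar> / pi" using nz by simp
    then show "0 < cmod (cis t - 1)" using lb by linarith
  qed
  have ne: "cis t \<noteq> 1" using pos by auto
  have "cmod (\<Sum>k<m. cis t ^ k) = cmod (cis t ^ m - 1) / cmod (cis t - 1)"
    using ne by (simp add: geometric_sum norm_divide)
  also have "\<dots> \<le> 2 / cmod (cis t - 1)"
    using norm_triangle_ineq4[of "cis t ^ m" 1] pos by (intro divide_right_mono) (auto simp: norm_power)
  also have "\<dots> \<le> 2 / (\<bar>t\<bar> / pi)" using lb nz pos by (intro divide_left_mono mult_pos_pos) auto
  finally have 2: "cmod (\<Sum>k<m. cis t ^ k) \<le> 2 * pi / \<bar>t\<bar>" by simp
  have "real m \<le> 2 * pi * real m" using pi_gt3 by (simp add: mult_le_cancel_right1)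
  then have "real m \<le> 2 * pi / (1 / real m)" by simp
  then show ?thesis using 1 2 by (auto simp: max_def)
qed

text \<open>Summation by parts against the geometric sums of \<open>u\<close>.\<close>

lemma norm_suminf_Abel_le:
  fixes b M :: "nat \<Rightarrow> real" and u :: complex
  assumes sum_b: "summable (\<lambda>n. cmod (of_real (b n) * u ^ n))" and b0: "b \<longlonglongrightarrow> 0"
    and M: "\<And>n. cmod (\<Sum>k<Suc n. u ^ k) \<le> M n" and bound: "\<And>n. M n \<le> L"
    and sum: "summable (\<lambda>n. \<bar>b n - b (Suc n)\<bar> * M n)"
  shows "cmod (\<Sum>n. of_real (b n) * u ^ n) \<le> (\<Sum>n. \<bar>b n - b (Suc n)\<bar> * M n)"
proof -
  let ?S = "\<lambda>N. \<Sum>k<N. u ^ k"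
  have parts: "(\<Sum>n<N. of_real (b n) * u ^ n) = (\<Sum>n<N. of_real (b n - b (Suc n)) * ?S (Suc n)) + of_real (b N) * ?S N" for N
    by (induction N) (auto simp: algebra_simps)
  have S: "cmod (?S N) \<le> L" for N
  proof (cases N)
    case 0
    have "0 \<le> cmod (\<Sum>k<Suc 0. u ^ k)" by simp
    also have "\<dots> \<le> M 0" by (rule M)
    also have "\<dots> \<le> L" by (rule bound)
    finally show ?thesis using 0 by simp
  next
    case (Suc n)
    then show ?thesis using M[of n] bound[of n] by simp
  qed
  have "(\<lambda>N. of_real (b N) * ?S N) \<longlonglongrightarrow> 0"
  proof (rule Lim_null_comparison)
    show "eventually (\<lambda>N. norm (of_real (b N) * ?S N) \<le> \<bar>b N\<bar> * L) sequentially"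
      by (rule always_eventually) (auto simp: norm_mult intro!: mult_left_mono S)
    show "(\<lambda>N. \<bar>b N\<bar> * L) \<longlonglongrightarrow> 0"
      using tendsto_mult_left_zero[OF tendsto_rabs_zero[OF b0]] .
  qed
  moreover have "(\<lambda>N. \<Sum>n<N. of_real (b n) * u ^ n) \<longlonglongrightarrow> (\<Sum>n. of_real (b n) * u ^ n)"
    using summable_norm_cancel[OF sum_b] by (rule summable_LIMSEQ)
  ultimately have "(\<lambda>N. (\<Sum>n<N. of_real (b n) * u ^ n) - of_real (b N) * ?S N) \<longlonglongrightarrow> (\<Sum>n. of_real (b n) * u ^ n) - 0"
    by (intro tendsto_diff)
  then have lim: "(\<lambda>N. \<Sum>n<N. of_real (b n - b (Suc n)) * ?S (Suc n)) \<longlonglongrightarrow> (\<Sum>n. of_real (b n) * u ^ n)"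
    by (simp add: parts)
  show ?thesis
  proof (rule tendsto_upperbound[OF tendsto_norm[OF lim]])
    show "eventually (\<lambda>N. norm (\<Sum>n<N. of_real (b n - b (Suc n)) * ?S (Suc n)) \<le> (\<Sum>n. \<bar>b n - b (Suc n)\<bar> * M n)) sequentially"
    proof (rule always_eventually, rule allI)
      fix N
      have "norm (\<Sum>n<N. of_real (b n - b (Suc n)) * ?S (Suc n)) \<le> (\<Sum>n<N. \<bar>b n - b (Suc n)\<bar> * M n)"
      proof (rule sum_norm_le)
        fix n
        show "norm (of_real (b n - b (Suc n)) * ?S (Suc n)) \<le> \<bar>b n - b (Suc n)\<bar> * M n"
          unfolding norm_mult norm_of_real by (rule mult_left_mono[OF M]) simp
      qed
      also have "\<dots> \<le> (\<Sum>n. \<bar>b n - b (Suc n)\<bar> * M n)"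
        using sum
      proof (rule sum_le_suminf)
        show "0 \<le> \<bar>b n - b (Suc n)\<bar> * M n" for n
          using M[of n] norm_ge_zero[of "\<Sum>k<Suc n. u ^ k"] by (intro mult_nonneg_nonneg) linarith+
      qed auto
      finally show "norm (\<Sum>n<N. of_real (b n - b (Suc n)) * ?S (Suc n)) \<le> (\<Sum>n. \<bar>b n - b (Suc n)\<bar> * M n)" .
    qed
  qed simp
qed

context borel_weight
begin

lemma moment_odd_ge:
  assumes "0 < \<rho>" "\<rho> < 1"
  shows "\<rho> * (\<rho>\<^sup>2) ^ n * weight_hat w \<rho> \<le> weight_moment w (2 * real n + 1)"
proof -
  have "\<rho> powr (2 * real n + 1) = \<rho> ^ (2 * n + 1)"
    using assms by (subst powr_realpow[symmetric]) (auto simp: algebra_simps)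
  also have "\<dots> = \<rho> * (\<rho>\<^sup>2) ^ n" by (simp add: power_mult)
  finally show ?thesis using powr_hat_le_moment[of \<rho> "2 * real n + 1"] assms by simp
qed

lemma summable_power_over_moment:
  assumes "0 \<le> x" "x < 1"
  shows "summable (\<lambda>n. x ^ n / weight_moment w (2 * real n + 1))"
proof -
  \<comment> \<open>Any \<open>\<rho>\<close> with \<open>x < \<rho>\<^sup>2 < 1\<close> would do.\<close>
  define \<rho> where "\<rho> = sqrt ((1 + x) / 2)"
  have \<rho>: "0 < \<rho>" "\<rho> < 1" "\<rho>\<^sup>2 = (1 + x) / 2" using assms by (auto simp: \<rho>_def)
  have h: "0 < weight_hat w \<rho>" using \<rho> by (intro hat_pos) auto
  have q: "x / \<rho>\<^sup>2 < 1" "0 \<le> x / \<rho>\<^sup>2" using assms \<rho> by auto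
  show ?thesis
  proof (rule summable_comparison_test'[where N = 0])
    show "summable (\<lambda>n. 1 / (\<rho> * weight_hat w \<rho>) * (x / \<rho>\<^sup>2) ^ n)"
      using q by (intro summable_mult summable_geometric) auto
    fix n :: nat
    have "x ^ n / weight_moment w (2 * real n + 1) \<le> x ^ n / (\<rho> * (\<rho>\<^sup>2) ^ n * weight_hat w \<rho>)"
      using assms \<rho> h by (intro divide_left_mono moment_odd_ge mult_pos_pos) (auto intro!: moment_pos)
    also have "\<dots> = 1 / (\<rho> * weight_hat w \<rho>) * (x / \<rho>\<^sup>2) ^ n"
      by (simp add: power_divide field_simps)
    finally show "norm (x ^ n / weight_moment w (2 * real n + 1)) \<le> 1 / (\<rho> * weight_hat w \<rho>) * (x / \<rho>\<^sup>2) ^ n"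
      using assms by (simp add: abs_divide)
  qed
qed

end

context doubling_weight
begin

lemma summable_kap:
  assumes "0 \<le> x" "x < 1"
  shows "summable (\<lambda>n. (real n + 1) * kap n * x ^ n)" "summable (\<lambda>n. kap n * x ^ n)"
proof -
  have "(real n + 1) * kap n * x ^ n = 1 / 2 * (x ^ n / weight_moment w (2 * real n + 1))" for n
  proof -
    have "(real n + 1) * (1 / (2 * (real n + 1) * m)) * y = 1 / 2 * (y / m)" for y m :: real
      by (simp add: divide_simps)
    then show ?thesis unfolding kap_def .
  qed
  then show 1: "summable (\<lambda>n. (real n + 1) * kap n * x ^ n)"
    using summable_mult[OF summable_power_over_moment[OF assms], of "1/2"] by simp
  show "summable (\<lambda>n. kap n * x ^ n)"
  proof (rule summable_comparison_test'[OF 1, where N = 0])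
    fix n
    have "0 \<le> kap n * x ^ n" using kap_pos[of n] assms by simp
    then show "norm (kap n * x ^ n) \<le> (real n + 1) * kap n * x ^ n"
      by (simp add: algebra_simps)
  qed
qed

text \<open>The kernel of the operator at \<open>(t, z)\<close> depends on \<open>t * z\<close> only, and this is the function of one variable behind it.\<close>

definition kern :: "complex \<Rightarrow> complex" where
  "kern z = (\<Sum>n. of_real (kap n) * z ^ n)"

lemma summable_norm_kern: "cmod z < 1 \<Longrightarrow> summable (\<lambda>n. cmod (of_real (kap n) * z ^ n))"
  using summable_kap(2)[of "cmod z"] kap_pos by (simp add: norm_mult norm_power less_imp_le)

lemma summable_kern: "cmod z < 1 \<Longrightarrow> summable (\<lambda>n. of_real (kap n) * z ^ n)"
  by (rule summable_norm_cancel) (rule summable_norm_kern)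

lemma norm_kern_le: "cmod z < 1 \<Longrightarrow> cmod z \<le> x \<Longrightarrow> x < 1 \<Longrightarrow> cmod (kern z) \<le> (\<Sum>n. kap n * x ^ n)"
proof -
  assume z: "cmod z < 1" "cmod z \<le> x" "x < 1"
  have x: "0 \<le> x" using z(2) norm_ge_zero[of z] by linarith
  have "cmod (kern z) \<le> (\<Sum>n. cmod (of_real (kap n) * z ^ n))"
    unfolding kern_def by (rule summable_norm[OF summable_norm_kern[OF z(1)]])
  also have "\<dots> \<le> (\<Sum>n. kap n * x ^ n)"
    using z x summable_norm_kern[OF z(1)] summable_kap(2)[of x] kap_pos
    by (intro suminf_le) (auto simp: norm_mult norm_power less_imp_le intro!: mult_left_mono power_mono)
  finally show ?thesis .
qed

lemma kern_of_real: "0 \<le> x \<Longrightarrow> x < 1 \<Longrightarrow> kern (of_real x) = of_real (\<Sum>n. kap n * x ^ n)"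
proof -
  assume "0 \<le> x" "x < 1"
  then have "of_real (\<Sum>n. kap n * x ^ n) = (\<Sum>n. complex_of_real (kap n * x ^ n))"
    by (intro suminf_of_real summable_kap)
  then show ?thesis unfolding kern_def by simp
qed

end

lemma nn_integral_Ico_ge:
  fixes g :: "real \<Rightarrow> real"
  assumes "\<And>y. a \<le> y \<Longrightarrow> y < b \<Longrightarrow> c \<le> g y" "0 \<le> c" "a \<le> b"
  shows "ennreal (c * (b - a)) \<le> (\<integral>\<^sup>+y\<in>{a..<b}. ennreal (g y) \<partial>lborel)"
proof -
  have "ennreal (c * (b - a)) = (\<integral>\<^sup>+y. ennreal c * indicator {a..<b} y \<partial>lborel)"
    using assms by (simp add: nn_integral_cmult_indicator ennreal_mult)
  also have "\<dots> \<le> (\<integral>\<^sup>+y\<in>{a..<b}. ennreal (g y) \<partial>lborel)"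
    using assms by (intro nn_integral_mono) (auto simp: indicator_def intro!: ennreal_leI)
  finally show ?thesis .
qed

context doubling_weight
begin

lemma moment_odd_ge_hat:
  assumes "0 < m"
  shows "weight_hat w (1 - 1 / (2 * real m)) \<le> 4 * weight_moment w (2 * real (m - 1) + 1)"
proof -
  let ?\<rho> = "1 - 1 / (2 * real m)"
  have m: "1 \<le> real m" using assms by simp
  have \<rho>: "0 < ?\<rho>" "?\<rho> < 1" using m by (auto simp: field_simps)
  have "1 / 2 \<le> ?\<rho> ^ m"
  proof -
    have "1 + real m * (- (1 / (2 * real m))) \<le> (1 + (- (1 / (2 * real m)))) ^ m"
      using m by (intro Bernoulli_inequality) (auto simp: field_simps)
    moreover have "1 + real m * (- (1 / (2 * real m))) = 1 / 2" using m by (simp add: field_simps)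
    ultimately show ?thesis by simp
  qed
  then have "(1 / 2) * (1 / 2) \<le> ?\<rho> ^ m * ?\<rho> ^ m" by (intro mult_mono) auto
  also have "\<dots> = ?\<rho> powr (2 * real m)"
  proof -
    have "?\<rho> powr (2 * real m) = ?\<rho> powr real m * ?\<rho> powr real m" by (simp only: powr_add[symmetric] mult_2)
    then show ?thesis using \<rho> by (simp add: powr_realpow)
  qed
  finally have "1 / 4 * weight_hat w ?\<rho> \<le> ?\<rho> powr (2 * real m) * weight_hat w ?\<rho>"
    by (intro mult_right_mono) auto
  also have "\<dots> \<le> weight_moment w (2 * real m)" using \<rho> by (intro powr_hat_le_moment) auto
  also have "\<dots> \<le> weight_moment w (2 * real (m - 1) + 1)" 
    using assms by (intro moment_antimono) (auto simp: of_nat_diff)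
  finally show ?thesis by simp
qed

text \<open>The majorant of the kernel at radius \<open>x\<close> and angle \<open>t\<close> is the integral of this function of \<open>y\<close> over \<open>[0, x]\<close>. It couples
  \<open>1 - y\<close> and \<open>t\<close> through the Hilbert-type kernel \<open>1 / max\<close>.\<close>

definition hilb :: "real \<Rightarrow> real \<Rightarrow> real" where
  "hilb t y = 1 / (weight_hat w y * max (1 - y) \<bar>t\<bar>)"

lemma hilb_measurable [measurable]: "hilb t \<in> borel_measurable borel"
  unfolding hilb_def[abs_def] by measurable

lemma hilb_measurable2 [measurable (raw)]:
  assumes [measurable]: "f \<in> borel_measurable M" "g \<in> borel_measurable M"
  shows "(\<lambda>x. hilb (f x) (g x)) \<in> borel_measurable M"
  unfolding hilb_def by measurable

text \<open>The \<open>m\<close>-th coefficient lives at distance \<open>1 / m\<close> from the circle: on the interval of length about \<open>1 / m\<^sup>2\<close> below \<open>1 - 1 / m\<close> the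
  tail of the weight is comparable with the moment, so that the term is an integral over this interval.\<close>

lemma kap_term_low_le:
  assumes m: "2 \<le> m" and t: "t \<noteq> 0"
  shows "ennreal (kap (m - 1) * (1 / real m) / max (1 / real m) \<bar>t\<bar>) \<le>
    ennreal (4 * C\<^sup>2) * (\<integral>\<^sup>+y\<in>{1 - 1 / (real m - 1)..<1 - 1 / real m}. ennreal (hilb t y) \<partial>lborel)"
proof -
  let ?M = "real m" and ?mu = "weight_moment w (2 * real (m - 1) + 1)"
  have M: "2 \<le> ?M" using m by simp
  let ?mx = "max (1 / ?M) \<bar>t\<bar>"
  have mx: "0 < ?mx" using M by (auto simp: max_def)
  have mu: "0 < ?mu" by (intro moment_pos) auto
  have kap: "kap (m - 1) = 1 / (2 * ?M * ?mu)" using m by (simp add: kap_def)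
  have lower: "1 / (8 * C\<^sup>2 * ?mu * ?mx) \<le> hilb t y" if y: "1 - 1 / (?M - 1) \<le> y" "y < 1 - 1 / ?M" for y
  proof -
    have "1 / (?M - 1) \<le> 1" using M by (simp add: field_simps)
    then have y0: "0 \<le> y" using y by linarith
    have "0 < 1 / ?M" using M by simp
    then have y1: "y < 1" using y by linarith
    have hy: "0 < weight_hat w y" using y0 y1 by (rule hat_pos)
    have "weight_hat w y \<le> weight_hat w (1 - 1 / (?M - 1))" by (rule hat_antimono) fact
    also have "\<dots> \<le> C * weight_hat w ((1 + (1 - 1 / (?M - 1))) / 2)"
      using M by (intro doubling) (auto simp: field_simps)
    also have "\<dots> \<le> C * weight_hat w (1 - 1 / ?M)"
      using C M by (intro mult_left_mono hat_antimono) (auto simp: field_simps)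
    also have "\<dots> \<le> C * (C * weight_hat w ((1 + (1 - 1 / ?M)) / 2))"
      using C M by (intro mult_left_mono doubling) (auto simp: field_simps)
    also have "(1 + (1 - 1 / ?M)) / 2 = 1 - 1 / (2 * ?M)" using M by (simp add: field_simps)
    also have "C * (C * weight_hat w (1 - 1 / (2 * ?M))) \<le> C * (C * (4 * ?mu))"
      using C m by (intro mult_left_mono moment_odd_ge_hat) auto
    finally have 1: "weight_hat w y \<le> 4 * C\<^sup>2 * ?mu" by (simp add: power2_eq_square)
    have "1 - y \<le> 1 / (?M - 1)" using y by linarith
    also have "\<dots> \<le> 2 * (1 / ?M)" using M by (simp add: field_simps)
    finally have 2: "max (1 - y) \<bar>t\<bar> \<le> 2 * ?mx" by (auto simp: max_def)
    have "weight_hat w y * max (1 - y) \<bar>t\<bar> \<le> 4 * C\<^sup>2 * ?mu * (2 * ?mx)"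
      using 1 2 y1 C mu by (intro mult_mono) auto
    then have "1 / (4 * C\<^sup>2 * ?mu * (2 * ?mx)) \<le> 1 / (weight_hat w y * max (1 - y) \<bar>t\<bar>)"
      using hy y1 mx mu C by (intro divide_left_mono mult_pos_pos) (auto simp: max_def)
    then show ?thesis by (simp add: hilb_def mult_ac)
  qed
  have len: "1 - 1 / ?M - (1 - 1 / (?M - 1)) \<ge> 1 / ?M\<^sup>2"
    using M by (simp add: field_simps power2_eq_square)
  have "kap (m - 1) * (1 / ?M) / ?mx = 4 * C\<^sup>2 * (1 / (8 * C\<^sup>2 * ?mu * ?mx) * (1 / ?M\<^sup>2))"
    unfolding kap using C mu mx M by (simp add: divide_simps power2_eq_square)
  also have "\<dots> \<le> 4 * C\<^sup>2 * (1 / (8 * C\<^sup>2 * ?mu * ?mx) * (1 - 1 / ?M - (1 - 1 / (?M - 1))))"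
    using len C mu mx by (intro mult_left_mono) auto
  finally have "ennreal (kap (m - 1) * (1 / ?M) / ?mx) \<le> 
     ennreal (4 * C\<^sup>2) * ennreal (1 / (8 * C\<^sup>2 * ?mu * ?mx) * (1 - 1 / ?M - (1 - 1 / (?M - 1))))"
    by (subst ennreal_mult'[symmetric]) (use C in \<open>auto intro!: ennreal_leI simp del: ennreal_le_iff2\<close>)
  also have "\<dots> \<le> ennreal (4 * C\<^sup>2) * (\<integral>\<^sup>+y\<in>{1 - 1 / (?M - 1)..<1 - 1 / ?M}. ennreal (hilb t y) \<partial>lborel)"
    using lower C mu mx M by (intro mult_left_mono nn_integral_Ico_ge) (auto simp: field_simps)
  finally show ?thesis .
qed

text \<open>Beyond \<open>m = 1 / (1 - x)\<close> half of the decay of \<open>x ^ m\<close> pays for the growth of the coefficients and the other half makes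
  the sum converge geometrically.\<close>

lemma kap_term_high_le:
  assumes x: "1 / 2 \<le> x" "x < 1" and m: "1 < real m * (1 - x)" and t: "t \<noteq> 0"
  shows "kap (m - 1) * x ^ (m - 1) * (1 - x) / max (1 / real m) \<bar>t\<bar> \<le>
    C ^ 3 * (1 - x)\<^sup>2 / (weight_hat w x * max (1 - x) \<bar>t\<bar>) * sqrt x ^ (m - 1)"
proof -
  define n where "n = m - 1"
  let ?M = "real m" and ?mu = "weight_moment w (2 * real n + 1)"
  have m0: "0 < m" using m by (cases m) auto
  have M: "1 < ?M"
  proof -
    have "?M * (1 - x) \<le> ?M * 1" using x by (intro mult_left_mono) auto
    then show ?thesis using m by linarith
  qed
  have mu: "0 < ?mu" by (intro moment_pos) auto
  have hx: "0 < weight_hat w x" using x by (intro hat_pos) auto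
  have kap: "kap n = 1 / (2 * ?M * ?mu)" using m0 by (simp add: kap_def n_def)
  \<comment> \<open>The exponents leave room: \<open>n / 2 + (2 * n + 1) / 8 \<le> n + 1\<close>, and the spare factor \<open>x\<close> is at least \<open>1 / 2\<close>.\<close>
  have xp: "x ^ n \<le> 2 * sqrt x ^ n * x powr ((2 * real n + 1) / 8)"
  proof -
    have x0: "0 < x" using x by simp
    have "sqrt x ^ n = x powr (real n / 2)"
      using x0 by (simp add: powr_half_sqrt[symmetric] powr_realpow[symmetric] powr_powr)
    then have "sqrt x ^ n * x powr ((2 * real n + 1) / 8) = x powr (real n / 2 + (2 * real n + 1) / 8)"
      by (simp add: powr_add)
    also have "\<dots> \<ge> x powr (real n + 1)"
      using x by (intro powr_mono') (auto simp: field_simps)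
    finally have "x powr (real n + 1) \<le> sqrt x ^ n * x powr ((2 * real n + 1) / 8)" .
    moreover have "x powr (real n + 1) = x ^ n * x" using x0 by (simp add: powr_add powr_realpow)
    moreover have "x ^ n * (1 / 2) \<le> x ^ n * x" using x by (intro mult_left_mono) auto
    ultimately show ?thesis by simp
  qed
  have "x ^ n / ?mu \<le> 2 * C ^ 3 / weight_hat w x * sqrt x ^ n"
  proof -
    have "x ^ n * weight_hat w x \<le> 2 * sqrt x ^ n * x powr ((2 * real n + 1) / 8) * weight_hat w x"
      using xp by (intro mult_right_mono) auto
    also have "\<dots> = 2 * sqrt x ^ n * (weight_hat w x * x powr ((2 * real n + 1) / 8))" by simp
    also have "\<dots> \<le> 2 * sqrt x ^ n * (C ^ 3 * ?mu)"
      using x by (intro mult_left_mono hat_powr_le_moment) auto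
    finally show ?thesis using mu hx by (simp add: field_simps)
  qed
  moreover have "1 / (?M * max (1 / ?M) \<bar>t\<bar>) \<le> (1 - x) / max (1 - x) \<bar>t\<bar>"
  proof -
    have "max (1 - x) \<bar>t\<bar> \<le> (1 - x) * (?M * max (1 / ?M) \<bar>t\<bar>)"
    proof (rule max.boundedI)
      have "1 \<le> ?M * max (1 / ?M) \<bar>t\<bar>" using M by (simp add: max_def field_simps)
      then show "1 - x \<le> (1 - x) * (?M * max (1 / ?M) \<bar>t\<bar>)" using x by (simp add: mult_le_cancel_left1)
      have "\<bar>t\<bar> \<le> (?M * (1 - x)) * \<bar>t\<bar>" using m by (simp add: mult_le_cancel_right1)
      also have "\<dots> \<le> (?M * (1 - x)) * max (1 / ?M) \<bar>t\<bar>" using x by (intro mult_left_mono) auto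
      finally show "\<bar>t\<bar> \<le> (1 - x) * (?M * max (1 / ?M) \<bar>t\<bar>)" by (simp add: mult_ac)
    qed
    moreover have "0 < ?M * max (1 / ?M) \<bar>t\<bar>" using M by (intro mult_pos_pos) (auto simp: less_max_iff_disj)
    moreover have "0 < max (1 - x) \<bar>t\<bar>" using x by (auto simp: max_def)
    ultimately show ?thesis by (simp add: divide_simps mult_ac)
  qed
  ultimately have "(x ^ n / ?mu) * (1 / (?M * max (1 / ?M) \<bar>t\<bar>)) \<le>
      (2 * C ^ 3 / weight_hat w x * sqrt x ^ n) * ((1 - x) / max (1 - x) \<bar>t\<bar>)"
    using C x hx M mu by (intro mult_mono) auto
  then have "1 / 2 * (1 - x) * ((x ^ n / ?mu) * (1 / (?M * max (1 / ?M) \<bar>t\<bar>))) \<le>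
      1 / 2 * (1 - x) * ((2 * C ^ 3 / weight_hat w x * sqrt x ^ n) * ((1 - x) / max (1 - x) \<bar>t\<bar>))"
    using x by (intro mult_left_mono) auto
  also have "\<dots> = C ^ 3 * (1 - x)\<^sup>2 / (weight_hat w x * max (1 - x) \<bar>t\<bar>) * sqrt x ^ n"
    by (simp add: power2_eq_square)
  finally show ?thesis unfolding n_def[symmetric] kap by (simp add: mult_ac)
qed

text \<open>By doubling, a single value at \<open>x\<close> is dominated by the integral over \<open>[2 * x - 1, x]\<close>.\<close>

lemma high_tail_le:
  assumes x: "1 / 2 \<le> x" "x < 1" and t: "t \<noteq> 0"
  shows "ennreal ((1 - x) / (weight_hat w x * max (1 - x) \<bar>t\<bar>)) \<le>
    ennreal (2 * C) * (\<integral>\<^sup>+y\<in>{0..x}. ennreal (hilb t y) \<partial>lborel)"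
proof -
  have hx: "0 < weight_hat w x" using x by (intro hat_pos) auto
  have mx: "0 < max (1 - x) \<bar>t\<bar>" using x by (auto simp: max_def)
  let ?c = "1 / (2 * C * weight_hat w x * max (1 - x) \<bar>t\<bar>)"
  have lower: "?c \<le> hilb t y" if y: "2 * x - 1 \<le> y" "y < x" for y
  proof -
    have y0: "0 \<le> y" using y x by linarith
    have hy: "0 < weight_hat w y" using y0 y x by (intro hat_pos) auto
    have "weight_hat w y \<le> weight_hat w (2 * x - 1)" using y by (intro hat_antimono) auto
    also have "\<dots> \<le> C * weight_hat w ((1 + (2 * x - 1)) / 2)" using x by (intro doubling) auto
    finally have "weight_hat w y \<le> C * weight_hat w x" by simp
    moreover have "max (1 - y) \<bar>t\<bar> \<le> 2 * max (1 - x) \<bar>t\<bar>" using y by (auto simp: max_def)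
    ultimately have "weight_hat w y * max (1 - y) \<bar>t\<bar> \<le> C * weight_hat w x * (2 * max (1 - x) \<bar>t\<bar>)"
      using C hx x y by (intro mult_mono) auto
    then have "1 / (C * weight_hat w x * (2 * max (1 - x) \<bar>t\<bar>)) \<le> 1 / (weight_hat w y * max (1 - y) \<bar>t\<bar>)"
      using hy y x mx hx C by (intro divide_left_mono mult_pos_pos) (auto simp: max_def)
    then show ?thesis by (simp add: hilb_def mult_ac)
  qed
  have "ennreal ((1 - x) / (weight_hat w x * max (1 - x) \<bar>t\<bar>)) = ennreal (2 * C) * ennreal (?c * (x - (2 * x - 1)))"
    using C by (subst ennreal_mult'[symmetric]) auto
  also have "\<dots> \<le> ennreal (2 * C) * (\<integral>\<^sup>+y\<in>{2 * x - 1..<x}. ennreal (hilb t y) \<partial>lborel)"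
    using C hx mx x lower by (intro mult_left_mono nn_integral_Ico_ge) auto
  also have "\<dots> \<le> ennreal (2 * C) * (\<integral>\<^sup>+y\<in>{0..x}. ennreal (hilb t y) \<partial>lborel)"
    using x by (intro mult_left_mono nn_integral_mono) (auto simp: indicator_def)
  finally show ?thesis .
qed

end

context doubling_weight
begin

lemma kern_coeff_diff_le:
  assumes "0 \<le> x" "x \<le> 1"
  shows "\<bar>kap n * x ^ n - kap (Suc n) * x ^ Suc n\<bar> \<le>
    (1 + (1 + 4 * C) * C\<^sup>2) * (kap n * x ^ n * (1 / (real n + 1) + (1 - x)))"
proof -
  let ?B = "(1 + 4 * C) * C\<^sup>2" and ?k = "kap n / (real n + 1)"
  have B: "0 \<le> ?B" using C by simp
  have k: "0 \<le> ?k" "?k \<le> kap n" using kap_pos[of n] by (auto simp: field_simps)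
  have d: "\<bar>kap n - kap (Suc n)\<bar> \<le> ?B * ?k" by (rule kap_diff_le)
  have "kap (Suc n) \<le> kap n + ?B * ?k" using d by linarith
  also have "\<dots> \<le> kap n + ?B * kap n" using B k by (intro add_left_mono mult_left_mono) auto
  finally have s: "kap (Suc n) \<le> (1 + ?B) * kap n" by (simp add: algebra_simps)
  have "kap n * x ^ n - kap (Suc n) * x ^ Suc n = (kap n - kap (Suc n)) * x ^ n + kap (Suc n) * (x ^ n * (1 - x))"
    by (simp add: algebra_simps)
  also have "\<bar>\<dots>\<bar> \<le> \<bar>kap n - kap (Suc n)\<bar> * x ^ n + kap (Suc n) * (x ^ n * (1 - x))"
    using assms kap_pos[of "Suc n"] by (intro order_trans[OF abs_triangle_ineq]) (auto simp: abs_mult)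
  also have "\<dots> \<le> ?B * ?k * x ^ n + (1 + ?B) * kap n * (x ^ n * (1 - x))"
    using assms d s by (intro add_mono mult_right_mono) auto
  also have "\<dots> \<le> (1 + ?B) * ?k * x ^ n + (1 + ?B) * kap n * (x ^ n * (1 - x))"
    using assms B k by (intro add_right_mono mult_right_mono) auto
  also have "\<dots> = (1 + ?B) * (kap n * x ^ n * (1 / (real n + 1) + (1 - x)))"
    by (simp add: algebra_simps)
  finally show ?thesis .
qed

text \<open>What remains of the \<open>n\<close>-th term of the kernel after summation by parts, up to a constant: the factor \<open>1 / (n + 1)\<close> comes
  from the difference of the coefficients, \<open>1 - x\<close> from that of the powers, and the last factor from the Dirichlet kernel.\<close>

definition abel_term :: "real \<Rightarrow> real \<Rightarrow> nat \<Rightarrow> real" where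
  "abel_term x t n = kap n * x ^ n * (1 / (real n + 1) + (1 - x)) * (2 * pi / max (1 / (real n + 1)) \<bar>t\<bar>)"

lemma abel_term_nonneg: "0 \<le> x \<Longrightarrow> x \<le> 1 \<Longrightarrow> 0 \<le> abel_term x t n"
  unfolding abel_term_def using kap_pos[of n] by (intro mult_nonneg_nonneg) (auto simp: less_imp_le)

lemma abel_term_le:
  assumes "0 \<le> x" "x \<le> 1"
  shows "abel_term x t n \<le> 4 * pi * ((real n + 1) * kap n * x ^ n)"
proof -
  have mx: "1 / (real n + 1) \<le> max (1 / (real n + 1)) \<bar>t\<bar>" by simp
  have pos: "0 < 1 / (real n + 1)" by simp
  have "2 * pi / max (1 / (real n + 1)) \<bar>t\<bar> \<le> 2 * pi / (1 / (real n + 1))"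
    using mx pos by (intro divide_left_mono mult_pos_pos less_le_trans[OF pos mx]) auto
  moreover have "1 / (real n + 1) + (1 - x) \<le> 2"
  proof -
    have "1 / (real n + 1) \<le> 1" by (simp add: field_simps)
    then show ?thesis using assms by linarith
  qed
  ultimately have "abel_term x t n \<le> kap n * x ^ n * 2 * (2 * pi / (1 / (real n + 1)))"
    unfolding abel_term_def using assms kap_pos[of n]
    by (intro mult_mono mult_nonneg_nonneg) (auto simp: less_imp_le)
  then show ?thesis by (simp add: algebra_simps)
qed

lemma summable_abel_term: "0 \<le> x \<Longrightarrow> x < 1 \<Longrightarrow> summable (abel_term x t)"
proof (rule summable_comparison_test')
  assume x: "0 \<le> x" "x < 1"
  show "summable (\<lambda>n. 4 * pi * ((real n + 1) * kap n * x ^ n))"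
    using x by (intro summable_mult summable_kap)
  show "norm (abel_term x t n) \<le> 4 * pi * ((real n + 1) * kap n * x ^ n)" for n
    using abel_term_le[of x t n] abel_term_nonneg[of x t n] x by simp
qed

lemma norm_kern_le_abel_sum:
  assumes x: "0 \<le> x" "x < 1" and t: "t \<noteq> 0" "\<bar>t\<bar> \<le> pi"
  shows "cmod (kern (of_real x * cis t)) \<le> (1 + (1 + 4 * C) * C\<^sup>2) * (\<Sum>n. abel_term x t n)"
proof -
  let ?B = "(1 + 4 * C) * C\<^sup>2"
  define b where "b n = kap n * x ^ n" for n
  define M where "M n = 2 * pi / max (1 / (real n + 1)) \<bar>t\<bar>" for n
  have B: "0 \<le> ?B" using C by simp
  have M0: "0 \<le> M n" for n unfolding M_def by simp
  have le: "\<bar>b n - b (Suc n)\<bar> * M n \<le> (1 + ?B) * abel_term x t n" for n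
    unfolding abel_term_def mult.assoc[symmetric] b_def
    using mult_right_mono[OF kern_coeff_diff_le[of x n] M0[of n]] x
    by (simp add: M_def mult.assoc)
  have sumb: "summable (\<lambda>n. \<bar>b n - b (Suc n)\<bar> * M n)"
  proof (rule summable_comparison_test')
    show "summable (\<lambda>n. (1 + ?B) * abel_term x t n)" using x by (intro summable_mult summable_abel_term)
    show "norm (\<bar>b n - b (Suc n)\<bar> * M n) \<le> (1 + ?B) * abel_term x t n" for n
      using le[of n] M0[of n] by (simp add: abs_mult)
  qed
  have "kern (of_real x * cis t) = (\<Sum>n. of_real (b n) * cis t ^ n)"
    unfolding kern_def b_def by (simp add: power_mult_distrib mult.assoc)
  also have "cmod \<dots> \<le> (\<Sum>n. \<bar>b n - b (Suc n)\<bar> * M n)"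
  proof (rule norm_suminf_Abel_le[where L = "2 * pi / \<bar>t\<bar>"])
    show "summable (\<lambda>n. cmod (of_real (b n) * cis t ^ n))"
      using summable_kap(2)[OF x] kap_pos x by (simp add: b_def norm_mult norm_power abs_mult less_imp_le)
    show "b \<longlonglongrightarrow> 0" unfolding b_def using summable_kap(2)[OF x] by (rule summable_LIMSEQ_zero)
    show "cmod (\<Sum>k<Suc n. cis t ^ k) \<le> M n" for n
      using norm_geometric_sum_cis_le[OF t(2,1), of "Suc n"] by (simp add: M_def add.commute)
    show "M n \<le> 2 * pi / \<bar>t\<bar>" for n
      unfolding M_def using t by (intro divide_left_mono mult_pos_pos) (auto simp: less_max_iff_disj)
  qed fact
  also have "\<dots> \<le> (\<Sum>n. (1 + ?B) * abel_term x t n)"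
    using x by (intro suminf_le le sumb summable_mult summable_abel_term)
  also have "\<dots> = (1 + ?B) * (\<Sum>n. abel_term x t n)"
    using x by (intro suminf_mult summable_abel_term)
  finally show ?thesis .
qed

text \<open>The sum is split at \<open>1 / (1 - x)\<close>. The low terms fill up the integral over disjoint intervals inside \<open>[0, x]\<close>, and the
  high terms form a geometric series whose size is that of the integral near \<open>x\<close>. The cut-off of the integral
  at \<open>x\<close> has to be sharp, as the weight in the norm of the image may decay arbitrarily fast.\<close>

lemma abel_sum_le_hilb:
  assumes x: "1 / 2 \<le> x" "x < 1" and t: "t \<noteq> 0"
  shows "(\<Sum>n. ennreal (abel_term x t n)) \<le> ennreal (4 * pi * kap 0) +
    ennreal (16 * pi * C\<^sup>2 + 16 * pi * C ^ 4) * (\<integral>\<^sup>+y\<in>{0..x}. ennreal (hilb t y) \<partial>lborel)"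
proof -
  let ?I = "\<lambda>n. {1 - 1 / real n..<1 - 1 / (real n + 1)}"
  let ?H = "\<integral>\<^sup>+y\<in>{0..x}. ennreal (hilb t y) \<partial>lborel"
  define D where "D = C ^ 3 * (1 - x)\<^sup>2 / (weight_hat w x * max (1 - x) \<bar>t\<bar>)"
  have hx: "0 < weight_hat w x" using x by (intro hat_pos) auto
  have mx: "0 < max (1 - x) \<bar>t\<bar>" using x by (auto simp: less_max_iff_disj)
  have D: "0 \<le> D" unfolding D_def using C hx mx by simp
  define a where "a n = (if n = 0 then ennreal (4 * pi * kap 0) else 0)" for n :: nat
  define b where "b n = (if n = 0 then 0 else ennreal (16 * pi * C\<^sup>2) *
      (\<integral>\<^sup>+y. ennreal (hilb t y) * indicator {0..x} y * indicator (?I n) y \<partial>lborel))" for n :: nat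
  define c where "c n = ennreal (4 * pi * D * sqrt x ^ n)" for n :: nat
  have pointwise: "ennreal (abel_term x t n) \<le> a n + b n + c n" for n
  proof -
    consider "n = 0" | "n \<noteq> 0" "(real n + 1) * (1 - x) \<le> 1" | "1 < (real n + 1) * (1 - x)" by fastforce
    then show ?thesis
    proof cases
      case 1
      have "abel_term x t 0 \<le> 4 * pi * kap 0" using abel_term_le[of x t 0] x by simp
      then show ?thesis using 1 by (auto simp: a_def b_def intro!: add_increasing2 ennreal_leI)
    next
      case 2
      let ?m = "real n + 1"
      have xm: "1 - x \<le> 1 / ?m" using 2 by (simp add: field_simps)
      have "abel_term x t n \<le> kap n * 1 * (1 / ?m + 1 / ?m) * (2 * pi / max (1 / ?m) \<bar>t\<bar>)"
        unfolding abel_term_def using x xm kap_pos[of n]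
        by (intro mult_right_mono mult_mono add_left_mono power_le_one) auto
      also have "\<dots> = 4 * pi * (kap n * (1 / ?m) / max (1 / ?m) \<bar>t\<bar>)" by simp
      finally have "ennreal (abel_term x t n) \<le> ennreal (4 * pi) * ennreal (kap n * (1 / ?m) / max (1 / ?m) \<bar>t\<bar>)"
        by (subst ennreal_mult'[symmetric]) (auto intro!: ennreal_leI)
      also have "\<dots> \<le> ennreal (4 * pi) * (ennreal (4 * C\<^sup>2) * (\<integral>\<^sup>+y\<in>?I n. ennreal (hilb t y) \<partial>lborel))"
        using kap_term_low_le[of "Suc n" t] 2 t by (intro mult_left_mono) (auto simp: add.commute)
      also have "(\<integral>\<^sup>+y\<in>?I n. ennreal (hilb t y) \<partial>lborel) = 
          (\<integral>\<^sup>+y. ennreal (hilb t y) * indicator {0..x} y * indicator (?I n) y \<partial>lborel)"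
      proof (intro nn_integral_cong)
        fix y
        have "0 \<le> 1 - 1 / real n" using 2 by (simp add: field_simps)
        then show "ennreal (hilb t y) * indicator (?I n) y = ennreal (hilb t y) * indicator {0..x} y * indicator (?I n) y"
          using xm by (auto simp: indicator_def)
      qed
      also have "ennreal (4 * pi) * (ennreal (4 * C\<^sup>2) * \<dots>) = b n"
        using 2 by (simp add: b_def mult.assoc[symmetric] ennreal_mult[symmetric])
      finally show ?thesis by (simp add: add_increasing add_increasing2)
    next
      case 3
      let ?m = "real n + 1"
      have xm: "1 / ?m \<le> 1 - x" using 3 by (simp add: field_simps)
      have "abel_term x t n \<le> kap n * x ^ n * ((1 - x) + (1 - x)) * (2 * pi / max (1 / ?m) \<bar>t\<bar>)"
        unfolding abel_term_def using x xm kap_pos[of n]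
        by (intro mult_right_mono mult_left_mono add_right_mono) auto
      also have "\<dots> = 4 * pi * (kap n * x ^ n * (1 - x) / max (1 / ?m) \<bar>t\<bar>)" by simp
      also have "\<dots> \<le> 4 * pi * (D * sqrt x ^ n)"
        using kap_term_high_le[of x "Suc n" t] x t 3 by (intro mult_left_mono) (auto simp: add.commute D_def)
      finally have "ennreal (abel_term x t n) \<le> c n" unfolding c_def by (intro ennreal_leI) simp
      then show ?thesis by (simp add: add_increasing)
    qed
  qed
  have sum_a: "(\<Sum>n. a n) = ennreal (4 * pi * kap 0)"
  proof -
    have "(\<Sum>n. a n) = (\<Sum>n\<in>{0}. a n)" by (rule suminf_finite) (auto simp: a_def)
    then show ?thesis by (simp add: a_def)
  qed
  have sum_b: "(\<Sum>n. b n) \<le> ennreal (16 * pi * C\<^sup>2) * ?H"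
  proof -
    let ?J = "\<lambda>n. ?I (Suc n)"
    have disj: "disjoint_family ?J"
      unfolding disjoint_family_on_def
    proof (intro ballI impI)
      fix m n :: nat assume ne: "m \<noteq> n"
      have *: "?J i \<inter> ?J j = {}" if "i < j" for i j :: nat
      proof -
        have "1 / real (Suc j) \<le> 1 / (real (Suc i) + 1)" using that by (simp add: field_simps)
        then show ?thesis by auto
      qed
      show "?J m \<inter> ?J n = {}" using ne *[of m n] *[of n m] by (cases "m < n") (auto simp: Int_commute)
    qed
    have "(\<Sum>n. \<integral>\<^sup>+y. ennreal (hilb t y) * indicator {0..x} y * indicator (?J n) y \<partial>lborel) =
      (\<integral>\<^sup>+y. (\<Sum>n. ennreal (hilb t y) * indicator {0..x} y * indicator (?J n) y) \<partial>lborel)"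
      by (rule nn_integral_suminf[symmetric]) measurable
    also have "\<dots> \<le> ?H"
    proof (intro nn_integral_mono)
      fix y
      have "(\<Sum>n. ennreal (hilb t y) * indicator {0..x} y * indicator (?J n) y) =
          ennreal (hilb t y) * indicator {0..x} y * (\<Sum>n. indicator (?J n) y)"
        by (rule ennreal_suminf_cmult)
      also have "(\<Sum>n. indicator (?J n) y :: ennreal) = indicator (\<Union>n. ?J n) y"
        by (rule suminf_indicator[OF disj])
      also have "ennreal (hilb t y) * indicator {0..x} y * \<dots> \<le> ennreal (hilb t y) * indicator {0..x} y * 1"
        by (intro mult_left_mono) (auto simp: indicator_def)
      finally show "(\<Sum>n. ennreal (hilb t y) * indicator {0..x} y * indicator (?J n) y) \<le> ennreal (hilb t y) * indicator {0..x} y"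
        by simp
    qed
    finally have inner: "(\<Sum>n. \<integral>\<^sup>+y. ennreal (hilb t y) * indicator {0..x} y * indicator (?J n) y \<partial>lborel) \<le> ?H" .
    have "(\<Sum>n. b n) = b 0 + (\<Sum>n. b (Suc n))"
      using suminf_offset[of b 1] by (simp add: add.commute)
    also have "\<dots> = (\<Sum>n. ennreal (16 * pi * C\<^sup>2) *
      (\<integral>\<^sup>+y. ennreal (hilb t y) * indicator {0..x} y * indicator (?J n) y \<partial>lborel))"
      by (simp add: b_def)
    also have "\<dots> = ennreal (16 * pi * C\<^sup>2) *
      (\<Sum>n. \<integral>\<^sup>+y. ennreal (hilb t y) * indicator {0..x} y * indicator (?J n) y \<partial>lborel)"
      by (rule ennreal_suminf_cmult)
    also have "\<dots> \<le> ennreal (16 * pi * C\<^sup>2) * ?H"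
      by (rule mult_left_mono[OF inner]) simp
    finally show ?thesis .
  qed
  have sum_c: "(\<Sum>n. c n) \<le> ennreal (16 * pi * C ^ 4) * ?H"
  proof -
    have sq: "0 \<le> sqrt x" "sqrt x < 1" using x by auto
    have geo: "(\<lambda>n. 4 * pi * D * sqrt x ^ n) sums (4 * pi * D * (1 / (1 - sqrt x)))"
      using sq by (intro sums_mult geometric_sums) auto
    have "(\<Sum>n. c n) = ennreal (4 * pi * D * (1 / (1 - sqrt x)))"
      unfolding c_def using geo D sq by (subst suminf_ennreal_eq[OF _ geo]) auto
    also have "\<dots> \<le> ennreal (8 * pi * C ^ 3 * ((1 - x) / (weight_hat w x * max (1 - x) \<bar>t\<bar>)))"
    proof (rule ennreal_leI)
      have "1 - x = (1 - sqrt x) * (1 + sqrt x)" using x by (simp add: algebra_simps)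
      also have "\<dots> \<le> (1 - sqrt x) * 2" using sq by (intro mult_left_mono) auto
      finally have "1 / (1 - sqrt x) \<le> 2 / (1 - x)" using x sq by (simp add: field_simps)
      then have "4 * pi * D * (1 / (1 - sqrt x)) \<le> 4 * pi * D * (2 / (1 - x))"
        using D by (intro mult_left_mono) auto
      also have "\<dots> = 8 * pi * C ^ 3 * ((1 - x) / (weight_hat w x * max (1 - x) \<bar>t\<bar>))"
        using x hx mx by (simp add: D_def power2_eq_square)
      finally show "4 * pi * D * (1 / (1 - sqrt x)) \<le> 8 * pi * C ^ 3 * ((1 - x) / (weight_hat w x * max (1 - x) \<bar>t\<bar>))" .
    qed
    also have "\<dots> = ennreal (8 * pi * C ^ 3) * ennreal ((1 - x) / (weight_hat w x * max (1 - x) \<bar>t\<bar>))"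
      using C by (intro ennreal_mult') auto
    also have "\<dots> \<le> ennreal (8 * pi * C ^ 3) * (ennreal (2 * C) * ?H)"
      using x t by (intro mult_left_mono high_tail_le) auto
    also have "\<dots> = ennreal (16 * pi * C ^ 4) * ?H"
      using C by (simp add: mult.assoc[symmetric] ennreal_mult[symmetric] eval_nat_numeral)
    finally show ?thesis .
  qed
  have "(\<Sum>n. ennreal (abel_term x t n)) \<le> (\<Sum>n. a n + b n + c n)"
    by (intro suminf_le pointwise) auto
  also have "\<dots> = (\<Sum>n. a n) + (\<Sum>n. b n) + (\<Sum>n. c n)"
    by (simp add: suminf_add[symmetric])
  also have "\<dots> \<le> ennreal (4 * pi * kap 0) + ennreal (16 * pi * C\<^sup>2) * ?H + ennreal (16 * pi * C ^ 4) * ?H"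
    using sum_a sum_b sum_c by (intro add_mono) auto
  also have "\<dots> = ennreal (4 * pi * kap 0) + ennreal (16 * pi * C\<^sup>2 + 16 * pi * C ^ 4) * ?H"
    using C by (simp add: ennreal_plus distrib_right add.assoc)
  finally show ?thesis .
qed

text \<open>The size of the kernel off the radius. For \<open>x < 1/2\<close> the constant alone suffices, and it is needed, as the integral tends
  to \<open>0\<close> with \<open>x\<close>.\<close>

theorem norm_kern_le_hilb:
  obtains K where "0 < K" "\<And>x t. \<lbrakk>0 \<le> x; x < 1; t \<noteq> 0; \<bar>t\<bar> \<le> pi\<rbrakk> \<Longrightarrow>
    ennreal (cmod (kern (of_real x * cis t))) \<le> ennreal K * (1 + (\<integral>\<^sup>+y\<in>{0..x}. ennreal (hilb t y) \<partial>lborel))"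
proof -
  define K1 where "K1 = (\<Sum>n. 4 * pi * ((real n + 1) * kap n * (1/2) ^ n))"
  define E where "E = 1 + (1 + 4 * C) * C\<^sup>2"
  define F where "F = K1 + 4 * pi * kap 0 + (16 * pi * C\<^sup>2 + 16 * pi * C ^ 4)"
  have E: "0 < E" using C by (simp add: E_def add_pos_nonneg)
  have s1: "summable (\<lambda>n. 4 * pi * ((real n + 1) * kap n * (1/2) ^ n))"
    by (intro summable_mult summable_kap) auto
  have K1: "0 \<le> K1" unfolding K1_def using kap_pos by (intro suminf_nonneg s1) (auto simp: less_imp_le)
  have F: "0 < F" unfolding F_def using C kap_pos[of 0] K1 by (intro add_pos_pos add_nonneg_pos mult_pos_pos) auto
  show ?thesis
  proof (rule that[of "E * F"])
    show "0 < E * F" using E F by simp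
    fix x t :: real assume x: "0 \<le> x" "x < 1" and t: "t \<noteq> 0" "\<bar>t\<bar> \<le> pi"
    let ?H = "\<integral>\<^sup>+y\<in>{0..x}. ennreal (hilb t y) \<partial>lborel"
    have "ennreal (cmod (kern (of_real x * cis t))) \<le> ennreal (E * (\<Sum>n. abel_term x t n))"
      unfolding E_def by (intro ennreal_leI norm_kern_le_abel_sum x t)
    also have "\<dots> = ennreal E * (\<Sum>n. ennreal (abel_term x t n))"
      using E x abel_term_nonneg[of x t] summable_abel_term[of x t]
      by (simp add: ennreal_mult' suminf_ennreal2)
    also have "(\<Sum>n. ennreal (abel_term x t n)) \<le> ennreal F * (1 + ?H)"
    proof (cases "x < 1 / 2")
      case True
      have "(\<Sum>n. ennreal (abel_term x t n)) = ennreal (\<Sum>n. abel_term x t n)"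
        using x abel_term_nonneg[of x t] summable_abel_term[of x t] by (simp add: suminf_ennreal2)
      also have "(\<Sum>n. abel_term x t n) \<le> K1"
        unfolding K1_def
      proof (intro suminf_le summable_abel_term s1)
        fix n
        have "abel_term x t n \<le> 4 * pi * ((real n + 1) * kap n * x ^ n)" using x by (intro abel_term_le) auto
        also have "\<dots> \<le> 4 * pi * ((real n + 1) * kap n * (1/2) ^ n)"
          using x True kap_pos[of n] by (intro mult_left_mono power_mono) auto
        finally show "abel_term x t n \<le> 4 * pi * ((real n + 1) * kap n * (1/2) ^ n)" .
      qed (use x in auto)
      also have "K1 \<le> F" unfolding F_def using C kap_pos[of 0] by (simp add: add_nonneg_nonneg)
      finally have "(\<Sum>n. ennreal (abel_term x t n)) \<le> ennreal F * 1" by (simp add: ennreal_leI)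
      also have "\<dots> \<le> ennreal F * (1 + ?H)" by (intro mult_left_mono) auto
      finally show ?thesis .
    next
      case False
      then have "(\<Sum>n. ennreal (abel_term x t n)) \<le> ennreal (4 * pi * kap 0) +
          ennreal (16 * pi * C\<^sup>2 + 16 * pi * C ^ 4) * ?H"
        using x t by (intro abel_sum_le_hilb) auto
      also have "\<dots> \<le> ennreal F * 1 + ennreal F * ?H"
        using C kap_pos[of 0] K1 unfolding F_def
        by (intro add_mono mult_right_mono) (auto intro!: ennreal_leI simp del: ennreal_plus)
      finally show ?thesis by (simp add: distrib_left)
    qed
    finally show "ennreal (cmod (kern (of_real x * cis t))) \<le> ennreal (E * F) * (1 + ?H)"
      using E F by (simp add: ennreal_mult mult.assoc mult_left_mono)
  qed
qed

end

context doubling_weight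
begin

text \<open>On the radius the kernel is at least the reciprocal of the tail. As the moments decrease, the terms between \<open>N\<close> and \<open>2 * N\<close>
  add up to at least a constant multiple of the reciprocal of the moment of order \<open>2 * N + 1\<close>, up to the power \<open>x ^ (2 * N)\<close>; for \<open>N\<close> close
  to \<open>1 / (1 - x)\<close> this power is bounded below and the moment is comparable with the tail at \<open>x\<close>.\<close>

lemma kern_lower:
  obtains c where "0 < c" "\<And>x. \<lbrakk>0 \<le> x; x < 1\<rbrakk> \<Longrightarrow> c \<le> weight_hat w x * (\<Sum>n. kap n * x ^ n)"
proof -
  obtain A where A: "0 < A" "\<And>x \<rho>. \<lbrakk>0 < x; 0 \<le> \<rho>; \<rho> < 1; \<rho> powr x \<le> exp (- 1)\<rbrakk> \<Longrightarrow>
    weight_moment w x \<le> A * weight_hat w \<rho>" by (rule moment_le_hat) blast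
  have h12: "0 < weight_hat w (1/2)" by (intro hat_pos) auto
  have terms: "0 \<le> kap n * x ^ n" if "0 \<le> x" for n x using kap_pos[of n] that by simp
  show ?thesis
  proof (rule that[of "min (exp (- 8) / (4 * A)) (weight_hat w (1/2) * kap 0)"])
    show "0 < min (exp (- 8) / (4 * A)) (weight_hat w (1/2) * kap 0)"
      using A h12 kap_pos[of 0] by simp
    fix x :: real assume x: "0 \<le> x" "x < 1"
    let ?S = "\<Sum>n. kap n * x ^ n"
    have part: "(\<Sum>n\<in>I. kap n * x ^ n) \<le> ?S" if "finite I" for I
      using that x by (intro sum_le_suminf summable_kap) (auto intro: terms)
    show "min (exp (- 8) / (4 * A)) (weight_hat w (1/2) * kap 0) \<le> weight_hat w x * ?S"
    proof (cases "x < 1 / 2")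
      case True
      have "weight_hat w (1/2) * kap 0 \<le> weight_hat w x * ?S"
        using True part[of "{0}"] kap_pos[of 0] by (intro mult_mono hat_antimono) auto
      then show ?thesis by simp
    next
      case False
      \<comment> \<open>The order at which \<open>x powr (2 * N + 1)\<close> is at most \<open>1 / e\<close>, but still bounded below.\<close>
      define N where "N = nat \<lceil>1 / (1 - x)\<rceil>"
      have N: "1 / (1 - x) \<le> real N" "real N \<le> 1 / (1 - x) + 1"
      proof -
        have "0 \<le> 1 / (1 - x)" using x by simp
        then have "0 \<le> real_of_int \<lceil>1 / (1 - x)\<rceil>" using le_of_int_ceiling[of "1 / (1 - x)"] by linarith
        then have "0 \<le> \<lceil>1 / (1 - x)\<rceil>" by (simp only: of_int_0_le_iff)
        then have "real N = of_int \<lceil>1 / (1 - x)\<rceil>" unfolding N_def by simp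
        then show "1 / (1 - x) \<le> real N" "real N \<le> 1 / (1 - x) + 1" by linarith+
      qed
      have N1: "1 \<le> real N * (1 - x)" using N(1) x by (simp add: field_simps)
      have "real N * (1 - x) \<le> (1 / (1 - x) + 1) * (1 - x)" using N(2) x by (intro mult_right_mono) auto
      also have "\<dots> = 1 + (1 - x)" using x by (simp add: distrib_right)
      finally have N2: "real N * (1 - x) \<le> 2" using x by linarith
      let ?mu = "weight_moment w (2 * real N + 1)"
      have mu: "0 < ?mu" by (intro moment_pos) auto
      have x0: "0 < x" using False by simp
      have "x powr (2 * real N + 1) = exp ((2 * real N + 1) * ln x)" using x0 by (simp add: powr_def)
      also have "\<dots> \<le> exp (- 1)"
      proof -
        have "ln x \<le> x - 1" using x0 by (rule ln_le_minus_one)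
        then have "(2 * real N + 1) * ln x \<le> (2 * real N + 1) * (x - 1)" by (intro mult_left_mono) auto
        also have "\<dots> \<le> - 1" using N1 x by (simp add: algebra_simps)
        finally show ?thesis by simp
      qed
      finally have mu_le: "?mu \<le> A * weight_hat w x" using A(2)[of "2 * real N + 1" x] x by simp
      have low: "exp (- 8) \<le> x ^ (2 * N)"
      proof -
        have "ln (1 / x) \<le> 1 / x - 1" using x0 by (intro ln_le_minus_one) auto
        then have "1 - 1 / x \<le> ln x" using x0 by (simp add: ln_div)
        moreover have "- 2 * (1 - x) \<le> 1 - 1 / x"
        proof -
          have "(1 - x) * (1 / x) \<le> (1 - x) * 2" using False x by (intro mult_left_mono) (auto simp: field_simps)
          then show ?thesis using x0 by (simp add: field_simps)
        qed
        ultimately have "- 2 * (1 - x) \<le> ln x" by linarith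
        then have "(2 * real N) * (- 2 * (1 - x)) \<le> (2 * real N) * ln x" by (intro mult_left_mono) auto
        then have "- 8 \<le> real (2 * N) * ln x" using N2 by (simp add: algebra_simps)
        then have "exp (- 8) \<le> exp (real (2 * N) * ln x)" by simp
        also have "\<dots> = x ^ (2 * N)" using x0 by (simp only: exp_of_nat_mult) simp
        finally show ?thesis .
      qed
      have each: "1 / (2 * (2 * real N + 1) * ?mu) * exp (- 8) \<le> kap n * x ^ n" if n: "n \<in> {N..2 * N}" for n
      proof (rule mult_mono)
        show "1 / (2 * (2 * real N + 1) * ?mu) \<le> kap n"
          unfolding kap_def using n mu moment_pos[of "2 * real n + 1"]
          by (intro divide_left_mono mult_mono[of "2 * (real n + 1)"] moment_antimono mult_pos_pos) auto
        have "x ^ (2 * N) \<le> x ^ n" using n x by (intro power_decreasing) auto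
        then show "exp (- 8) \<le> x ^ n" using low by linarith
      qed (use kap_pos[of n] in auto)
      have "(real N + 1) * (1 / (2 * (2 * real N + 1) * ?mu) * exp (- 8)) =
         (\<Sum>n\<in>{N..2 * N}. 1 / (2 * (2 * real N + 1) * ?mu) * exp (- 8))"
        by simp
      also have "\<dots> \<le> (\<Sum>n\<in>{N..2 * N}. kap n * x ^ n)" by (intro sum_mono each)
      also have "\<dots> \<le> ?S" by (intro part) auto
      finally have S: "(real N + 1) * (1 / (2 * (2 * real N + 1) * ?mu) * exp (- 8)) \<le> ?S" .
      have half: "1 / 2 \<le> (real N + 1) / (2 * real N + 1)" by (simp add: field_simps)
      have "1 / (4 * ?mu) * exp (- 8) = 1 / 2 * (1 / (2 * ?mu) * exp (- 8))" by simp
      also have "\<dots> \<le> (real N + 1) / (2 * real N + 1) * (1 / (2 * ?mu) * exp (- 8))"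
        using half mu by (intro mult_right_mono) auto
      also have "\<dots> = (real N + 1) * (1 / (2 * (2 * real N + 1) * ?mu) * exp (- 8))"
        by (simp add: divide_simps)
      finally have S': "1 / (4 * ?mu) * exp (- 8) \<le> ?S" using S by linarith
      have hx: "0 < weight_hat w x" using x by (intro hat_pos) auto
      have "exp (- 8) / (4 * A) \<le> weight_hat w x * (1 / (4 * ?mu) * exp (- 8))"
      proof -
        have "exp (- 8) / (4 * A) = weight_hat w x * (exp (- 8) / (4 * (A * weight_hat w x)))"
          using hx A by simp
        also have "\<dots> \<le> weight_hat w x * (exp (- 8) / (4 * ?mu))"
          using hx mu_le mu A(1) by (intro mult_left_mono divide_left_mono mult_pos_pos) auto
        finally show ?thesis by simp
      qed
      also have "\<dots> \<le> weight_hat w x * ?S" using S' by (intro mult_left_mono) auto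
      finally show ?thesis by simp
    qed
  qed
qed

text \<open>For \<open>y \<le> r\<close> the point \<open>r * y\<close> is no further from \<open>1\<close> than \<open>2 * (1 - y)\<close>, so that doubling applies.\<close>

lemma kern_lower_scaled:
  obtains c where "0 < c" "\<And>r y. \<lbrakk>0 \<le> y; y \<le> r; r < 1\<rbrakk> \<Longrightarrow>
    c \<le> weight_hat w y * (\<Sum>n. kap n * (r * y) ^ n)"
proof -
  obtain c where c: "0 < c" "\<And>x. \<lbrakk>0 \<le> x; x < 1\<rbrakk> \<Longrightarrow> c \<le> weight_hat w x * (\<Sum>n. kap n * x ^ n)"
    by (rule kern_lower) blast
  show ?thesis
  proof (rule that[of "c / C"])
    show "0 < c / C" using c C by simp
    fix r y :: real assume y: "0 \<le> y" "y \<le> r" "r < 1"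
    have ry: "0 \<le> r * y" "r * y < 1"
    proof -
      show "0 \<le> r * y" using y by simp
      have "r * y \<le> r * 1" using y by (intro mult_left_mono) auto
      then show "r * y < 1" using y by simp
    qed
    have "weight_hat w (r * y) \<le> C * weight_hat w y"
    proof (cases "y < 1 / 2")
      case True
      have "weight_hat w (r * y) \<le> weight_hat w 0" using ry by (intro hat_antimono) auto
      also have "\<dots> \<le> C * weight_hat w ((1 + 0) / 2)" by (intro doubling) auto
      also have "\<dots> \<le> C * weight_hat w y" using True C by (intro mult_left_mono hat_antimono) auto
      finally show ?thesis .
    next
      case False
      have "0 \<le> (y - 1)\<^sup>2" by simp
      then have "2 * y - 1 \<le> y * y" by (simp add: power2_eq_square algebra_simps)
      also have "\<dots> \<le> r * y" using y by (intro mult_right_mono) auto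
      finally have "weight_hat w (r * y) \<le> weight_hat w (2 * y - 1)" by (rule hat_antimono)
      also have "\<dots> \<le> C * weight_hat w ((1 + (2 * y - 1)) / 2)" using y False by (intro doubling) auto
      finally show ?thesis by simp
    qed
    moreover have "0 \<le> (\<Sum>n. kap n * (r * y) ^ n)"
      using kap_pos ry by (intro suminf_nonneg summable_kap) (auto simp: less_imp_le)
    ultimately have "weight_hat w (r * y) * (\<Sum>n. kap n * (r * y) ^ n) \<le> C * weight_hat w y * (\<Sum>n. kap n * (r * y) ^ n)"
      by (rule mult_right_mono)
    then have "c \<le> C * (weight_hat w y * (\<Sum>n. kap n * (r * y) ^ n))"
      using c(2)[OF ry] by (simp add: mult.assoc)
    then show "c / C \<le> weight_hat w y * (\<Sum>n. kap n * (r * y) ^ n)" using C by (simp add: field_simps)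
  qed
qed

lemma kern_holomorphic: "kern holomorphic_on ball 0 1"
proof -
  have "kern field_differentiable at z" if "cmod z < 1" for z
  proof -
    have "((\<lambda>z. \<Sum>n. of_real (kap n) * z ^ n) has_field_derivative
        (\<Sum>n. diffs (\<lambda>n. of_real (kap n)) n * z ^ n)) (at z)"
      by (rule termdiffs_strong'[where K = 1]) (use that summable_kern in auto)
    then show ?thesis unfolding field_differentiable_def kern_def[abs_def] by blast
  qed
  then show ?thesis by (auto simp: holomorphic_on_def intro: field_differentiable_at_within)
qed

section \<open>The kernel and the operator as power series\<close>

text \<open>Termwise integration: the contour integral is evaluated with the primitive \<open>\<zeta> * kern (t * \<zeta>)\<close>, and dividing by \<open>z\<close> leaves a
  function that is continuous at \<open>0\<close>.\<close>

lemma hilbert_kernel_eq_kern: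
  assumes t: "0 \<le> t" "t < 1" and z: "cmod z < 1"
  shows "hilbert_kernel w t z = kern (of_real t * z)"
proof -
  define c where "c n = (case n of 0 \<Rightarrow> 0 | Suc n \<Rightarrow> complex_of_real (kap n * t ^ n))" for n
  define P where "P \<zeta> = (\<Sum>n. c n * \<zeta> ^ n)" for \<zeta>
  have tz: "cmod (of_real t * \<zeta>) < 1" if "cmod \<zeta> < 1" for \<zeta>
  proof -
    have "t * cmod \<zeta> \<le> 1 * cmod \<zeta>" using t by (intro mult_right_mono) auto
    then show ?thesis using that t by (simp add: norm_mult)
  qed
  have summ: "summable (\<lambda>n. c n * \<zeta> ^ n)" "P \<zeta> = \<zeta> * kern (of_real t * \<zeta>)" if "cmod \<zeta> < 1" for \<zeta>
  proof -
    have s: "(\<lambda>n. \<zeta> * (of_real (kap n) * (of_real t * \<zeta>) ^ n)) sums (\<zeta> * kern (of_real t * \<zeta>))"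
      unfolding kern_def using summable_kern[OF tz[OF that]] by (intro sums_mult summable_sums)
    have "(\<lambda>n. c (Suc n) * \<zeta> ^ Suc n) = (\<lambda>n. \<zeta> * (of_real (kap n) * (of_real t * \<zeta>) ^ n))"
      by (auto simp: c_def power_mult_distrib mult_ac)
    then have "(\<lambda>n. c (Suc n) * \<zeta> ^ Suc n) sums (\<zeta> * kern (of_real t * \<zeta>))" using s by simp
    then have "(\<lambda>n. c n * \<zeta> ^ n) sums (\<zeta> * kern (of_real t * \<zeta>))"
      by (subst (asm) sums_Suc_iff) (simp add: c_def)
    then show "summable (\<lambda>n. c n * \<zeta> ^ n)" "P \<zeta> = \<zeta> * kern (of_real t * \<zeta>)"
      unfolding P_def by (auto simp: sums_iff)
  qed
  have deriv: "(P has_field_derivative bergman_kernel w (of_real t) \<zeta>) (at \<zeta>)" if "cmod \<zeta> < 1" for \<zeta>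
  proof -
    have "(P has_field_derivative (\<Sum>n. diffs c n * \<zeta> ^ n)) (at \<zeta>)"
      unfolding P_def by (rule termdiffs_strong'[where K = 1]) (use that summ in auto)
    moreover have "diffs c n * \<zeta> ^ n = (cnj (of_real t) * \<zeta>) ^ n / of_real (2 * weight_moment w (2 * real n + 1))" for n
    proof -
      have m: "weight_moment w (2 * real n + 1) \<noteq> 0" using moment_pos[of "2 * real n + 1"] by simp
      have "(real n + 1) * (kap n * t ^ n) = t ^ n / (2 * weight_moment w (2 * real n + 1))"
        using m by (simp add: kap_def divide_simps)
      then have "complex_of_real ((real n + 1) * (kap n * t ^ n)) = complex_of_real (t ^ n / (2 * weight_moment w (2 * real n + 1)))"
        by simp
      then have "diffs c n = of_real t ^ n / of_real (2 * weight_moment w (2 * real n + 1))"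
        unfolding diffs_def c_def by (simp add: add.commute)
      then show ?thesis by (simp add: power_mult_distrib)
    qed
    ultimately show ?thesis unfolding bergman_kernel_def by simp
  qed
  define K where "K = (\<lambda>w'. 1 / w' * contour_integral (linepath 0 w') (bergman_kernel w (of_real t)))"
  have K: "K v = kern (of_real t * v)" if v: "cmod v < 1" "v \<noteq> 0" for v
  proof -
    have "(bergman_kernel w (of_real t) has_contour_integral (P (pathfinish (linepath 0 v)) - P (pathstart (linepath 0 v)))) (linepath 0 v)"
    proof (rule contour_integral_primitive)
      show "(P has_field_derivative bergman_kernel w (of_real t) x) (at x within ball 0 1)" if "x \<in> ball 0 1" for x
        using deriv that by (auto intro: has_field_derivative_at_within)
      show "path_image (linepath 0 v) \<subseteq> ball 0 1"
        unfolding path_image_linepath using v by (intro closed_segment_subset) auto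
    qed (rule valid_path_linepath)
    then have "contour_integral (linepath 0 v) (bergman_kernel w (of_real t)) = P v - P 0"
      by (simp add: contour_integral_unique)
    then show ?thesis using summ(2)[of v] summ(2)[of 0] v by (simp add: K_def)
  qed
  have "hilbert_kernel w t z = (if z = 0 then Lim (at 0) K else K z)"
    unfolding hilbert_kernel_def K_def Let_def ..
  also have "\<dots> = kern (of_real t * z)"
  proof (cases "z = 0")
    case True
    have "isCont kern 0"
      using kern_holomorphic by (intro continuous_on_interior[of "ball 0 1"] holomorphic_on_imp_continuous_on) auto
    then have "(kern \<longlongrightarrow> kern (of_real t * 0)) (nhds 0)" by (simp add: isCont_def tendsto_nhds_iff)
    then have "((\<lambda>v. kern (of_real t * v)) \<longlongrightarrow> kern (of_real t * 0)) (at 0)"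
    proof (rule filterlim_compose)
      have "((\<lambda>v. of_real t * v) \<longlongrightarrow> of_real t * 0) (at (0::complex))" by (intro tendsto_intros)
      then show "filterlim (\<lambda>v. of_real t * v) (nhds 0) (at (0::complex))" by simp
    qed
    moreover have "eventually (\<lambda>v. kern (of_real t * v) = K v) (at 0)"
      unfolding eventually_at using K by (intro exI[of _ 1]) auto
    ultimately have "(K \<longlongrightarrow> kern (of_real t * 0)) (at 0)" by (rule Lim_transform_eventually)
    then have "Lim (at 0) K = kern (of_real t * 0)" by (intro tendsto_Lim) auto
    then show ?thesis using True by simp
  qed (use K z in auto)
  finally show ?thesis .
qed

end

lemma norm_scaled_lt:
  assumes "0 \<le> t" "t < 1" "cmod z < 1"
  shows "cmod (of_real t * z) < 1" "cmod (of_real t * z) \<le> cmod z"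
proof -
  have "t * cmod z \<le> 1 * cmod z" using assms by (intro mult_right_mono) auto
  then show "cmod (of_real t * z) < 1" "cmod (of_real t * z) \<le> cmod z"
    using assms by (auto simp: norm_mult)
qed

context doubling_weight
begin

lemma kern_ray_measurable:
  assumes z: "cmod z < 1"
  shows "(\<lambda>t. indicator {0..<1} t *\<^sub>R kern (of_real t * z)) \<in> borel_measurable borel"
proof (rule borel_measurable_continuous_on_indicator)
  have "continuous_on (ball 0 1) kern" by (rule holomorphic_on_imp_continuous_on[OF kern_holomorphic])
  then show "continuous_on {0..<1} (\<lambda>t::real. kern (of_real t * z))"
    by (rule continuous_on_compose2) (use norm_scaled_lt z in \<open>auto intro!: continuous_intros\<close>)
qed simp

lemma indicator_hilbert_integrand:
  assumes z: "cmod z < 1"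
  shows "indicator {0..<1} t *\<^sub>R hilbert_integrand w f z t =
    (indicator {0..<1} t *\<^sub>R (f t * of_real (w t))) * (indicator {0..<1} t *\<^sub>R kern (of_real t * z))"
  using z by (auto simp: indicator_def hilbert_integrand_def hilbert_kernel_eq_kern)

lemma norm_kern_ray_le:
  assumes z: "cmod z < 1"
  shows "norm (indicator {0..<1} t *\<^sub>R kern (of_real t * z)) \<le> (\<Sum>n. kap n * cmod z ^ n)"
proof (cases "t \<in> {0..<1}")
  case True
  then show ?thesis using norm_kern_le[of "of_real t * z" "cmod z"] norm_scaled_lt[of t z] z by simp
next
  case False
  have "0 \<le> (\<Sum>n. kap n * cmod z ^ n)"
    using z kap_pos by (intro suminf_nonneg summable_kap) (auto simp: less_imp_le)
  then show ?thesis using False by simp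
qed

lemma hilbert_integrand_integrable:
  fixes f :: "real \<Rightarrow> complex"
  assumes int: "set_integrable lebesgue {0..<1} (\<lambda>t. f t * of_real (w t))" and z: "cmod z < 1"
  shows "set_integrable lebesgue {0..<1} (hilbert_integrand w f z)"
proof -
  let ?S = "\<Sum>n. kap n * cmod z ^ n"
  have f: "integrable lebesgue (\<lambda>t. indicator {0..<1} t *\<^sub>R (f t * of_real (w t)))"
    using int unfolding set_integrable_def .
  have k: "(\<lambda>t. indicator {0..<1} t *\<^sub>R kern (of_real t * z)) \<in> borel_measurable lebesgue"
    using kern_ray_measurable[OF z] by (intro measurable_completion) simp
  show ?thesis
    unfolding set_integrable_def indicator_hilbert_integrand[OF z]
  proof (rule Bochner_Integration.integrable_bound)
    show "integrable lebesgue (\<lambda>t. ?S * norm (indicator {0..<1} t *\<^sub>R (f t * of_real (w t))))"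
      using f by (intro integrable_mult_right integrable_norm)
    show "(\<lambda>t. indicator {0..<1} t *\<^sub>R (f t * of_real (w t)) * (indicator {0..<1} t *\<^sub>R kern (of_real t * z)))
        \<in> borel_measurable lebesgue"
      using borel_measurable_integrable[OF f] k by (rule borel_measurable_times)
    show "AE t in lebesgue. norm (indicator {0..<1} t *\<^sub>R (f t * of_real (w t)) * (indicator {0..<1} t *\<^sub>R kern (of_real t * z)))
      \<le> norm (?S * norm (indicator {0..<1} t *\<^sub>R (f t * of_real (w t))))"
    proof (rule AE_I2)
      fix t :: real
      let ?a = "norm (indicator {0..<1} t *\<^sub>R (f t * of_real (w t)))" and ?b = "norm (indicator {0..<1} t *\<^sub>R kern (of_real t * z))"
      have "?a * ?b \<le> ?a * ?S" by (intro mult_left_mono norm_kern_ray_le[OF z]) simp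
      also have "\<dots> \<le> norm (?S * ?a)" by (metis abs_ge_self mult.commute real_norm_def)
      finally show "norm (indicator {0..<1} t *\<^sub>R (f t * of_real (w t)) * (indicator {0..<1} t *\<^sub>R kern (of_real t * z)))
        \<le> norm (?S * ?a)" by (simp only: norm_mult)
    qed
  qed
qed

text \<open>The image is a power series whose coefficients are the \<open>kap n\<close> times the moments of \<open>f * w\<close>; hence it is holomorphic.\<close>

lemma hilbert_op_sums:
  fixes f :: "real \<Rightarrow> complex"
  assumes int: "set_integrable lebesgue {0..<1} (\<lambda>t. f t * of_real (w t))" and z: "cmod z < 1"
  shows "(\<lambda>n. (LINT t|lebesgue. (indicator {0..<1} t *\<^sub>R (f t * of_real (w t))) * of_real (kap n * t ^ n)) * z ^ n)
    sums hilbert_op w f z"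
proof -
  let ?f = "\<lambda>t. indicator {0..<1} t *\<^sub>R (f t * of_real (w t))"
  let ?g = "\<lambda>(n::nat) (t::real). ?f t * of_real (kap n * t ^ n) * z ^ n"
  have f: "integrable lebesgue ?f" using int unfolding set_integrable_def .
  have le: "norm (?g n t) \<le> norm (?f t) * (kap n * cmod z ^ n)" for n t
  proof (cases "t \<in> {0..<1}")
    case True
    then have "t ^ n \<le> 1" by (intro power_le_one) auto
    then have "kap n * t ^ n * cmod z ^ n \<le> kap n * 1 * cmod z ^ n"
      using kap_pos[of n] by (intro mult_right_mono mult_left_mono) auto
    then have "norm (?f t) * (kap n * t ^ n * cmod z ^ n) \<le> norm (?f t) * (kap n * cmod z ^ n)"
      by (intro mult_left_mono) auto
    then show ?thesis using True kap_pos[of n] by (simp add: norm_mult norm_power abs_mult mult.assoc)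
  qed simp
  have g: "integrable lebesgue (?g n)" for n
  proof (rule Bochner_Integration.integrable_bound)
    show "integrable lebesgue (\<lambda>t. norm (?f t) * (kap n * cmod z ^ n))"
      using f by (intro integrable_mult_left integrable_norm)
    have "(\<lambda>t. of_real (kap n * t ^ n) * z ^ n) \<in> borel_measurable borel"
      by (intro borel_measurable_continuous_onI continuous_intros)
    then have "(\<lambda>t. of_real (kap n * t ^ n) * z ^ n) \<in> borel_measurable lebesgue"
      by (intro measurable_completion) simp
    from borel_measurable_times[OF borel_measurable_integrable[OF f] this]
    show "?g n \<in> borel_measurable lebesgue" by (simp add: mult.assoc)
    show "AE t in lebesgue. norm (?g n t) \<le> norm (norm (?f t) * (kap n * cmod z ^ n))"
    proof (rule AE_I2)
      fix t
      show "norm (?g n t) \<le> norm (norm (?f t) * (kap n * cmod z ^ n))"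
        using le[where n = n and t = t] by (simp only: real_norm_def)
    qed
  qed
  have "(\<lambda>n. LINT t|lebesgue. ?g n t) sums (LINT t|lebesgue. (\<Sum>n. ?g n t))"
  proof (rule sums_integral[OF g])
    show "AE t in lebesgue. summable (\<lambda>n. norm (?g n t))"
    proof (rule AE_I2)
      fix t
      show "summable (\<lambda>n. norm (?g n t))"
      proof (rule summable_comparison_test')
        show "summable (\<lambda>n. norm (?f t) * (kap n * cmod z ^ n))"
          using z by (intro summable_mult summable_kap) auto
        show "norm (norm (?g n t)) \<le> norm (?f t) * (kap n * cmod z ^ n)" for n using le by simp
      qed
    qed
    show "summable (\<lambda>n. LINT t|lebesgue. norm (?g n t))"
    proof (rule summable_comparison_test')
      show "summable (\<lambda>n. (LINT t|lebesgue. norm (?f t)) * (kap n * cmod z ^ n))"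
        using z by (intro summable_mult summable_kap) auto
      fix n :: nat
      have "(LINT t|lebesgue. norm (?g n t)) \<le> (LINT t|lebesgue. norm (?f t) * (kap n * cmod z ^ n))"
      proof (rule integral_mono)
        show "integrable lebesgue (\<lambda>t. norm (?g n t))" using g[of n] by (rule integrable_norm)
        show "integrable lebesgue (\<lambda>t. norm (?f t) * (kap n * cmod z ^ n))"
          using f by (intro integrable_mult_left integrable_norm)
      qed (rule le)
      also have "\<dots> = (LINT t|lebesgue. norm (?f t)) * (kap n * cmod z ^ n)" by simp
      finally show "norm (LINT t|lebesgue. norm (?g n t)) \<le> (LINT t|lebesgue. norm (?f t)) * (kap n * cmod z ^ n)"
        by (simp add: integral_nonneg_AE del: norm_scaleR norm_mult)
    qed
  qed
  also have "(LINT t|lebesgue. (\<Sum>n. ?g n t)) = hilbert_op w f z"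
    unfolding hilbert_op_def set_lebesgue_integral_def
  proof (rule Bochner_Integration.integral_cong[OF refl])
    fix t :: real
    show "(\<Sum>n. ?g n t) = indicator {0..<1} t *\<^sub>R hilbert_integrand w f z t"
    proof (cases "t \<in> {0..<1}")
      case True
      then have tz: "cmod (of_real t * z) < 1" using norm_scaled_lt z by auto
      have "(\<Sum>n. ?g n t) = (\<Sum>n. ?f t * (of_real (kap n) * (of_real t * z) ^ n))"
        by (simp add: power_mult_distrib mult_ac)
      also have "\<dots> = ?f t * kern (of_real t * z)"
        unfolding kern_def by (rule suminf_mult[OF summable_kern[OF tz]])
      finally show ?thesis using True unfolding indicator_hilbert_integrand[OF z] by simp
    qed simp
  qed
  finally show ?thesis by (simp only: integral_mult_left_zero)
qed

lemma hilbert_op_holomorphic: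
  fixes f :: "real \<Rightarrow> complex"
  assumes int: "set_integrable lebesgue {0..<1} (\<lambda>t. f t * of_real (w t))"
  shows "hilbert_op w f holomorphic_on ball 0 1"
proof -
  define a where "a n = (LINT t|lebesgue. (indicator {0..<1} t *\<^sub>R (f t * of_real (w t))) * of_real (kap n * t ^ n))" for n
  have sums: "(\<lambda>n. a n * z ^ n) sums hilbert_op w f z" if "z \<in> ball 0 1" for z
    unfolding a_def using hilbert_op_sums[OF int] that by simp
  have "(\<lambda>z. \<Sum>n. a n * z ^ n) field_differentiable at z" if "z \<in> ball 0 1" for z
    unfolding field_differentiable_def
    by (rule exI, rule termdiffs_strong'[where K = 1]) (use that sums in \<open>auto simp: sums_iff\<close>)
  then have "(\<lambda>z. \<Sum>n. a n * z ^ n) holomorphic_on ball 0 1"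
    by (auto simp: holomorphic_on_def intro: field_differentiable_at_within)
  then show ?thesis
    by (rule holomorphic_transform) (use sums in \<open>auto simp: sums_iff\<close>)
qed

text \<open>The kernel estimate integrated against \<open>f * w\<close>. Since the kernel at \<open>t * s\<close> only sees \<open>y \<le> t\<close> and \<open>y \<le> s\<close>, Tonelli's theorem
  leaves the tails of \<open>\<Phi>\<close>.\<close>

lemma norm_hilbert_op_le:
  obtains K where "0 < K" "\<And>(f :: real \<Rightarrow> complex) \<Phi> s \<theta>. \<lbrakk>\<Phi> \<in> borel_measurable borel;
      AE t in lebesgue. t \<in> {0..<1} \<longrightarrow> ennreal (cmod (f t) * w t) \<le> \<Phi> t;
      set_integrable lebesgue {0..<1} (\<lambda>t. f t * of_real (w t));
      0 \<le> s; s < 1; \<theta> \<noteq> 0; \<bar>\<theta>\<bar> \<le> pi\<rbrakk> \<Longrightarrow>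
    ennreal (cmod (hilbert_op w f (of_real s * cis \<theta>))) \<le> ennreal K *
      ((\<integral>\<^sup>+t\<in>{0..<1}. \<Phi> t \<partial>lborel) +
       (\<integral>\<^sup>+y\<in>{0..s}. ennreal (hilb \<theta> y) * (\<integral>\<^sup>+t\<in>{y..<1}. \<Phi> t \<partial>lborel) \<partial>lborel))"
proof -
  obtain K where K: "0 < K" and kern: "\<And>x t. \<lbrakk>0 \<le> x; x < 1; t \<noteq> 0; \<bar>t\<bar> \<le> pi\<rbrakk> \<Longrightarrow>
    ennreal (cmod (kern (of_real x * cis t))) \<le> ennreal K * (1 + (\<integral>\<^sup>+y\<in>{0..x}. ennreal (hilb t y) \<partial>lborel))"
    by (rule norm_kern_le_hilb) blast
  show ?thesis
  proof (rule that[OF K])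
    fix f :: "real \<Rightarrow> complex" and \<Phi> :: "real \<Rightarrow> ennreal" and s \<theta> :: real
    assume \<Phi> [measurable]: "\<Phi> \<in> borel_measurable borel"
      and ae: "AE t in lebesgue. t \<in> {0..<1} \<longrightarrow> ennreal (cmod (f t) * w t) \<le> \<Phi> t"
      and int: "set_integrable lebesgue {0..<1} (\<lambda>t. f t * of_real (w t))"
      and s: "0 \<le> s" "s < 1" and \<theta>: "\<theta> \<noteq> 0" "\<bar>\<theta>\<bar> \<le> pi"
    let ?z = "of_real s * cis \<theta>"
    let ?\<phi> = "\<lambda>t. \<Phi> t * indicator {0..<1} t"
    let ?A = "\<lambda>t. \<integral>\<^sup>+y. ennreal (hilb \<theta> y) * indicator {0..s} y * indicator {y. y \<le> t} y \<partial>lborel"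
    have [measurable]: "?A \<in> borel_measurable borel"
      by (rule borel_measurable_nn_integral_below) measurable
    have z: "cmod ?z < 1" using s by (simp add: norm_mult)
    have "ennreal (cmod (hilbert_op w f ?z)) \<le> (\<integral>\<^sup>+t. ennreal (norm (indicator {0..<1} t *\<^sub>R hilbert_integrand w f ?z t)) \<partial>lebesgue)"
      unfolding hilbert_op_def set_lebesgue_integral_def
      using hilbert_integrand_integrable[OF int z] unfolding set_integrable_def
      by (rule integral_norm_bound_ennreal)
    also have "\<dots> \<le> (\<integral>\<^sup>+t. ?\<phi> t *
        (ennreal K * (1 + ?A t)) \<partial>lebesgue)"
    proof (rule nn_integral_mono_AE)
      show "AE t in lebesgue. ennreal (norm (indicator {0..<1} t *\<^sub>R hilbert_integrand w f ?z t)) \<le>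
        ?\<phi> t * (ennreal K * (1 + ?A t))"
        using ae
      proof eventually_elim
        case (elim t)
        show ?case
        proof (cases "t \<in> {0..<1}")
          case True
          have ts: "0 \<le> t * s" "t * s \<le> s" "t * s \<le> t" "t * s < 1"
          proof -
            show "0 \<le> t * s" using True s by simp
            show "t * s \<le> s" using True s by (simp add: mult_left_le_one_le)
            then show "t * s < 1" using s by linarith
            show "t * s \<le> t" using True s by (simp add: mult_left_le)
          qed
          have "indicator {0..<1} t *\<^sub>R hilbert_integrand w f ?z t = f t * of_real (w t) * kern (of_real (t * s) * cis \<theta>)"
            using True unfolding indicator_hilbert_integrand[OF z] by (simp add: mult.assoc)
          then have "norm (indicator {0..<1} t *\<^sub>R hilbert_integrand w f ?z t) = cmod (f t) * w t * cmod (kern (of_real (t * s) * cis \<theta>))"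
            by (simp only: norm_mult norm_of_real abs_of_nonneg[OF nonneg])
          then have "ennreal (norm (indicator {0..<1} t *\<^sub>R hilbert_integrand w f ?z t)) =
             ennreal (cmod (f t) * w t) * ennreal (cmod (kern (of_real (t * s) * cis \<theta>)))"
            by (simp add: ennreal_mult)
          also have "\<dots> \<le> \<Phi> t * (ennreal K * (1 + (\<integral>\<^sup>+y\<in>{0..t * s}. ennreal (hilb \<theta> y) \<partial>lborel)))"
            using elim True ts \<theta> by (intro mult_mono kern) auto
          also have "(\<integral>\<^sup>+y\<in>{0..t * s}. ennreal (hilb \<theta> y) \<partial>lborel) \<le> ?A t"
            using ts by (intro nn_integral_mono) (auto simp: indicator_def)
          finally show ?thesis using True by (simp add: mult_left_mono add_left_mono)
        qed simp
      qed
    qed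
    also have "\<dots> = (\<integral>\<^sup>+t. ennreal K * (?\<phi> t + ?\<phi> t * ?A t) \<partial>lborel)"
      unfolding nn_integral_completion by (intro nn_integral_cong) (simp only: distrib_left mult_1_right mult_1 mult_ac)
    also have "\<dots> = ennreal K * ((\<integral>\<^sup>+t. ?\<phi> t \<partial>lborel) + (\<integral>\<^sup>+t. ?\<phi> t * ?A t \<partial>lborel))"
      by (subst nn_integral_cmult) (auto simp: nn_integral_add)
    also have "(\<integral>\<^sup>+t. ?\<phi> t * ?A t \<partial>lborel) =
        (\<integral>\<^sup>+y. ennreal (hilb \<theta> y) * indicator {0..s} y * (\<integral>\<^sup>+t. ?\<phi> t * indicator {y..} t \<partial>lborel) \<partial>lborel)"
      by (rule nn_integral_triangle_swap[symmetric]) measurable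
    also have "\<dots> = (\<integral>\<^sup>+y\<in>{0..s}. ennreal (hilb \<theta> y) * (\<integral>\<^sup>+t\<in>{y..<1}. \<Phi> t \<partial>lborel) \<partial>lborel)"
    proof (intro nn_integral_cong)
      fix y
      have "(\<integral>\<^sup>+t. ?\<phi> t * indicator {y..} t \<partial>lborel) = (\<integral>\<^sup>+t\<in>{y..<1}. \<Phi> t \<partial>lborel)" if "0 \<le> y"
        using that by (intro nn_integral_cong) (auto simp: indicator_def)
      then show "ennreal (hilb \<theta> y) * indicator {0..s} y * (\<integral>\<^sup>+t. ?\<phi> t * indicator {y..} t \<partial>lborel) =
          ennreal (hilb \<theta> y) * (\<integral>\<^sup>+t\<in>{y..<1}. \<Phi> t \<partial>lborel) * indicator {0..s} y"
        by (cases "y \<in> {0..s}") auto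
    qed
    finally show "ennreal (cmod (hilbert_op w f ?z)) \<le> ennreal K *
      ((\<integral>\<^sup>+t\<in>{0..<1}. \<Phi> t \<partial>lborel) +
       (\<integral>\<^sup>+y\<in>{0..s}. ennreal (hilb \<theta> y) * (\<integral>\<^sup>+t\<in>{y..<1}. \<Phi> t \<partial>lborel) \<partial>lborel))" .
  qed
qed

text \<open>For nonnegative functions the kernel on the radius is positive and increasing, so that it may be evaluated at the left end
  of the support.\<close>

lemma norm_hilbert_op_ge:
  fixes g :: "real \<Rightarrow> real"
  assumes int: "set_integrable lebesgue {0..<1} (\<lambda>t. g t * w t)"
    and g: "\<And>t. 0 \<le> g t" "\<And>t. t < r \<Longrightarrow> g t = 0"
    and r: "0 \<le> r" "r < 1" and y: "0 \<le> y" "y < 1"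
  shows "(\<Sum>n. kap n * (r * y) ^ n) * (LINT t:{0..<1}|lebesgue. g t * w t) \<le>
    cmod (hilbert_op w (\<lambda>t. of_real (g t)) (of_real y))"
proof -
  let ?K = "\<lambda>x. \<Sum>n. kap n * x ^ n"
  let ?f = "\<lambda>t. complex_of_real (g t)"
  have yc: "cmod (of_real y) < 1" using y by simp
  have intc: "set_integrable lebesgue {0..<1} (\<lambda>t. ?f t * of_real (w t))"
    using int unfolding set_integrable_def
    by (subst (asm) complex_of_real_integrable_eq[symmetric]) (simp add: scaleR_conv_of_real)
  have i1: "integrable lebesgue (\<lambda>t. indicator {0..<1} t *\<^sub>R hilbert_integrand w ?f (of_real y) t)"
    using hilbert_integrand_integrable[OF intc yc] unfolding set_integrable_def .
  have ty: "0 \<le> t * y" "t * y < 1" if "t \<in> {0..<1}" for t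
    using that y norm_scaled_lt(1)[of t "of_real y"] by (auto simp: norm_mult)
  have eq: "indicator {0..<1} t *\<^sub>R hilbert_integrand w ?f (of_real y) t =
      of_real (indicator {0..<1} t * (g t * w t) * ?K (t * y))" for t
  proof (cases "t \<in> {0..<1}")
    case True
    then have "kern (of_real t * of_real y) = of_real (?K (t * y))"
      using kern_of_real[of "t * y"] ty[OF True] by simp
    then show ?thesis using True unfolding indicator_hilbert_integrand[OF yc] by simp
  qed simp
  have i2: "integrable lebesgue (\<lambda>t. indicator {0..<1} t * (g t * w t) * ?K (t * y))"
    using i1 unfolding eq by (subst (asm) complex_of_real_integrable_eq)
  have ge: "?K (r * y) * (indicator {0..<1} t * (g t * w t)) \<le> indicator {0..<1} t * (g t * w t) * ?K (t * y)" for t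
  proof (cases "t \<in> {0..<1} \<and> r \<le> t")
    case True
    have "?K (r * y) \<le> ?K (t * y)"
    proof (intro suminf_le summable_kap mult_left_mono power_mono)
      show "r * y \<le> t * y" using True y by (intro mult_right_mono) auto
      then show "r * y < 1" using ty[of t] True by linarith
    qed (use ty[of t] True r y kap_pos in \<open>auto simp: less_imp_le\<close>)
    then have "?K (r * y) * (g t * w t) \<le> ?K (t * y) * (g t * w t)" using g(1) by (intro mult_right_mono) auto
    then show ?thesis using True by (simp add: mult_ac)
  next
    case False
    then show ?thesis using g(2)[of t] by (auto simp: indicator_def not_le)
  qed
  have "?K (r * y) * (LINT t:{0..<1}|lebesgue. g t * w t) =
      (LINT t|lebesgue. ?K (r * y) * (indicator {0..<1} t * (g t * w t)))"
    unfolding set_lebesgue_integral_def by simp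
  also have "\<dots> \<le> (LINT t|lebesgue. indicator {0..<1} t * (g t * w t) * ?K (t * y))"
    using int i2 ge unfolding set_integrable_def by (intro integral_mono integrable_mult_right) auto
  also have "\<dots> \<le> cmod (of_real (LINT t|lebesgue. indicator {0..<1} t * (g t * w t) * ?K (t * y)))"
    by simp
  also have "complex_of_real (LINT t|lebesgue. indicator {0..<1} t * (g t * w t) * ?K (t * y)) = hilbert_op w ?f (of_real y)"
    unfolding hilbert_op_def set_lebesgue_integral_def eq by (rule integral_complex_of_real[symmetric])
  finally show ?thesis .
qed

end

section \<open>A Fejer-Riesz inequality\<close>

text \<open>Cauchy's integral formula over the unit circle, with absolute values inside.\<close>

lemma Cauchy_bound_on_radius:
  assumes G: "G holomorphic_on ball 0 R" and R: "1 < R" and x: "0 \<le> x" "x < 1"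
  shows "ennreal (cmod (G (of_real x))) \<le>
    (\<integral>\<^sup>+a\<in>{-pi..<pi}. ennreal (cmod (G (cis a)) / (2 * pi * cmod (cis a - of_real x))) \<partial>lborel)"
proof -
  define h where "h a = cmod (G (cis a)) / (2 * pi * cmod (cis a - of_real x))" for a
  have ne: "cis a \<noteq> of_real x" for a
  proof
    assume "cis a = of_real x"
    then have "cmod (cis a) = \<bar>x\<bar>" by simp
    then show False using x by simp
  qed
  have contG: "continuous_on (ball 0 R) G" by (rule holomorphic_on_imp_continuous_on[OF G])
  have conth: "continuous_on UNIV h"
    unfolding h_def
    by (intro continuous_intros continuous_on_compose2[OF contG]) (use R ne in auto)
  then have [measurable]: "h \<in> borel_measurable borel" by (rule borel_measurable_continuous_onI)
  let ?I = "\<lambda>t. G (circlepath 0 1 t) / (circlepath 0 1 t - of_real x) * vector_derivative (circlepath 0 1) (at t within {0..1})"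
  have circ: "circlepath 0 1 t = cis (2 * pi * t)" for t
    by (simp add: circlepath cis_conv_exp mult_ac)
  have "((\<lambda>u. G u / (u - of_real x)) has_contour_integral (2 * of_real pi * \<i> * G (of_real x))) (circlepath 0 1)"
  proof (rule Cauchy_integral_circlepath)
    show "continuous_on (cball 0 1) G" by (rule continuous_on_subset[OF contG]) (use R in auto)
    show "G holomorphic_on ball 0 1" by (rule holomorphic_on_subset[OF G]) (use R in auto)
  qed (use x in auto)
  then have "(?I has_integral (2 * of_real pi * \<i> * G (of_real x))) {0..1}"
    by (simp add: has_contour_integral_def)
  then have I: "(?I has_integral (2 * of_real pi * \<i> * G (of_real x))) (cbox 0 1)" by simp
  have H: "((\<lambda>t. 2 * pi * (2 * pi * h (2 * pi * t))) has_integral integral {0..1} (\<lambda>t. 2 * pi * (2 * pi * h (2 * pi * t)))) {0..1}"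
    by (intro integrable_integral integrable_continuous_real continuous_intros continuous_on_compose2[OF conth]) auto
  define J where "J = integral {0..1} (\<lambda>t. 2 * pi * (2 * pi * h (2 * pi * t)))"
  have H': "((\<lambda>t. 2 * pi * (2 * pi * h (2 * pi * t))) has_integral J) {0..1}"
    unfolding J_def by (rule H)
  have h0: "0 \<le> h a" for a unfolding h_def by simp
  have "norm (2 * of_real pi * \<i> * G (of_real x)) \<le> J \<bullet> 1"
  proof (rule has_integral_norm_bound_integral_component[OF I[unfolded cbox_interval] H'])
    fix t :: real assume t: "t \<in> {0..1}"
    have "vector_derivative (circlepath 0 1) (at t within {0..1}) = 2 * of_real pi * \<i> * cis (2 * pi * t)"
      using t vector_derivative_circlepath01[of t 0 1] by (simp add: cis_conv_exp mult_ac)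
    then have "norm (?I t) = 2 * pi * (2 * pi * h (2 * pi * t))"
      by (simp add: circ norm_mult norm_divide h_def)
    then show "norm (?I t) \<le> (2 * pi * (2 * pi * h (2 * pi * t))) \<bullet> 1" by simp
  qed
  then have J: "2 * pi * cmod (G (of_real x)) \<le> J" by (simp add: norm_mult)
  have "ennreal (2 * pi) * ennreal (cmod (G (of_real x))) = ennreal (2 * pi * cmod (G (of_real x)))"
    by (simp add: ennreal_mult)
  also have "\<dots> \<le> ennreal J" using J by (rule ennreal_leI)
  also have "ennreal J = (\<integral>\<^sup>+t\<in>{0..1}. ennreal (2 * pi * (2 * pi * h (2 * pi * t))) \<partial>lborel)"
    using nn_integral_has_integral_lebesgue'[OF _ H'] h0 by simp
  also have "\<dots> = (\<integral>\<^sup>+t. ennreal (2 * pi) * (ennreal (2 * pi) * (ennreal (h (2 * pi * t)) * indicator {0..2 * pi} (0 + 2 * pi * t))) \<partial>lborel)"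
  proof (intro nn_integral_cong)
    fix t :: real
    have tp: "0 \<le> 2 * pi" by simp
    have "indicator {0..1} t = (indicator {0..2 * pi} (0 + 2 * pi * t) :: ennreal)"
      using mult_le_cancel_left_pos[of "2 * pi" t 1] mult_le_cancel_left_pos[of "2 * pi" 0 t]
      by (simp add: indicator_def)
    moreover have "ennreal (2 * pi * (2 * pi * X)) = ennreal (2 * pi) * (ennreal (2 * pi) * ennreal X)" for X
      by (simp only: ennreal_mult'[OF tp])
    ultimately show "ennreal (2 * pi * (2 * pi * h (2 * pi * t))) * indicator {0..1} t =
      ennreal (2 * pi) * (ennreal (2 * pi) * (ennreal (h (2 * pi * t)) * indicator {0..2 * pi} (0 + 2 * pi * t)))"
      by (simp only: mult.assoc[of "ennreal a" for a])
  qed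
  also have "\<dots> = ennreal (2 * pi) * (ennreal (2 * pi) * (\<integral>\<^sup>+t. ennreal (h (0 + 2 * pi * t)) * indicator {0..2 * pi} (0 + 2 * pi * t) \<partial>lborel))"
    by (simp add: nn_integral_cmult)
  also have "ennreal (2 * pi) * (\<integral>\<^sup>+t. ennreal (h (0 + 2 * pi * t)) * indicator {0..2 * pi} (0 + 2 * pi * t) \<partial>lborel)
      = (\<integral>\<^sup>+a. ennreal (h a) * indicator {0..2 * pi} a \<partial>lborel)"
    using nn_integral_real_affine[of "\<lambda>a. ennreal (h a) * indicator {0..2 * pi} a" "2 * pi" 0] by simp
  also have "(\<integral>\<^sup>+a. ennreal (h a) * indicator {0..2 * pi} a \<partial>lborel) = (\<integral>\<^sup>+a. ennreal (h a) * indicator {0..<2 * pi} a \<partial>lborel)"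
  proof (intro nn_integral_cong_AE)
    show "AE a in lborel. ennreal (h a) * indicator {0..2 * pi} a = ennreal (h a) * indicator {0..<2 * pi} a"
      using AE_lborel_singleton[of "2 * pi"] by eventually_elim (auto simp: indicator_def)
  qed
  also have "\<dots> = (\<integral>\<^sup>+a. ennreal (h (a + pi)) * indicator {0..<2 * pi} (a + pi) \<partial>lborel)"
    by (rule nn_integral_shift[symmetric]) measurable
  also have "\<dots> = (\<integral>\<^sup>+a\<in>{-pi..<pi}. ennreal (h (a + pi)) \<partial>lborel)"
    by (intro nn_integral_cong) (auto simp: indicator_def)
  also have "\<dots> = (\<integral>\<^sup>+a\<in>{-pi..<pi}. ennreal (h a) \<partial>lborel)"
  proof (rule nn_integral_period)
    show "(\<lambda>a. ennreal (h a)) \<in> borel_measurable borel" by measurable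
    show "ennreal (h (a + 2 * pi)) = ennreal (h a)" for a by (simp add: h_def cis_mult[symmetric])
  qed auto
  finally show ?thesis by (simp add: h_def ennreal_mult_le_mult_iff)
qed

text \<open>An inequality of Fejer-Riesz type. In Cauchy's formula the distance from \<open>x\<close> to a point of the circle at angle \<open>a\<close> is
  comparable with \<open>max (1 - x) \<bar>a\<bar>\<close>, so that Hilbert's inequality applies on each half of the circle.\<close>

theorem Fejer_Riesz_circle:
  assumes G: "G holomorphic_on ball 0 R" and R: "1 < R"
    and p: "1 < p" "1 < q" "1 / p + 1 / q = 1"
  shows "(\<integral>\<^sup>+x\<in>{0..<1}. ennreal (cmod (G (of_real x)) powr p) \<partial>lborel) \<le>
    ennreal ((p + q) powr p) * (\<integral>\<^sup>+a\<in>{-pi..<pi}. ennreal (cmod (G (cis a)) powr p) \<partial>lborel)"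
proof -
  define k where "k a = ennreal (cmod (G (cis a)))" for a
  have "continuous_on UNIV (\<lambda>a. cmod (G (cis a)))"
    by (intro continuous_intros continuous_on_compose2[OF holomorphic_on_imp_continuous_on[OF G]]) (use R in auto)
  from borel_measurable_continuous_onI[OF this]
  have k [measurable]: "k \<in> borel_measurable borel" unfolding k_def by measurable
  define kp where "kp a = k a * indicator {0<..<pi} a" for a
  define km where "km a = k (- a) * indicator {0<..pi} a" for a
  have [measurable]: "kp \<in> borel_measurable borel" "km \<in> borel_measurable borel"
    unfolding kp_def km_def by measurable
  define Q where "Q h u = (\<integral>\<^sup>+a\<in>{0<..}. h a * ennreal (1 / max u a) \<partial>lborel)" for h :: "real \<Rightarrow> ennreal" and u :: real
  have [measurable]: "Q kp \<in> borel_measurable borel" "Q km \<in> borel_measurable borel"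
    unfolding Q_def by measurable
  have neg: "(\<integral>\<^sup>+a. f a \<partial>lborel) = (\<integral>\<^sup>+a. f (- a) \<partial>lborel)"
    if "f \<in> borel_measurable borel" for f :: "real \<Rightarrow> ennreal"
    using nn_integral_real_affine[OF that, of "-1" 0] by simp
  have bound: "ennreal (cmod (G (of_real x))) \<le> ennreal (1 / 2) * (Q kp (1 - x) + Q km (1 - x))"
    if x: "x \<in> {0..<1}" for x
  proof -
    define kp' where "kp' a = km (- a) * ennreal (1 / max (1 - x) (- a)) * indicator {0<..} (- a)" for a
    have [measurable]: "kp' \<in> borel_measurable borel" unfolding kp'_def by measurable
    have "ennreal (cmod (G (of_real x))) \<le>
      (\<integral>\<^sup>+a\<in>{-pi..<pi}. ennreal (cmod (G (cis a)) / (2 * pi * cmod (cis a - of_real x))) \<partial>lborel)"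
      using x by (intro Cauchy_bound_on_radius[OF G R]) auto
    also have "\<dots> \<le> (\<integral>\<^sup>+a. ennreal (1 / 2) * (kp a * ennreal (1 / max (1 - x) a) * indicator {0<..} a +
        kp' a) \<partial>lborel)"
    proof (intro nn_integral_mono_AE)
      show "AE a in lborel. ennreal (cmod (G (cis a)) / (2 * pi * cmod (cis a - of_real x))) * indicator {-pi..<pi} a \<le>
        ennreal (1 / 2) * (kp a * ennreal (1 / max (1 - x) a) * indicator {0<..} a + kp' a)"
        using AE_lborel_singleton[of 0]
      proof eventually_elim
        case (elim a)
        show ?case
        proof (cases "a \<in> {-pi..<pi}")
          case True
          have mx: "max (1 - x) \<bar>a\<bar> / pi \<le> cmod (cis a - of_real x)"
          proof -
            have "1 - x \<le> cmod (cis a - of_real x)"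
              using norm_triangle_ineq2[of "cis a" "of_real x"] x by simp
            moreover have "(1 - x) / pi \<le> (1 - x) / 1"
              using x pi_gt3 by (intro divide_left_mono) auto
            ultimately have "(1 - x) / pi \<le> cmod (cis a - of_real x)" by simp
            moreover have "\<bar>a\<bar> / pi \<le> cmod (cis a - of_real x)"
              using True x by (intro norm_cis_minus_of_real_ge) auto
            ultimately show ?thesis by (auto simp: max_def)
          qed
          have pos: "0 < max (1 - x) \<bar>a\<bar>" using x by (auto simp: less_max_iff_disj)
          have "cmod (G (cis a)) / (2 * pi * cmod (cis a - of_real x)) \<le> cmod (G (cis a)) / (2 * pi * (max (1 - x) \<bar>a\<bar> / pi))"
            using mx pos by (intro divide_left_mono mult_left_mono mult_pos_pos less_le_trans[OF _ mx] divide_pos_pos) auto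
          also have "\<dots> = 1 / 2 * (cmod (G (cis a)) * (1 / max (1 - x) \<bar>a\<bar>))" by simp
          finally have "ennreal (cmod (G (cis a)) / (2 * pi * cmod (cis a - of_real x))) \<le>
             ennreal (1 / 2) * (k a * ennreal (1 / max (1 - x) \<bar>a\<bar>))"
          proof -
            assume "cmod (G (cis a)) / (2 * pi * cmod (cis a - of_real x)) \<le> 1 / 2 * (cmod (G (cis a)) * (1 / max (1 - x) \<bar>a\<bar>))"
            then have "ennreal (cmod (G (cis a)) / (2 * pi * cmod (cis a - of_real x))) \<le>
                ennreal (1 / 2 * (cmod (G (cis a)) * (1 / max (1 - x) \<bar>a\<bar>)))" by (rule ennreal_leI)
            then show ?thesis
              unfolding k_def by (simp only: ennreal_mult'[of "1 / 2"] ennreal_mult'[OF norm_ge_zero] zero_le_divide_1_iff zero_le_numeral)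
          qed
          also have "k a * ennreal (1 / max (1 - x) \<bar>a\<bar>) \<le> kp a * ennreal (1 / max (1 - x) a) * indicator {0<..} a + kp' a"
            using elim True unfolding kp'_def by (cases "a > 0") (auto simp: kp_def km_def)
          finally show ?thesis using True by (simp add: mult_left_mono)
        qed simp
      qed
    qed
    also have "\<dots> = ennreal (1 / 2) * ((\<integral>\<^sup>+a. kp a * ennreal (1 / max (1 - x) a) * indicator {0<..} a \<partial>lborel) +
        (\<integral>\<^sup>+a. kp' a \<partial>lborel))"
      by (subst nn_integral_cmult) (auto simp: nn_integral_add)
    also have "(\<integral>\<^sup>+a. kp' a \<partial>lborel) = Q km (1 - x)"
      unfolding Q_def kp'_def by (rule neg[symmetric]) measurable
    finally show ?thesis by (simp add: Q_def)
  qed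
  have bp: "ennreal (cmod (G (of_real x)) powr p) \<le> ennreal_powr (Q kp (1 - x)) p + ennreal_powr (Q km (1 - x)) p"
    if x: "x \<in> {0..<1}" for x
  proof -
    have "ennreal (cmod (G (of_real x)) powr p) = ennreal_powr (ennreal (cmod (G (of_real x)))) p" by simp
    also have "\<dots> \<le> ennreal_powr (ennreal (1 / 2) * (Q kp (1 - x) + Q km (1 - x))) p"
      using p by (intro ennreal_powr_mono bound x) auto
    also have "\<dots> = ennreal ((1 / 2) powr p) * ennreal_powr (Q kp (1 - x) + Q km (1 - x)) p"
      by (simp only: ennreal_powr_mult ennreal_powr_ennreal)
    also have "\<dots> \<le> ennreal ((1 / 2) powr p) * (ennreal (2 powr p) * (ennreal_powr (Q kp (1 - x)) p + ennreal_powr (Q km (1 - x)) p))"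
      using p by (intro mult_left_mono ennreal_powr_add_le) auto
    also have "\<dots> = ennreal_powr (Q kp (1 - x)) p + ennreal_powr (Q km (1 - x)) p"
      by (simp add: mult.assoc[symmetric] ennreal_mult[symmetric] powr_mult[symmetric])
    finally show ?thesis .
  qed
  have "(\<integral>\<^sup>+x\<in>{0..<1}. ennreal (cmod (G (of_real x)) powr p) \<partial>lborel) \<le>
     (\<integral>\<^sup>+x. ennreal_powr (Q kp (1 - x)) p * indicator {0<..} (1 - x) + ennreal_powr (Q km (1 - x)) p * indicator {0<..} (1 - x) \<partial>lborel)"
    using bp by (intro nn_integral_mono) (auto simp: indicator_def)
  also have "\<dots> = (\<integral>\<^sup>+u. ennreal_powr (Q kp u) p * indicator {0<..} u + ennreal_powr (Q km u) p * indicator {0<..} u \<partial>lborel)"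
    using nn_integral_real_affine[of "\<lambda>u. ennreal_powr (Q kp u) p * indicator {0<..} u + ennreal_powr (Q km u) p * indicator {0<..} u" "-1" 1]
    by simp
  also have "\<dots> = (\<integral>\<^sup>+u\<in>{0<..}. ennreal_powr (Q kp u) p \<partial>lborel) + (\<integral>\<^sup>+u\<in>{0<..}. ennreal_powr (Q km u) p \<partial>lborel)"
    by (rule nn_integral_add) measurable
  also have "\<dots> \<le> ennreal ((p + q) powr p) * (\<integral>\<^sup>+a\<in>{0<..}. ennreal_powr (kp a) p \<partial>lborel) +
      ennreal ((p + q) powr p) * (\<integral>\<^sup>+a\<in>{0<..}. ennreal_powr (km a) p \<partial>lborel)"
    unfolding Q_def by (intro add_mono Hilbert_max_kernel_bound p) measurable
  also have "\<dots> = ennreal ((p + q) powr p) * ((\<integral>\<^sup>+a\<in>{0<..}. ennreal_powr (kp a) p \<partial>lborel) + (\<integral>\<^sup>+a\<in>{0<..}. ennreal_powr (km a) p \<partial>lborel))"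
    by (simp add: distrib_left)
  also have "(\<integral>\<^sup>+a\<in>{0<..}. ennreal_powr (km a) p \<partial>lborel) = (\<integral>\<^sup>+a. ennreal_powr (km (- a)) p * indicator {0<..} (- a) \<partial>lborel)"
    by (rule neg) measurable
  also have "(\<integral>\<^sup>+a\<in>{0<..}. ennreal_powr (kp a) p \<partial>lborel) + \<dots> =
      (\<integral>\<^sup>+a. ennreal_powr (kp a) p * indicator {0<..} a + ennreal_powr (km (- a)) p * indicator {0<..} (- a) \<partial>lborel)"
    by (rule nn_integral_add[symmetric]) measurable
  also have "\<dots> \<le> (\<integral>\<^sup>+a\<in>{-pi..<pi}. ennreal (cmod (G (cis a)) powr p) \<partial>lborel)"
    by (intro nn_integral_mono) (auto simp: kp_def km_def k_def indicator_def)
  finally show ?thesis by (simp add: mult_left_mono)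
qed

section \<open>The Bergman space on the radius\<close>

lemma AE_area_measure: "AE z in lebesgue. P z \<Longrightarrow> AE z in area_measure. P z"
proof -
  assume "AE z in lebesgue. P z"
  then obtain N where N: "N \<in> null_sets lebesgue" "{z. \<not> P z} \<subseteq> N"
    unfolding eventually_ae_filter by auto
  have "N \<in> null_sets area_measure"
    using N(1) by (auto simp: null_sets_def area_measure_def emeasure_scale_measure)
  then show "AE z in area_measure. P z"
    unfolding eventually_ae_filter using N(2) by (auto simp: area_measure_def space_scale_measure)
qed

context borel_weight
begin

lemma holomorphic_disc_measurable:
  assumes "g holomorphic_on ball 0 1"
  shows "(\<lambda>z. indicator (ball 0 1) z *\<^sub>R g z) \<in> borel_measurable borel"
  using assms by (intro borel_measurable_continuous_on_indicator holomorphic_on_imp_continuous_on) auto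

lemma nn_integral_disc_polar:
  assumes g: "g holomorphic_on ball 0 1"
  shows "(\<integral>\<^sup>+z\<in>ball 0 1. ennreal (cmod (g z) powr p * w (cmod z)) \<partial>lborel) =
    (\<integral>\<^sup>+s\<in>{0..<1}. ennreal (w s) * (ennreal s * (\<integral>\<^sup>+a\<in>{-pi..<pi}. ennreal (cmod (g (of_real s * cis a)) powr p) \<partial>lborel)) \<partial>lborel)"
proof -
  let ?g = "\<lambda>z. indicator (ball 0 1) z *\<^sub>R g z"
  have [measurable]: "?g \<in> borel_measurable borel" by (rule holomorphic_disc_measurable[OF g])
  have [measurable]: "cis \<in> borel_measurable borel"
    by (intro borel_measurable_continuous_onI continuous_intros)
  have "(\<integral>\<^sup>+z\<in>ball 0 1. ennreal (cmod (g z) powr p * w (cmod z)) \<partial>lborel) =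
     (\<integral>\<^sup>+z\<in>ball 0 1. ennreal (cmod (?g z) powr p * w (cmod z)) \<partial>lborel)"
    by (intro nn_integral_cong) (simp add: indicator_def)
  also have "\<dots> = (\<integral>\<^sup>+s\<in>{0..<1}. ennreal s * (\<integral>\<^sup>+a\<in>{-pi..<pi}.
      ennreal (cmod (?g (of_real s * cis a)) powr p * w (cmod (of_real s * cis a))) \<partial>lborel) \<partial>lborel)"
    by (rule nn_integral_polar) measurable
  also have "\<dots> = (\<integral>\<^sup>+s\<in>{0..<1}. ennreal (w s) * (ennreal s * (\<integral>\<^sup>+a\<in>{-pi..<pi}. ennreal (cmod (g (of_real s * cis a)) powr p) \<partial>lborel)) \<partial>lborel)"
  proof (intro nn_integral_cong)
    fix s :: real
    show "ennreal s * (\<integral>\<^sup>+a\<in>{-pi..<pi}. ennreal (cmod (?g (of_real s * cis a)) powr p * w (cmod (of_real s * cis a))) \<partial>lborel) * indicator {0..<1} s =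
      ennreal (w s) * (ennreal s * (\<integral>\<^sup>+a\<in>{-pi..<pi}. ennreal (cmod (g (of_real s * cis a)) powr p) \<partial>lborel)) * indicator {0..<1} s"
    proof (cases "s \<in> {0..<1}")
      case True
      have "(\<integral>\<^sup>+a\<in>{-pi..<pi}. ennreal (cmod (?g (of_real s * cis a)) powr p * w (cmod (of_real s * cis a))) \<partial>lborel)
        = (\<integral>\<^sup>+a. ennreal (w s) * (ennreal (cmod (?g (of_real s * cis a)) powr p) * indicator {-pi..<pi} a) \<partial>lborel)"
        using True by (intro nn_integral_cong) (simp add: norm_mult ennreal_mult mult_ac)
      also have "\<dots> = ennreal (w s) * (\<integral>\<^sup>+a\<in>{-pi..<pi}. ennreal (cmod (?g (of_real s * cis a)) powr p) \<partial>lborel)"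
        by (rule nn_integral_cmult) measurable
      also have "\<dots> = ennreal (w s) * (\<integral>\<^sup>+a\<in>{-pi..<pi}. ennreal (cmod (g (of_real s * cis a)) powr p) \<partial>lborel)"
        using True by (simp add: norm_mult)
      finally show ?thesis by (simp add: mult_ac)
    qed simp
  qed
  finally show ?thesis .
qed

lemma bergman_integral_lborel:
  assumes g: "g holomorphic_on ball 0 1"
  shows "(\<integral>\<^sup>+z\<in>ball 0 1. ennreal (cmod (g z) powr p * w (cmod z)) \<partial>area_measure) =
    ennreal (1 / pi) * (\<integral>\<^sup>+z\<in>ball 0 1. ennreal (cmod (g z) powr p * w (cmod z)) \<partial>lborel)"
proof -
  let ?g = "\<lambda>z. indicator (ball 0 1) z *\<^sub>R g z"
  have [measurable]: "?g \<in> borel_measurable borel" by (rule holomorphic_disc_measurable[OF g])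
  have [measurable]: "ball (0::complex) 1 \<in> sets borel" by simp
  have eq: "ennreal (cmod (g z) powr p * w (cmod z)) * indicator (ball 0 1) z =
     ennreal (cmod (?g z) powr p * w (cmod z)) * indicator (ball 0 1) z" for z
    by (simp add: indicator_def)
  have "(\<lambda>z. ennreal (cmod (?g z) powr p * w (cmod z)) * indicator (ball 0 1) z) \<in> borel_measurable lborel"
    by measurable
  then have "(\<lambda>z. ennreal (cmod (?g z) powr p * w (cmod z)) * indicator (ball 0 1) z) \<in> borel_measurable lebesgue"
    by (rule measurable_completion)
  then show ?thesis
    unfolding area_measure_def eq by (simp add: nn_integral_scale_measure nn_integral_completion)
qed

text \<open>The inequality of Fejer and Riesz on every circle, integrated against the weight: the integral of \<open>w\<close> over the circles that
  enclose \<open>y\<close> is the tail of \<open>w\<close> at \<open>y\<close>, and the factor \<open>s\<close> of polar coordinates is the one from rescaling the radius \<open>[0, s]\<close>.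
  This is the embedding of the Bergman space into the space on the radius.\<close>

theorem radial_embedding:
  assumes g: "g holomorphic_on ball 0 1" and p: "1 < p" "1 < q" "1 / p + 1 / q = 1"
  shows "(\<integral>\<^sup>+y\<in>{0..<1}. ennreal (cmod (g (of_real y)) powr p * weight_hat w y) \<partial>lborel) \<le>
    ennreal ((p + q) powr p) * (\<integral>\<^sup>+z\<in>ball 0 1. ennreal (cmod (g z) powr p * w (cmod z)) \<partial>lborel)"
proof -
  define h where "h y = ennreal (cmod (indicator {0..<1} y *\<^sub>R g (of_real y)) powr p) * indicator {0..<1} y" for y :: real
  have "(\<lambda>y::real. indicator {0..<1} y *\<^sub>R g (of_real y)) \<in> borel_measurable borel"
  proof (rule borel_measurable_continuous_on_indicator)
    show "continuous_on {0..<1} (\<lambda>y::real. g (of_real y))"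
      by (rule continuous_on_compose2[OF holomorphic_on_imp_continuous_on[OF g]]) (auto intro!: continuous_intros)
  qed simp
  then have h [measurable]: "h \<in> borel_measurable borel" unfolding h_def[abs_def] by measurable
  let ?A = "\<lambda>s. \<integral>\<^sup>+a\<in>{-pi..<pi}. ennreal (cmod (g (of_real s * cis a)) powr p) \<partial>lborel"
  have circle: "(\<integral>\<^sup>+y\<in>{0..r}. h y \<partial>lborel) \<le> ennreal ((p + q) powr p) * (ennreal r * ?A r)"
    if r: "0 \<le> r" "r < 1" for r
  proof (cases "r = 0")
    case True
    have "AE y in lborel. h y * indicator {0..r} y = 0"
      using AE_lborel_singleton[of 0] by eventually_elim (use True in auto)
    then have "(\<integral>\<^sup>+y\<in>{0..r}. h y \<partial>lborel) = 0" by (subst nn_integral_0_iff_AE) auto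
    then show ?thesis by simp
  next
    case False
    then have r0: "0 < r" using r by simp
    have G: "(\<lambda>z. g (of_real r * z)) holomorphic_on ball 0 (1 / r)"
    proof -
      have "(g \<circ> (\<lambda>z. of_real r * z)) holomorphic_on ball 0 (1 / r)"
      proof (rule holomorphic_on_compose_gen[OF _ g])
        show "(\<lambda>z. complex_of_real r * z) ` ball 0 (1 / r) \<subseteq> ball 0 1"
          using r0 by (auto simp: dist_norm norm_mult field_simps)
      qed (intro holomorphic_intros)
      then show ?thesis by (simp add: o_def)
    qed
    have "(\<integral>\<^sup>+y\<in>{0..r}. h y \<partial>lborel) = ennreal r * (\<integral>\<^sup>+x. h (0 + r * x) * indicator {0..r} (0 + r * x) \<partial>lborel)"
      using nn_integral_real_affine[of "\<lambda>y. h y * indicator {0..r} y" r 0] r0 by simp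
    also have "(\<integral>\<^sup>+x. h (0 + r * x) * indicator {0..r} (0 + r * x) \<partial>lborel) =
        (\<integral>\<^sup>+x\<in>{0..<1}. ennreal (cmod (g (of_real r * of_real x)) powr p) \<partial>lborel)"
    proof (intro nn_integral_cong_AE)
      show "AE x in lborel. h (0 + r * x) * indicator {0..r} (0 + r * x) =
        ennreal (cmod (g (of_real r * of_real x)) powr p) * indicator {0..<1} x"
        using AE_lborel_singleton[of 1]
      proof eventually_elim
        case (elim x)
        have "r * x \<le> r \<longleftrightarrow> x \<le> 1" "0 \<le> r * x \<longleftrightarrow> 0 \<le> x"
          using mult_le_cancel_left_pos[OF r0, of x 1] mult_le_cancel_left_pos[OF r0, of 0 x] by auto
        moreover have "r * x < 1" if "x \<le> 1" using mult_left_mono[OF that, of r] r by simp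
        ultimately show ?case using elim by (auto simp: h_def indicator_def)
      qed
    qed
    also have "\<dots> \<le> ennreal ((p + q) powr p) * ?A r"
      by (rule Fejer_Riesz_circle[OF G _ p]) (use r r0 in auto)
    finally show ?thesis by (simp add: mult_left_mono mult.left_commute)
  qed
  have "(\<integral>\<^sup>+y\<in>{0..<1}. ennreal (cmod (g (of_real y)) powr p * weight_hat w y) \<partial>lborel) =
      (\<integral>\<^sup>+y. h y * ennreal (weight_hat w y) \<partial>lborel)"
    by (intro nn_integral_cong) (auto simp: h_def indicator_def ennreal_mult)
  also have "\<dots> = (\<integral>\<^sup>+s. ennreal (w s) * (\<integral>\<^sup>+y. h y * indicator {y. y \<le> s} y \<partial>lborel) \<partial>lborel)"
    unfolding hat_nn by (rule nn_integral_triangle_swap) measurable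
  also have "\<dots> = (\<integral>\<^sup>+s. ennreal (w s) * (\<integral>\<^sup>+y\<in>{0..s}. h y \<partial>lborel) \<partial>lborel)"
  proof -
    have "h y * indicator {y. y \<le> s} y = h y * indicator {0..s} y" for y s
      by (auto simp: h_def indicator_def)
    then show ?thesis by simp
  qed
  also have "\<dots> \<le> (\<integral>\<^sup>+s. ennreal ((p + q) powr p) * (ennreal (w s) * (ennreal s * ?A s) * indicator {0..<1} s) \<partial>lborel)"
  proof (intro nn_integral_mono)
    fix s :: real
    show "ennreal (w s) * (\<integral>\<^sup>+y\<in>{0..s}. h y \<partial>lborel) \<le>
      ennreal ((p + q) powr p) * (ennreal (w s) * (ennreal s * ?A s) * indicator {0..<1} s)"
    proof (cases "s \<in> {0..<1}")
      case True
      then have "ennreal (w s) * (\<integral>\<^sup>+y\<in>{0..s}. h y \<partial>lborel) \<le> ennreal (w s) * (ennreal ((p + q) powr p) * (ennreal s * ?A s))"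
        by (intro mult_left_mono circle) auto
      then show ?thesis using True by (simp add: mult_ac)
    qed (simp add: support)
  qed
  also have "\<dots> = ennreal ((p + q) powr p) * (\<integral>\<^sup>+s\<in>{0..<1}. ennreal (w s) * (ennreal s * ?A s) \<partial>lborel)"
  proof (rule nn_integral_cmult)
    let ?g = "\<lambda>z. indicator (ball 0 1) z *\<^sub>R g z"
    have [measurable]: "?g \<in> borel_measurable borel" by (rule holomorphic_disc_measurable[OF g])
    have [measurable]: "cis \<in> borel_measurable borel"
      by (intro borel_measurable_continuous_onI continuous_intros)
    have "(\<lambda>s. ennreal (w s) * (ennreal s * (\<integral>\<^sup>+a\<in>{-pi..<pi}. ennreal (cmod (?g (of_real s * cis a)) powr p) \<partial>lborel)) * indicator {0..<1} s)
      \<in> borel_measurable lborel" by measurable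
    also have "(\<lambda>s. ennreal (w s) * (ennreal s * (\<integral>\<^sup>+a\<in>{-pi..<pi}. ennreal (cmod (?g (of_real s * cis a)) powr p) \<partial>lborel)) * indicator {0..<1} s)
      = (\<lambda>s. ennreal (w s) * (ennreal s * ?A s) * indicator {0..<1} s)"
      by (rule ext) (auto simp: indicator_def norm_mult)
    finally show "(\<lambda>s. ennreal (w s) * (ennreal s * ?A s) * indicator {0..<1} s) \<in> borel_measurable lborel" .
  qed
  also have "(\<integral>\<^sup>+s\<in>{0..<1}. ennreal (w s) * (ennreal s * ?A s) \<partial>lborel) =
     (\<integral>\<^sup>+z\<in>ball 0 1. ennreal (cmod (g z) powr p * w (cmod z)) \<partial>lborel)"
    by (rule nn_integral_disc_polar[OF g, symmetric])
  finally show ?thesis .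
qed

end

section \<open>The condition is sufficient\<close>

locale weight_pair = doubling_weight w C + nu: borel_weight n for w n :: "real \<Rightarrow> real" and C :: real +
  fixes p q :: real
  assumes pq: "1 < p" "1 < q" "1 / p + 1 / q = 1"
begin

abbreviation Lp_integral :: "(real \<Rightarrow> complex) \<Rightarrow> ennreal" where
  "Lp_integral f \<equiv> \<integral>\<^sup>+t\<in>{0..<1}. ennreal (cmod (f t) powr p * weight_hat n t) \<partial>lborel"

abbreviation disc_integral :: "(complex \<Rightarrow> complex) \<Rightarrow> ennreal" where
  "disc_integral f \<equiv> \<integral>\<^sup>+z\<in>ball 0 1. ennreal (cmod (f z) powr p * n (cmod z)) \<partial>lborel"

definition muck_left :: "real \<Rightarrow> ennreal" where
  "muck_left r = (\<integral>\<^sup>+t\<in>{0..r}. ennreal (weight_hat n t / weight_hat w t powr p) \<partial>lborel)"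

definition muck_weight :: "real \<Rightarrow> real" where
  "muck_weight t = w t / weight_hat n t powr (1 / p)"

definition muck_right :: "real \<Rightarrow> ennreal" where
  "muck_right r = (\<integral>\<^sup>+t\<in>{r..<1}. ennreal (muck_weight t powr q) \<partial>lborel)"

lemma muck_weight_measurable [measurable]: "muck_weight \<in> borel_measurable borel"
  unfolding muck_weight_def[abs_def] by measurable

lemma muck_weight_nonneg [simp]: "0 \<le> muck_weight t"
  unfolding muck_weight_def by simp

lemma muckenhoupt_sup_eq:
  "muckenhoupt_sup p q w n = (SUP r\<in>{0<..<1}. ennreal_powr (1 + muck_left r) (1 / p) * ennreal_powr (muck_right r) (1 / q))"
  unfolding muckenhoupt_sup_def muck_left_def muck_right_def muck_weight_def nn_integral_completion ..

lemma muckenhoupt_bound: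
  assumes "muckenhoupt_sup p q w n < \<infinity>"
  obtains M where "0 \<le> M" "\<And>r. \<lbrakk>0 < r; r < 1\<rbrakk> \<Longrightarrow> (1 + muck_left r) * ennreal_powr (muck_right r) (p / q) \<le> ennreal M"
proof -
  obtain m where m: "muckenhoupt_sup p q w n = ennreal m" "0 \<le> m"
    using assms by (cases "muckenhoupt_sup p q w n") auto
  show ?thesis
  proof (rule that[of "m powr p"])
    fix r :: real assume r: "0 < r" "r < 1"
    have "ennreal_powr (1 + muck_left r) (1 / p) * ennreal_powr (muck_right r) (1 / q) \<le> ennreal m"
      unfolding m(1)[symmetric] muckenhoupt_sup_eq using r by (intro SUP_upper) auto
    then have "ennreal_powr (ennreal_powr (1 + muck_left r) (1 / p) * ennreal_powr (muck_right r) (1 / q)) p \<le> ennreal_powr (ennreal m) p"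
      using pq by (intro ennreal_powr_mono) auto
    then show "(1 + muck_left r) * ennreal_powr (muck_right r) (p / q) \<le> ennreal (m powr p)"
      using pq m by (simp add: ennreal_powr_mult ennreal_powr_powr)
  qed simp
qed

text \<open>Hoelder's inequality with the splitting \<open>g * w = (g * weight_hat n powr (1/p)) * muck_weight\<close>.\<close>

lemma local_Holder:
  fixes g :: "real \<Rightarrow> real"
  assumes [measurable]: "g \<in> borel_measurable borel" and g0: "\<And>t. 0 \<le> g t" and r: "0 \<le> r" "s \<le> 1"
  shows "ennreal_powr (\<integral>\<^sup>+t\<in>{r..<s}. ennreal (g t * w t) \<partial>lborel) p \<le>
    ennreal_powr (muck_right r) (p / q) * (\<integral>\<^sup>+t\<in>{r..<s}. ennreal (g t powr p * weight_hat n t) \<partial>lborel)"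
proof -
  let ?f = "\<lambda>t. ennreal (g t * weight_hat n t powr (1 / p)) * indicator {r..<s} t"
  let ?v = "\<lambda>t. ennreal (muck_weight t) * indicator {r..<s} t"
  have "(\<integral>\<^sup>+t\<in>{r..<s}. ennreal (g t * w t) \<partial>lborel) = (\<integral>\<^sup>+t. ?f t * ?v t \<partial>lborel)"
  proof (intro nn_integral_cong)
    fix t
    show "ennreal (g t * w t) * indicator {r..<s} t = ?f t * ?v t"
    proof (cases "t \<in> {r..<s}")
      case True
      then have "0 < weight_hat n t" using r by (intro nu.hat_pos) auto
      then have "g t * w t = (g t * weight_hat n t powr (1 / p)) * muck_weight t"
        by (simp add: muck_weight_def)
      then have "ennreal (g t * w t) = ennreal (g t * weight_hat n t powr (1 / p)) * ennreal (muck_weight t)"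
        by (simp only: ennreal_mult''[OF muck_weight_nonneg])
      then show ?thesis using True by simp
    qed simp
  qed
  also have "\<dots> \<le> ennreal_powr (\<integral>\<^sup>+t. ennreal_powr (?f t) p \<partial>lborel) (1 / p) *
      ennreal_powr (\<integral>\<^sup>+t. ennreal_powr (?v t) q \<partial>lborel) (1 / q)"
    by (intro Holder_nn_integral pq) measurable
  also have "(\<integral>\<^sup>+t. ennreal_powr (?f t) p \<partial>lborel) = (\<integral>\<^sup>+t\<in>{r..<s}. ennreal (g t powr p * weight_hat n t) \<partial>lborel)"
    using pq g0 by (intro nn_integral_cong) (simp add: indicator_def powr_mult powr_powr)
  also have "ennreal_powr (\<integral>\<^sup>+t. ennreal_powr (?v t) q \<partial>lborel) (1 / q) \<le> ennreal_powr (muck_right r) (1 / q)"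
    unfolding muck_right_def using pq r
    by (intro ennreal_powr_mono nn_integral_mono) (auto simp: indicator_def)
  finally have "(\<integral>\<^sup>+t\<in>{r..<s}. ennreal (g t * w t) \<partial>lborel) \<le>
     ennreal_powr (\<integral>\<^sup>+t\<in>{r..<s}. ennreal (g t powr p * weight_hat n t) \<partial>lborel) (1 / p) * ennreal_powr (muck_right r) (1 / q)"
    by (simp add: mult_left_mono)
  then have "ennreal_powr (\<integral>\<^sup>+t\<in>{r..<s}. ennreal (g t * w t) \<partial>lborel) p \<le> ennreal_powr
     (ennreal_powr (\<integral>\<^sup>+t\<in>{r..<s}. ennreal (g t powr p * weight_hat n t) \<partial>lborel) (1 / p) * ennreal_powr (muck_right r) (1 / q)) p"
    using pq by (intro ennreal_powr_mono) auto
  then show ?thesis using pq by (simp add: ennreal_powr_mult ennreal_powr_powr mult.commute)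
qed

text \<open>The condition is imposed for \<open>r > 0\<close> only, whence the passage to the limit \<open>r \<rightarrow> 0\<close>. The summand \<open>1\<close> in the condition is what
  gives control of the whole mass.\<close>

lemma total_mass_bound:
  fixes g :: "real \<Rightarrow> real"
  assumes [measurable]: "g \<in> borel_measurable borel" and g0: "\<And>t. 0 \<le> g t"
    and M: "\<And>r. \<lbrakk>0 < r; r < 1\<rbrakk> \<Longrightarrow> (1 + muck_left r) * ennreal_powr (muck_right r) (p / q) \<le> ennreal M"
  shows "ennreal_powr (\<integral>\<^sup>+t\<in>{0..<1}. ennreal (g t * w t) \<partial>lborel) p \<le>
    ennreal M * (\<integral>\<^sup>+t\<in>{0..<1}. ennreal (g t powr p * weight_hat n t) \<partial>lborel)"
proof -
  let ?\<Psi> = "\<integral>\<^sup>+t\<in>{0..<1}. ennreal (g t powr p * weight_hat n t) \<partial>lborel"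
  have piece: "(\<integral>\<^sup>+t\<in>{r..<1}. ennreal (g t * w t) \<partial>lborel) \<le> ennreal_powr (ennreal M * ?\<Psi>) (1 / p)"
    if r: "0 < r" "r < 1" for r
  proof -
    have "ennreal_powr (\<integral>\<^sup>+t\<in>{r..<1}. ennreal (g t * w t) \<partial>lborel) p \<le>
      ennreal_powr (muck_right r) (p / q) * (\<integral>\<^sup>+t\<in>{r..<1}. ennreal (g t powr p * weight_hat n t) \<partial>lborel)"
      using r g0 by (intro local_Holder) auto
    also have "\<dots> \<le> ennreal M * ?\<Psi>"
    proof (rule mult_mono)
      have "1 * ennreal_powr (muck_right r) (p / q) \<le> (1 + muck_left r) * ennreal_powr (muck_right r) (p / q)"
        by (intro mult_right_mono) auto
      then show "ennreal_powr (muck_right r) (p / q) \<le> ennreal M" using M[OF r] by simp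
      show "(\<integral>\<^sup>+t\<in>{r..<1}. ennreal (g t powr p * weight_hat n t) \<partial>lborel) \<le> ?\<Psi>"
        using r by (intro nn_integral_mono) (auto simp: indicator_def)
    qed auto
    finally have "ennreal_powr (ennreal_powr (\<integral>\<^sup>+t\<in>{r..<1}. ennreal (g t * w t) \<partial>lborel) p) (1 / p) \<le> ennreal_powr (ennreal M * ?\<Psi>) (1 / p)"
      using pq by (intro ennreal_powr_mono) auto
    then show ?thesis using pq by (simp add: ennreal_powr_powr)
  qed
  have "(\<integral>\<^sup>+t\<in>{0..<1}. ennreal (g t * w t) \<partial>lborel) = (\<integral>\<^sup>+t\<in>{0<..<1}. ennreal (g t * w t) \<partial>lborel)"
  proof (intro nn_integral_cong_AE)
    show "AE t in lborel. ennreal (g t * w t) * indicator {0..<1} t = ennreal (g t * w t) * indicator {0<..<1} t"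
      using AE_lborel_singleton[of 0] by eventually_elim (auto simp: indicator_def)
  qed
  also have "\<dots> = (\<integral>\<^sup>+t. (SUP k::nat. ennreal (g t * w t) * indicator {1 / (real k + 2)..<1} t) \<partial>lborel)"
  proof (intro nn_integral_cong)
    fix t :: real
    show "ennreal (g t * w t) * indicator {0<..<1} t = (SUP k::nat. ennreal (g t * w t) * indicator {1 / (real k + 2)..<1} t)"
    proof (cases "0 < t \<and> t < 1")
      case True
      obtain k :: nat where "1 / t \<le> real k" using real_arch_simple by blast
      then have "1 / (real k + 2) \<le> t" using True by (simp add: field_simps)
      then have "ennreal (g t * w t) * indicator {0<..<1} t \<le> ennreal (g t * w t) * indicator {1 / (real k + 2)..<1} t"
        using True by simp
      then have "ennreal (g t * w t) * indicator {0<..<1} t \<le> (SUP k::nat. ennreal (g t * w t) * indicator {1 / (real k + 2)..<1} t)"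
        by (rule SUP_upper2[OF UNIV_I])
      moreover have "(SUP k::nat. ennreal (g t * w t) * indicator {1 / (real k + 2)..<1} t) \<le> ennreal (g t * w t) * indicator {0<..<1} t"
        using True by (intro SUP_least) (auto simp: indicator_def)
      ultimately show ?thesis by (rule antisym)
    next
      case False
      have "t \<notin> {1 / (real k + 2)..<1}" for k :: nat
      proof
        assume t: "t \<in> {1 / (real k + 2)..<1}"
        have "0 < 1 / (real k + 2)" by simp
        also have "\<dots> \<le> t" using t by simp
        finally show False using False t by simp
      qed
      then show ?thesis using False by simp
    qed
  qed
  also have "\<dots> = (SUP k::nat. \<integral>\<^sup>+t. ennreal (g t * w t) * indicator {1 / (real k + 2)..<1} t \<partial>lborel)"
  proof (rule nn_integral_monotone_convergence_SUP)
    show "incseq (\<lambda>k t. ennreal (g t * w t) * indicator {1 / (real k + 2)..<1} t)"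
    proof (intro incseq_SucI le_funI)
      fix k :: nat and t :: real
      have "1 / (real (Suc k) + 2) \<le> 1 / (real k + 2)" by (simp add: field_simps)
      then show "ennreal (g t * w t) * indicator {1 / (real k + 2)..<1} t \<le> ennreal (g t * w t) * indicator {1 / (real (Suc k) + 2)..<1} t"
        by (auto simp: indicator_def)
    qed
  qed measurable
  also have "\<dots> \<le> ennreal_powr (ennreal M * ?\<Psi>) (1 / p)"
    by (intro SUP_least piece) (auto simp: field_simps)
  finally have "ennreal_powr (\<integral>\<^sup>+t\<in>{0..<1}. ennreal (g t * w t) \<partial>lborel) p \<le> ennreal_powr (ennreal_powr (ennreal M * ?\<Psi>) (1 / p)) p"
    using pq by (intro ennreal_powr_mono) auto
  then show ?thesis using pq by (simp add: ennreal_powr_powr)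
qed

lemma set_integrable_finite_mass:
  fixes g :: "real \<Rightarrow> real"
  assumes [measurable]: "g \<in> borel_measurable borel" and g0: "\<And>t. 0 \<le> g t"
    and fin: "(\<integral>\<^sup>+t\<in>{0..<1}. ennreal (g t * w t) \<partial>lborel) < \<infinity>"
    and "A \<in> sets borel"
  shows "set_integrable lborel A (\<lambda>t. g t * w t)"
proof -
  have "integrable lborel (\<lambda>t. g t * w t)"
  proof (rule integrableI_nonneg)
    have "(\<integral>\<^sup>+t. ennreal (g t * w t) \<partial>lborel) = (\<integral>\<^sup>+t\<in>{0..<1}. ennreal (g t * w t) \<partial>lborel)"
      by (intro nn_integral_cong) (auto simp: support split: split_indicator)
    then show "(\<integral>\<^sup>+t. ennreal (g t * w t) \<partial>lborel) < \<infinity>" using fin by simp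
  qed (use g0 in auto)
  then show ?thesis unfolding set_integrable_def using \<open>A \<in> sets borel\<close> by (intro integrable_mult_indicator) auto
qed

lemma nn_integral_eq_closed:
  fixes g :: "real \<Rightarrow> real"
  assumes [measurable]: "g \<in> borel_measurable borel" and g0: "\<And>t. 0 \<le> g t"
    and fin: "(\<integral>\<^sup>+t\<in>{0..<1}. ennreal (g t * w t) \<partial>lborel) < \<infinity>"
  shows "ennreal (LINT t:{r..s}|lborel. g t * w t) = (\<integral>\<^sup>+t\<in>{r..<s}. ennreal (g t * w t) \<partial>lborel)"
proof -
  have "ennreal (LINT t:{r..s}|lborel. g t * w t) = (\<integral>\<^sup>+t. ennreal (indicator {r..s} t *\<^sub>R (g t * w t)) \<partial>lborel)"
    using set_integrable_finite_mass[OF assms, of "{r..s}"] g0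
    unfolding set_lebesgue_integral_def set_integrable_def
    by (intro nn_integral_eq_integral[symmetric]) auto
  also have "\<dots> = (\<integral>\<^sup>+t\<in>{r..<s}. ennreal (g t * w t) \<partial>lborel)"
  proof (intro nn_integral_cong_AE)
    show "AE t in lborel. ennreal (indicator {r..s} t *\<^sub>R (g t * w t)) = ennreal (g t * w t) * indicator {r..<s} t"
      using AE_lborel_singleton[of s] by eventually_elim (auto simp: indicator_def)
  qed
  finally show ?thesis .
qed

text \<open>Muckenhoupt's condition and Hoelder's inequality on \<open>[r, s)\<close> give the two-interval condition.\<close>

lemma weighted_Hardy:
  fixes g :: "real \<Rightarrow> real"
  assumes [measurable]: "g \<in> borel_measurable borel" and g0: "\<And>t. 0 \<le> g t"
    and M: "\<And>r. \<lbrakk>0 < r; r < 1\<rbrakk> \<Longrightarrow> (1 + muck_left r) * ennreal_powr (muck_right r) (p / q) \<le> ennreal M"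
    and fin: "(\<integral>\<^sup>+t\<in>{0..<1}. ennreal (g t * w t) \<partial>lborel) < \<infinity>"
  shows "(\<integral>\<^sup>+y\<in>{0..<1}. ennreal (weight_hat n y / weight_hat w y powr p) *
      ennreal_powr (\<integral>\<^sup>+t\<in>{y..<1}. ennreal (g t * w t) \<partial>lborel) p \<partial>lborel) \<le>
    ennreal (4 powr p) * ennreal M * (\<integral>\<^sup>+t\<in>{0..<1}. ennreal (g t powr p * weight_hat n t) \<partial>lborel)"
proof -
  note closed = nn_integral_eq_closed[OF assms(1) g0 fin]
  have nn: "0 \<le> (LINT t:{r..s}|lborel. g t * w t)" for r s
    unfolding set_lebesgue_integral_def using g0 by (intro integral_nonneg_AE) auto
  have powr: "ennreal_powr (\<integral>\<^sup>+t\<in>{r..<s}. ennreal (g t * w t) \<partial>lborel) p = ennreal ((LINT t:{r..s}|lborel. g t * w t) powr p)" for r s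
    using closed[of r s] nn[of r s] by (metis ennreal_powr_ennreal)
  show ?thesis
    unfolding powr
  proof (rule Hardy_inequality_of_two_interval_condition)
    show "set_integrable lborel {0..1} (\<lambda>t. g t * w t)"
      using set_integrable_finite_mass[OF assms(1) g0 fin] by simp
    fix r s :: real assume rs: "0 < r" "r < s" "s < 1"
    have "(\<integral>\<^sup>+x\<in>{0..r}. ennreal (weight_hat n x / weight_hat w x powr p) \<partial>lborel) * ennreal ((LINT t:{r..s}|lborel. g t * w t) powr p)
      \<le> (1 + muck_left r) * (ennreal_powr (muck_right r) (p / q) * (\<integral>\<^sup>+t\<in>{r..<s}. ennreal (g t powr p * weight_hat n t) \<partial>lborel))"
      unfolding powr[symmetric] muck_left_def[symmetric]
      using rs g0 by (intro mult_mono local_Holder) auto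
    also have "\<dots> = (1 + muck_left r) * ennreal_powr (muck_right r) (p / q) * (\<integral>\<^sup>+t\<in>{r..<s}. ennreal (g t powr p * weight_hat n t) \<partial>lborel)"
      by (simp add: mult.assoc)
    also have "\<dots> \<le> ennreal M * (\<integral>\<^sup>+t\<in>{r..<s}. ennreal (g t powr p * weight_hat n t) \<partial>lborel)"
      using rs by (intro mult_right_mono M) auto
    finally show "(\<integral>\<^sup>+x\<in>{0..r}. ennreal (weight_hat n x / weight_hat w x powr p) \<partial>lborel) * ennreal ((LINT t:{r..s}|lborel. g t * w t) powr p)
      \<le> ennreal M * (\<integral>\<^sup>+t\<in>{r..<s}. ennreal (g t powr p * weight_hat n t) \<partial>lborel)" .
  qed (use g0 pq in auto)
qed

end

context weight_pair
begin

text \<open>Hilbert's inequality in the variable \<open>v = 1 - y\<close> on both halves of the circle.\<close>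

lemma circle_Hilbert_bound:
  fixes F :: "real \<Rightarrow> ennreal"
  assumes [measurable]: "F \<in> borel_measurable borel" and s: "0 \<le> s" "s < 1"
  shows "(\<integral>\<^sup>+\<theta>\<in>{-pi..<pi}. ennreal_powr (\<integral>\<^sup>+y\<in>{0..s}. ennreal (hilb \<theta> y) * F y \<partial>lborel) p \<partial>lborel) \<le>
    ennreal (2 * (p + q) powr p) * (\<integral>\<^sup>+y\<in>{0..s}. ennreal_powr (ennreal (1 / weight_hat w y) * F y) p \<partial>lborel)"
proof -
  define Q where "Q \<theta> = (\<integral>\<^sup>+y\<in>{0..s}. ennreal (hilb \<theta> y) * F y \<partial>lborel)" for \<theta>
  have [measurable]: "Q \<in> borel_measurable borel" unfolding Q_def[abs_def] by measurable
  define X where "X y = ennreal (1 / weight_hat w y) * F y * indicator {0..s} y" for y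
  have [measurable]: "X \<in> borel_measurable borel" unfolding X_def[abs_def] by measurable
  have even: "Q (- \<theta>) = Q \<theta>" for \<theta> unfolding Q_def hilb_def by simp
  have Q: "Q \<theta> = (\<integral>\<^sup>+v\<in>{0<..}. X (1 - v) * ennreal (1 / max \<theta> v) \<partial>lborel)" if "0 < \<theta>" for \<theta>
  proof -
    have "Q \<theta> = (\<integral>\<^sup>+y. X y * ennreal (1 / max \<theta> (1 - y)) * indicator {0<..} (1 - y) \<partial>lborel)"
      unfolding Q_def
    proof (intro nn_integral_cong)
      fix y
      show "ennreal (hilb \<theta> y) * F y * indicator {0..s} y = X y * ennreal (1 / max \<theta> (1 - y)) * indicator {0<..} (1 - y)"
      proof (cases "y \<in> {0..s}")
        case True
        have "hilb \<theta> y = 1 / weight_hat w y * (1 / max \<theta> (1 - y))"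
          using that by (simp add: hilb_def max.commute)
        also have "ennreal \<dots> = ennreal (1 / weight_hat w y) * ennreal (1 / max \<theta> (1 - y))"
          by (rule ennreal_mult') simp
        finally show ?thesis using True s by (simp add: X_def mult_ac)
      qed (simp add: X_def)
    qed
    also have "\<dots> = (\<integral>\<^sup>+v. X (1 - v) * ennreal (1 / max \<theta> v) * indicator {0<..} v \<partial>lborel)"
      using nn_integral_real_affine[of "\<lambda>y. X y * ennreal (1 / max \<theta> (1 - y)) * indicator {0<..} (1 - y)" "-1" 1] by simp
    finally show ?thesis .
  qed
  have neg: "(\<integral>\<^sup>+a. f (- a) \<partial>lborel) = (\<integral>\<^sup>+a. f a \<partial>lborel)"
    if "f \<in> borel_measurable borel" for f :: "real \<Rightarrow> ennreal"
    using nn_integral_real_affine[OF that, of "-1" 0] by simp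
  have "(\<integral>\<^sup>+\<theta>\<in>{-pi..<pi}. ennreal_powr (Q \<theta>) p \<partial>lborel) \<le>
    (\<integral>\<^sup>+\<theta>. ennreal_powr (Q \<theta>) p * indicator {0<..} \<theta> + ennreal_powr (Q (- \<theta>)) p * indicator {0<..} (- \<theta>) \<partial>lborel)"
  proof (intro nn_integral_mono_AE)
    show "AE \<theta> in lborel. ennreal_powr (Q \<theta>) p * indicator {-pi..<pi} \<theta> \<le>
        ennreal_powr (Q \<theta>) p * indicator {0<..} \<theta> + ennreal_powr (Q (- \<theta>)) p * indicator {0<..} (- \<theta>)"
      using AE_lborel_singleton[of 0] by eventually_elim (auto simp: indicator_def even)
  qed
  also have "\<dots> = (\<integral>\<^sup>+\<theta>\<in>{0<..}. ennreal_powr (Q \<theta>) p \<partial>lborel) + (\<integral>\<^sup>+\<theta>. ennreal_powr (Q (- \<theta>)) p * indicator {0<..} (- \<theta>) \<partial>lborel)"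
    by (rule nn_integral_add) measurable
  also have "(\<integral>\<^sup>+\<theta>. ennreal_powr (Q (- \<theta>)) p * indicator {0<..} (- \<theta>) \<partial>lborel) = (\<integral>\<^sup>+\<theta>\<in>{0<..}. ennreal_powr (Q \<theta>) p \<partial>lborel)"
    by (rule neg) measurable
  also have "(\<integral>\<^sup>+\<theta>\<in>{0<..}. ennreal_powr (Q \<theta>) p \<partial>lborel) =
      (\<integral>\<^sup>+\<theta>\<in>{0<..}. ennreal_powr (\<integral>\<^sup>+v\<in>{0<..}. X (1 - v) * ennreal (1 / max \<theta> v) \<partial>lborel) p \<partial>lborel)"
  proof (intro nn_integral_cong)
    fix \<theta> :: real
    show "ennreal_powr (Q \<theta>) p * indicator {0<..} \<theta> =
        ennreal_powr (\<integral>\<^sup>+v\<in>{0<..}. X (1 - v) * ennreal (1 / max \<theta> v) \<partial>lborel) p * indicator {0<..} \<theta>"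
      using Q[of \<theta>] by (cases "0 < \<theta>") auto
  qed
  also have "\<dots> + \<dots> \<le> ennreal ((p + q) powr p) * (\<integral>\<^sup>+v\<in>{0<..}. ennreal_powr (X (1 - v)) p \<partial>lborel) +
     ennreal ((p + q) powr p) * (\<integral>\<^sup>+v\<in>{0<..}. ennreal_powr (X (1 - v)) p \<partial>lborel)"
    by (intro add_mono Hilbert_max_kernel_bound pq) measurable
  also have "(\<integral>\<^sup>+v\<in>{0<..}. ennreal_powr (X (1 - v)) p \<partial>lborel) = (\<integral>\<^sup>+y. ennreal_powr (X y) p * indicator {0<..} (1 - y) \<partial>lborel)"
    using nn_integral_real_affine[of "\<lambda>y. ennreal_powr (X y) p * indicator {0<..} (1 - y)" "-1" 1] by simp
  also have "\<dots> = (\<integral>\<^sup>+y\<in>{0..s}. ennreal_powr (ennreal (1 / weight_hat w y) * F y) p \<partial>lborel)"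
    using s by (intro nn_integral_cong) (auto simp: X_def indicator_def)
  finally have "(\<integral>\<^sup>+\<theta>\<in>{-pi..<pi}. ennreal_powr (Q \<theta>) p \<partial>lborel) \<le>
    (ennreal ((p + q) powr p) + ennreal ((p + q) powr p)) * (\<integral>\<^sup>+y\<in>{0..s}. ennreal_powr (ennreal (1 / weight_hat w y) * F y) p \<partial>lborel)"
    by (simp only: distrib_right)
  moreover have "ennreal ((p + q) powr p) + ennreal ((p + q) powr p) = ennreal (2 * (p + q) powr p)"
    by (simp add: ennreal_plus[symmetric] del: ennreal_plus)
  ultimately show ?thesis unfolding Q_def by (simp only:)
qed

lemma borel_modulus:
  fixes f :: "real \<Rightarrow> complex"
  assumes f: "f \<in> borel_measurable (lebesgue_on {0..<1})"
  obtains g :: "real \<Rightarrow> real" where "g \<in> borel_measurable borel" "\<And>t. 0 \<le> g t"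
    "AE t in lebesgue. t \<in> {0..<1} \<longrightarrow> cmod (f t) = g t"
    "(\<lambda>t. indicator {0..<1} t *\<^sub>R f t) \<in> borel_measurable lebesgue"
proof -
  have m: "(\<lambda>t. indicator {0..<1} t *\<^sub>R f t) \<in> borel_measurable lebesgue"
    using f by (subst borel_measurable_restrict_space_iff[symmetric]) auto
  from measurable_compose[OF m borel_measurable_norm]
  have "(\<lambda>t. cmod (indicator {0..<1} t *\<^sub>R f t)) \<in> borel_measurable lebesgue" .
  then obtain g1 where g1: "g1 \<in> borel_measurable lborel" "AE t in lborel. cmod (indicator {0..<1} t *\<^sub>R f t) = g1 t"
    using completion_ex_borel_measurable_real by blast
  show ?thesis
  proof (rule that[of "\<lambda>t. max 0 (g1 t)"])
    show "(\<lambda>t. max 0 (g1 t)) \<in> borel_measurable borel" using g1(1) by simp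
    have "AE t in lborel. t \<in> {0..<1} \<longrightarrow> cmod (f t) = max 0 (g1 t)"
      using g1(2)
    proof eventually_elim
      case (elim t)
      show ?case
      proof
        assume "t \<in> {0..<1}"
        then have "cmod (f t) = g1 t" using elim by simp
        then show "cmod (f t) = max 0 (g1 t)" using norm_ge_zero[of "f t"] by simp
      qed
    qed
    then show "AE t in lebesgue. t \<in> {0..<1} \<longrightarrow> cmod (f t) = max 0 (g1 t)" by (rule AE_completion)
  qed (use m in auto)
qed

text \<open>On the circle of radius \<open>s\<close> the operator is dominated by a constant multiple of the mass of \<open>f * w\<close> plus a Hilbert-type transform of the
  tail of \<open>f * w\<close> divided by that of \<open>w\<close>, restricted to \<open>y \<le> s\<close>. Integration over the circles against \<open>n\<close> produces \<open>weight_hat n\<close>, and the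
  weighted Hardy inequality finishes the estimate.\<close>

theorem hilbert_op_upper_bound:
  assumes M: "0 \<le> M" "\<And>r. \<lbrakk>0 < r; r < 1\<rbrakk> \<Longrightarrow> (1 + muck_left r) * ennreal_powr (muck_right r) (p / q) \<le> ennreal M"
  obtains B where "0 \<le> B" "\<And>f :: real \<Rightarrow> complex. \<lbrakk>f \<in> borel_measurable (lebesgue_on {0..<1});
      Lp_integral f < \<infinity>\<rbrakk> \<Longrightarrow>
    hilbert_well_defined w f \<and> hilbert_op w f holomorphic_on ball 0 1 \<and>
    disc_integral (hilbert_op w f) \<le>
      ennreal B * Lp_integral f"
proof -
  obtain K where K: "0 < K" and op: "\<And>(f :: real \<Rightarrow> complex) \<Phi> s \<theta>. \<lbrakk>\<Phi> \<in> borel_measurable borel;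
      AE t in lebesgue. t \<in> {0..<1} \<longrightarrow> ennreal (cmod (f t) * w t) \<le> \<Phi> t;
      set_integrable lebesgue {0..<1} (\<lambda>t. f t * of_real (w t));
      0 \<le> s; s < 1; \<theta> \<noteq> 0; \<bar>\<theta>\<bar> \<le> pi\<rbrakk> \<Longrightarrow>
    ennreal (cmod (hilbert_op w f (of_real s * cis \<theta>))) \<le> ennreal K *
      ((\<integral>\<^sup>+t\<in>{0..<1}. \<Phi> t \<partial>lborel) +
       (\<integral>\<^sup>+y\<in>{0..s}. ennreal (hilb \<theta> y) * (\<integral>\<^sup>+t\<in>{y..<1}. \<Phi> t \<partial>lborel) \<partial>lborel))"
    by (rule norm_hilbert_op_le) blast
  define c where "c = K powr p * 2 powr p"
  \<comment> \<open>The two summands come from the mass of \<open>f * w\<close> and from the Hilbert-type transform of its tails.\<close>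
  define B where "B = c * (2 * pi * weight_hat n 0 * M + 2 * (p + q) powr p * (4 powr p * M))"
  have c: "0 \<le> c" unfolding c_def by simp
  show ?thesis
  proof (rule that[of B])
    show "0 \<le> B" unfolding B_def using c M pq by simp
    fix f :: "real \<Rightarrow> complex"
    assume f: "f \<in> borel_measurable (lebesgue_on {0..<1})"
      and fin: "Lp_integral f < \<infinity>"
    obtain g where g [measurable]: "g \<in> borel_measurable borel" and g0: "\<And>t. 0 \<le> g t"
      and fg: "AE t in lebesgue. t \<in> {0..<1} \<longrightarrow> cmod (f t) = g t"
      and fm: "(\<lambda>t. indicator {0..<1} t *\<^sub>R f t) \<in> borel_measurable lebesgue"
      by (rule borel_modulus[OF f]) blast
    let ?\<Psi> = "\<integral>\<^sup>+t\<in>{0..<1}. ennreal (g t powr p * weight_hat n t) \<partial>lborel"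
    let ?T = "\<integral>\<^sup>+t\<in>{0..<1}. ennreal (g t * w t) \<partial>lborel"
    let ?F = "\<lambda>y. \<integral>\<^sup>+t\<in>{y..<1}. ennreal (g t * w t) \<partial>lborel"
    have \<Psi>: "Lp_integral f = ?\<Psi>"
    proof (intro nn_integral_cong_AE)
      have "AE t in lborel. t \<in> {0..<1} \<longrightarrow> cmod (f t) = g t" using fg by (simp only: AE_completion_iff)
      then show "AE t in lborel. ennreal (cmod (f t) powr p * weight_hat n t) * indicator {0..<1} t =
          ennreal (g t powr p * weight_hat n t) * indicator {0..<1} t"
        by eventually_elim (auto simp: indicator_def)
    qed
    have T: "ennreal_powr ?T p \<le> ennreal M * ?\<Psi>" by (intro total_mass_bound g g0 M)
    have "ennreal M * ?\<Psi> < \<infinity>" using fin unfolding \<Psi> by (simp add: ennreal_mult_less_top)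
    from order_le_less_trans[OF T this] have Tfin: "?T < \<infinity>" by simp
    have int: "set_integrable lebesgue {0..<1} (\<lambda>t. f t * of_real (w t))"
      unfolding set_integrable_def integrable_iff_bounded
    proof
      have "(\<lambda>t. complex_of_real (w t)) \<in> borel_measurable lebesgue"
        by (rule measurable_completion) measurable
      from borel_measurable_times[OF fm this]
      show "(\<lambda>t. indicator {0..<1} t *\<^sub>R (f t * of_real (w t))) \<in> borel_measurable lebesgue" by simp
      have "(\<integral>\<^sup>+t. ennreal (norm (indicator {0..<1} t *\<^sub>R (f t * of_real (w t)))) \<partial>lebesgue) =
          (\<integral>\<^sup>+t\<in>{0..<1}. ennreal (g t * w t) \<partial>lebesgue)"
      proof (intro nn_integral_cong_AE)
        show "AE t in lebesgue. ennreal (norm (indicator {0..<1} t *\<^sub>R (f t * of_real (w t)))) = ennreal (g t * w t) * indicator {0..<1} t"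
          using fg
        proof eventually_elim
          case (elim t)
          then show ?case by (cases "t \<in> {0..<1}") (auto simp: norm_mult)
        qed
      qed
      then show "(\<integral>\<^sup>+t. ennreal (norm (indicator {0..<1} t *\<^sub>R (f t * of_real (w t)))) \<partial>lebesgue) < \<infinity>"
        using Tfin by (simp add: nn_integral_completion)
    qed
    have wd: "hilbert_well_defined w f"
      unfolding hilbert_well_defined_def using hilbert_integrand_integrable[OF int] by simp
    have hol: "hilbert_op w f holomorphic_on ball 0 1" by (rule hilbert_op_holomorphic[OF int])
    have [measurable]: "?F \<in> borel_measurable borel"
    proof -
      have "(\<lambda>y. \<integral>\<^sup>+t. ennreal (g t * w t) * indicator {..<1} t * indicator {y..} t \<partial>lborel) \<in> borel_measurable borel"
        by (rule borel_measurable_nn_integral_above[where h = "\<lambda>y. y" and f = "\<lambda>_. 0"]) measurable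
      moreover have "ennreal (g t * w t) * indicator {..<1} t * indicator {y..} t = ennreal (g t * w t) * indicator {y..<1} t" for t y
        by (auto simp: indicator_def)
      ultimately show ?thesis by simp
    qed
    let ?X = "\<lambda>y. ennreal_powr (ennreal (1 / weight_hat w y) * ?F y) p"
    have circle: "(\<integral>\<^sup>+a\<in>{-pi..<pi}. ennreal (cmod (hilbert_op w f (of_real s * cis a)) powr p) \<partial>lborel) \<le>
       ennreal c * (ennreal (2 * pi) * ennreal_powr ?T p + ennreal (2 * (p + q) powr p) * (\<integral>\<^sup>+y\<in>{0..s}. ?X y \<partial>lborel))"
      if s: "0 \<le> s" "s < 1" for s
    proof -
      let ?Q = "\<lambda>\<theta>. \<integral>\<^sup>+y\<in>{0..s}. ennreal (hilb \<theta> y) * ?F y \<partial>lborel"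
      have "(\<integral>\<^sup>+a\<in>{-pi..<pi}. ennreal (cmod (hilbert_op w f (of_real s * cis a)) powr p) \<partial>lborel) \<le>
        (\<integral>\<^sup>+a. ennreal c * (ennreal_powr ?T p * indicator {-pi..<pi} a + ennreal_powr (?Q a) p * indicator {-pi..<pi} a) \<partial>lborel)"
      proof (intro nn_integral_mono_AE)
        show "AE a in lborel. ennreal (cmod (hilbert_op w f (of_real s * cis a)) powr p) * indicator {-pi..<pi} a \<le>
          ennreal c * (ennreal_powr ?T p * indicator {-pi..<pi} a + ennreal_powr (?Q a) p * indicator {-pi..<pi} a)"
          using AE_lborel_singleton[of 0]
        proof eventually_elim
          case (elim a)
          show ?case
          proof (cases "a \<in> {-pi..<pi}")
            case True
            have "ennreal (cmod (hilbert_op w f (of_real s * cis a)) powr p) = ennreal_powr (ennreal (cmod (hilbert_op w f (of_real s * cis a)))) p"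
              by simp
            also have "\<dots> \<le> ennreal_powr (ennreal K * (?T + ?Q a)) p"
            proof (intro ennreal_powr_mono op)
              show "AE t in lebesgue. t \<in> {0..<1} \<longrightarrow> ennreal (cmod (f t) * w t) \<le> ennreal (g t * w t)"
                using fg by eventually_elim auto
            qed (use s elim True int pq in auto)
            also have "\<dots> = ennreal (K powr p) * ennreal_powr (?T + ?Q a) p"
              using K by (simp add: ennreal_powr_mult)
            also have "\<dots> \<le> ennreal (K powr p) * (ennreal (2 powr p) * (ennreal_powr ?T p + ennreal_powr (?Q a) p))"
              using pq by (intro mult_left_mono ennreal_powr_add_le) auto
            also have "\<dots> = ennreal c * (ennreal_powr ?T p + ennreal_powr (?Q a) p)"
              by (simp add: c_def ennreal_mult mult.assoc)
            finally show ?thesis using True by simp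
          qed simp
        qed
      qed
      also have "\<dots> = ennreal c * (ennreal_powr ?T p * ennreal (2 * pi) + (\<integral>\<^sup>+a\<in>{-pi..<pi}. ennreal_powr (?Q a) p \<partial>lborel))"
        by (subst nn_integral_cmult) (auto simp: nn_integral_add nn_integral_cmult_indicator)
      also have "\<dots> \<le> ennreal c * (ennreal_powr ?T p * ennreal (2 * pi) + ennreal (2 * (p + q) powr p) * (\<integral>\<^sup>+y\<in>{0..s}. ?X y \<partial>lborel))"
        using s by (intro mult_left_mono add_left_mono circle_Hilbert_bound) auto
      finally show ?thesis by (simp add: mult.commute)
    qed
    let ?Y = "\<lambda>y. ?X y * indicator {0..} y"
    let ?A = "\<lambda>s. \<integral>\<^sup>+y. ?Y y * indicator {y. y \<le> s} y \<partial>lborel"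
    have [measurable]: "?A \<in> borel_measurable borel"
      by (rule borel_measurable_nn_integral_below) measurable
    let ?c2 = "ennreal (2 * (p + q) powr p)"
    have "disc_integral (hilbert_op w f) =
      (\<integral>\<^sup>+s\<in>{0..<1}. ennreal (n s) * (ennreal s * (\<integral>\<^sup>+a\<in>{-pi..<pi}. ennreal (cmod (hilbert_op w f (of_real s * cis a)) powr p) \<partial>lborel)) \<partial>lborel)"
      by (rule nu.nn_integral_disc_polar[OF hol])
    also have "\<dots> \<le> (\<integral>\<^sup>+s. ennreal c * (ennreal (2 * pi) * ennreal_powr ?T p * ennreal (n s) + ?c2 * (ennreal (n s) * ?A s)) \<partial>lborel)"
    proof (intro nn_integral_mono)
      fix s :: real
      let ?L = "\<integral>\<^sup>+a\<in>{-pi..<pi}. ennreal (cmod (hilbert_op w f (of_real s * cis a)) powr p) \<partial>lborel"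
      show "ennreal (n s) * (ennreal s * ?L) * indicator {0..<1} s \<le>
          ennreal c * (ennreal (2 * pi) * ennreal_powr ?T p * ennreal (n s) + ?c2 * (ennreal (n s) * ?A s))"
      proof (cases "s \<in> {0..<1}")
        case True
        have A: "(\<integral>\<^sup>+y\<in>{0..s}. ?X y \<partial>lborel) = ?A s"
          by (intro nn_integral_cong) (auto simp: indicator_def)
        have "ennreal s * ?L \<le> 1 * ?L" using True by (intro mult_right_mono) (auto simp: ennreal_le_1)
        then have "ennreal (n s) * (ennreal s * ?L) \<le> ennreal (n s) * (1 * ?L)" by (rule mult_left_mono) simp
        also have "\<dots> \<le> ennreal (n s) * (ennreal c * (ennreal (2 * pi) * ennreal_powr ?T p + ?c2 * ?A s))"
          unfolding A[symmetric] using circle[of s] True by (intro mult_left_mono) auto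
        also have "\<dots> = ennreal c * (ennreal (2 * pi) * ennreal_powr ?T p * ennreal (n s) + ?c2 * (ennreal (n s) * ?A s))"
          by (simp only: distrib_left mult_ac)
        finally show ?thesis using True by simp
      qed simp
    qed
    also have "\<dots> = ennreal c * (ennreal (2 * pi) * ennreal_powr ?T p * ennreal (weight_hat n 0) + ?c2 * (\<integral>\<^sup>+s. ennreal (n s) * ?A s \<partial>lborel))"
    proof -
      have "(\<integral>\<^sup>+s. ennreal (n s) \<partial>lborel) = ennreal (weight_hat n 0)"
        unfolding nu.hat_nn by (intro nn_integral_cong) (auto simp: nu.support split: split_indicator)
      then show ?thesis by (subst nn_integral_cmult) (auto simp: nn_integral_add nn_integral_cmult)
    qed
    also have "(\<integral>\<^sup>+s. ennreal (n s) * ?A s \<partial>lborel) = (\<integral>\<^sup>+y. ?Y y * ennreal (weight_hat n y) \<partial>lborel)"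
      unfolding nu.hat_nn by (rule nn_integral_triangle_swap[symmetric]) measurable
    also have "\<dots> = (\<integral>\<^sup>+y\<in>{0..<1}. ennreal (weight_hat n y / weight_hat w y powr p) * ennreal_powr (?F y) p \<partial>lborel)"
    proof (intro nn_integral_cong)
      fix y :: real
      show "?Y y * ennreal (weight_hat n y) = ennreal (weight_hat n y / weight_hat w y powr p) * ennreal_powr (?F y) p * indicator {0..<1} y"
      proof (cases "y \<in> {0..<1}")
        case True
        have X: "?X y = ennreal (1 / weight_hat w y powr p) * ennreal_powr (?F y) p"
          by (simp add: ennreal_powr_mult powr_divide)
        have R: "ennreal (1 / weight_hat w y powr p) * ennreal (weight_hat n y) = ennreal (weight_hat n y / weight_hat w y powr p)"
          by (simp add: ennreal_mult[symmetric])
        have "?X y * ennreal (weight_hat n y) =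
            (ennreal (1 / weight_hat w y powr p) * ennreal (weight_hat n y)) * ennreal_powr (?F y) p"
          unfolding X by (simp only: mult_ac)
        then show ?thesis unfolding R using True by simp
      next
        case False
        have "weight_hat n y = 0" if "1 \<le> y"
        proof -
          have "ennreal (weight_hat n y) = 0"
            unfolding nu.hat_nn by (subst nn_integral_0_iff_AE) (use that in \<open>auto simp: nu.support split: split_indicator\<close>)
          then show ?thesis using nu.hat_nonneg[of y] by (simp add: ennreal_eq_0_iff)
        qed
        then show ?thesis using False by (cases "1 \<le> y") auto
      qed
    qed
    also have "ennreal c * (ennreal (2 * pi) * ennreal_powr ?T p * ennreal (weight_hat n 0) + ?c2 * \<dots>) \<le>
      ennreal c * (ennreal (2 * pi) * (ennreal M * ?\<Psi>) * ennreal (weight_hat n 0) + ?c2 * (ennreal (4 powr p) * ennreal M * ?\<Psi>))"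
      by (intro mult_left_mono add_mono mult_right_mono T weighted_Hardy g g0 M Tfin) auto
    also have "\<dots> = (ennreal c * (ennreal (2 * pi) * ennreal (weight_hat n 0) * ennreal M + ?c2 * (ennreal (4 powr p) * ennreal M))) * ?\<Psi>"
      by (simp only: distrib_left distrib_right mult_ac)
    also have "ennreal c * (ennreal (2 * pi) * ennreal (weight_hat n 0) * ennreal M + ?c2 * (ennreal (4 powr p) * ennreal M)) = ennreal B"
      unfolding B_def using c M pq by (simp add: ennreal_mult ennreal_plus)
    finally show "hilbert_well_defined w f \<and> hilbert_op w f holomorphic_on ball 0 1 \<and>
      disc_integral (hilbert_op w f) \<le>
      ennreal B * Lp_integral f"
      using wd hol unfolding \<Psi> by blast
  qed
qed

end

section \<open>The condition is necessary\<close>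

context weight_pair
begin

lemma conj_exponents: "(q - 1) * p = q" "(p - 1) * (q / p) = 1"
  using pq by (simp_all add: field_simps)

text \<open>Test the operator on the extremal function of Hoelder's inequality on \<open>[r, 1)\<close>, cut off where \<open>muck_weight\<close> is large so that its norm is
  finite. By the embedding, the norm of the image controls its values on the radius, and these are bounded below by the mass \<open>i\<close>
  of \<open>f * w\<close> times the kernel: at least \<open>c / weight_hat w y\<close> for \<open>y \<le> r\<close>, and at least \<open>kap 0\<close> throughout, which accounts for the
  summand \<open>1\<close> in the condition.\<close>

theorem hilbert_op_lower_bound:
  assumes D: "0 \<le> D"
    and bnd: "\<And>f :: real \<Rightarrow> complex. \<lbrakk>f \<in> borel_measurable (lebesgue_on {0..<1});
      Lp_integral f < \<infinity>\<rbrakk> \<Longrightarrow>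
      hilbert_op w f holomorphic_on ball 0 1 \<and>
      disc_integral (hilbert_op w f) \<le>
        ennreal D * Lp_integral f"
  shows "muckenhoupt_sup p q w n < \<infinity>"
proof -
  obtain c where c: "0 < c" "\<And>r y. \<lbrakk>0 \<le> y; y \<le> r; r < 1\<rbrakk> \<Longrightarrow>
    c \<le> weight_hat w y * (\<Sum>n. kap n * (r * y) ^ n)"
    by (rule kern_lower_scaled) blast
  define E where "E = (p + q) powr p * D"
  define m0 where "m0 = weight_hat n (1 / 2) * (1 / 2)"
  \<comment> \<open>Collects the two lower bounds: \<open>kap 0\<close> on all of the radius and \<open>c / weight_hat w y\<close> for \<open>y \<le> r\<close>.\<close>
  define E' where "E' = E * (1 / (kap 0 powr p * m0) + 1 / c powr p)"
  have E: "0 \<le> E" unfolding E_def using D by simp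
  have m0: "0 < m0" unfolding m0_def using nu.hat_pos[of "1 / 2"] by simp
  have E': "0 \<le> E'" unfolding E'_def using E m0 by simp
  have main: "ennreal_powr (1 + muck_left r) (1 / p) * ennreal_powr (muck_right r) (1 / q) \<le> ennreal (E' powr (1 / p))"
    if r: "0 < r" "r < 1" for r
  proof -
    define S where "S N = {t. r \<le> t \<and> t < 1 \<and> muck_weight t \<le> real N}" for N :: nat
    have [measurable]: "S N \<in> sets borel" for N
    proof -
      have "{t \<in> space borel. r \<le> t \<and> t < 1 \<and> muck_weight t \<le> real N} \<in> sets borel" by measurable
      then show ?thesis by (simp add: S_def)
    qed
    define I where "I N = (\<integral>\<^sup>+t. ennreal (muck_weight t powr q) * indicator (S N) t \<partial>lborel)" for N
    have level: "ennreal_powr (1 + muck_left r) (q / p) * I N \<le> ennreal (E' powr (q / p))" for N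
    proof -
      \<comment> \<open>Extremal: both \<open>g * w\<close> and \<open>g powr p * weight_hat n\<close> are \<open>muck_weight powr q\<close> on \<open>S N\<close>.\<close>
      define g where "g t = muck_weight t powr (q - 1) * weight_hat n t powr (- (1 / p)) * indicator (S N) t" for t
      have [measurable]: "g \<in> borel_measurable borel" unfolding g_def[abs_def] by measurable
      have g0: "0 \<le> g t" for t unfolding g_def by simp
      have supp: "t < r \<Longrightarrow> g t = 0" for t unfolding g_def S_def by simp
      have hat: "0 < weight_hat n t" if "t \<in> S N" for t
        using that r by (intro nu.hat_pos) (auto simp: S_def)
      have gw: "g t * w t = muck_weight t powr q * indicator (S N) t" for t
      proof (cases "t \<in> S N")
        case True
        have "w t = muck_weight t * weight_hat n t powr (1 / p)"
          using hat[OF True] by (simp add: muck_weight_def)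
        then have "g t * w t = (muck_weight t powr (q - 1) * muck_weight t) * (weight_hat n t powr (- (1 / p)) * weight_hat n t powr (1 / p))"
          using True by (simp add: g_def)
        also have "weight_hat n t powr (- (1 / p)) * weight_hat n t powr (1 / p) = 1"
          using hat[OF True] by (simp add: powr_add[symmetric])
        also have "muck_weight t powr (q - 1) * muck_weight t = muck_weight t powr q"
        proof (cases "muck_weight t = 0")
          case False
          then have "0 < muck_weight t" using muck_weight_nonneg[of t] by linarith
          then show ?thesis using powr_add[of "muck_weight t" "q - 1" 1] by simp
        qed simp
        finally show ?thesis using True by simp
      qed (simp add: g_def)
      have gp: "g t powr p * weight_hat n t = muck_weight t powr q * indicator (S N) t" for t
      proof (cases "t \<in> S N")
        case True
        have "g t powr p = muck_weight t powr ((q - 1) * p) * weight_hat n t powr (- (1 / p) * p)"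
          using True by (simp add: g_def powr_mult powr_powr)
        also have "\<dots> = muck_weight t powr q * (1 / weight_hat n t)"
          using conj_exponents(1) hat[OF True] pq by (simp add: powr_minus divide_inverse)
        finally show ?thesis using True hat[OF True] by simp
      qed (use pq in \<open>simp add: g_def\<close>)
      have Ifin: "I N < \<infinity>"
      proof -
        have "I N \<le> (\<integral>\<^sup>+t. ennreal (real N powr q) * indicator {r..<1} t \<partial>lborel)"
          unfolding I_def using pq
          by (intro nn_integral_mono) (auto simp: indicator_def S_def intro!: ennreal_leI powr_mono2)
        also have "\<dots> = ennreal (real N powr q) * ennreal (1 - r)"
          using r by (simp add: nn_integral_cmult_indicator)
        also have "\<dots> < \<infinity>" by (simp add: ennreal_mult_less_top)
        finally show ?thesis .
      qed
      then obtain i where i: "I N = ennreal i" "0 \<le> i" by (cases "I N") auto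
      let ?f = "\<lambda>t. complex_of_real (g t)"
      have Lf: "Lp_integral ?f = ennreal i"
      proof -
        have "Lp_integral ?f = I N"
          unfolding I_def
        proof (intro nn_integral_cong)
          fix t
          show "ennreal (cmod (?f t) powr p * weight_hat n t) * indicator {0..<1} t = ennreal (muck_weight t powr q) * indicator (S N) t"
            using g0[of t] r by (auto simp: gp S_def indicator_def)
        qed
        then show ?thesis using i by simp
      qed
      have nnw: "(\<integral>\<^sup>+t. ennreal (g t * w t) \<partial>lborel) = ennreal i"
      proof -
        have "(\<integral>\<^sup>+t. ennreal (g t * w t) \<partial>lborel) = I N"
          unfolding I_def gw by (intro nn_integral_cong) (auto simp: indicator_def)
        then show ?thesis using i by simp
      qed
      have intb: "integrable lborel (\<lambda>t. g t * w t)"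
        by (rule integrableI_nonneg) (use g0 nnw in auto)
      then have intl: "integrable lebesgue (\<lambda>t. g t * w t)"
        by (subst integrable_completion) auto
      have set: "indicator {0..<1} t *\<^sub>R (g t * w t) = g t * w t" for t
        by (auto simp: support split: split_indicator)
      have int: "set_integrable lebesgue {0..<1} (\<lambda>t. g t * w t)"
        unfolding set_integrable_def set by (rule intl)
      have "(LINT t:{0..<1}|lebesgue. g t * w t) = (LINT t|lborel. g t * w t)"
        unfolding set_lebesgue_integral_def set by (rule integral_completion) measurable
      also have "\<dots> = i"
      proof -
        have "0 \<le> (LINT t|lborel. g t * w t)" using g0 by (intro integral_nonneg_AE) auto
        moreover have "ennreal (LINT t|lborel. g t * w t) = ennreal i"
          using nn_integral_eq_integral[OF intb] g0 nnw by simp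
        ultimately show ?thesis using i(2) by simp
      qed
      finally have lint: "(LINT t:{0..<1}|lebesgue. g t * w t) = i" .
      have fm: "?f \<in> borel_measurable (lebesgue_on {0..<1})"
      proof (rule measurable_restrict_space1)
        show "?f \<in> borel_measurable lebesgue" by (rule measurable_completion) measurable
      qed
      have hol: "hilbert_op w ?f holomorphic_on ball 0 1"
        and up: "disc_integral (hilbert_op w ?f) \<le> ennreal D * ennreal i"
        using bnd[OF fm] unfolding Lf by auto
      have total: "(\<integral>\<^sup>+y\<in>{0..<1}. ennreal (cmod (hilbert_op w ?f (of_real y)) powr p * weight_hat n y) \<partial>lborel) \<le> ennreal (E * i)"
      proof -
        have "(\<integral>\<^sup>+y\<in>{0..<1}. ennreal (cmod (hilbert_op w ?f (of_real y)) powr p * weight_hat n y) \<partial>lborel) \<le>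
          ennreal ((p + q) powr p) * disc_integral (hilbert_op w ?f)"
          by (rule nu.radial_embedding[OF hol pq])
        also have "\<dots> \<le> ennreal ((p + q) powr p) * (ennreal D * ennreal i)"
          by (intro mult_left_mono up) auto
        also have "\<dots> = ennreal (E * i)" unfolding E_def using D i by (simp add: ennreal_mult mult.assoc)
        finally show ?thesis .
      qed
      have ge: "(\<Sum>n. kap n * (r * y) ^ n) * i \<le> cmod (hilbert_op w ?f (of_real y))" if "0 \<le> y" "y < 1" for y
        using norm_hilbert_op_ge[OF int g0 supp _ _ that] r unfolding lint by simp
      have left: "muck_left r * ennreal (i powr p) \<le> ennreal (E * i * (1 / c powr p))"
      proof -
        have "muck_left r * ennreal ((c * i) powr p) = (\<integral>\<^sup>+y. ennreal (weight_hat n y / weight_hat w y powr p) * indicator {0..r} y * ennreal ((c * i) powr p) \<partial>lborel)"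
          unfolding muck_left_def by (rule nn_integral_multc[symmetric]) measurable
        also have "\<dots> \<le> (\<integral>\<^sup>+y\<in>{0..<1}. ennreal (cmod (hilbert_op w ?f (of_real y)) powr p * weight_hat n y) \<partial>lborel)"
        proof (intro nn_integral_mono)
          fix y
          show "ennreal (weight_hat n y / weight_hat w y powr p) * indicator {0..r} y * ennreal ((c * i) powr p) \<le>
              ennreal (cmod (hilbert_op w ?f (of_real y)) powr p * weight_hat n y) * indicator {0..<1} y"
          proof (cases "y \<in> {0..r}")
            case True
            then have y: "0 \<le> y" "y \<le> r" "y < 1" using r by auto
            have hy: "0 < weight_hat w y" using y by (intro hat_pos) auto
            have "c / weight_hat w y \<le> (\<Sum>n. kap n * (r * y) ^ n)"
              using c(2)[OF y(1,2) r(2)] hy by (simp add: divide_le_eq mult.commute)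
            then have "c / weight_hat w y * i \<le> (\<Sum>n. kap n * (r * y) ^ n) * i" using i by (intro mult_right_mono) auto
            also have "\<dots> \<le> cmod (hilbert_op w ?f (of_real y))" using y by (intro ge)
            finally have "(c / weight_hat w y * i) powr p \<le> cmod (hilbert_op w ?f (of_real y)) powr p"
              using c hy i pq by (intro powr_mono2) auto
            then have "(c / weight_hat w y * i) powr p * weight_hat n y \<le> cmod (hilbert_op w ?f (of_real y)) powr p * weight_hat n y"
              by (rule mult_right_mono) simp
            moreover have "(c / weight_hat w y * i) powr p * weight_hat n y = weight_hat n y / weight_hat w y powr p * (c * i) powr p"
              by (simp add: powr_mult powr_divide)
            ultimately have "ennreal (weight_hat n y / weight_hat w y powr p * (c * i) powr p) \<le> ennreal (cmod (hilbert_op w ?f (of_real y)) powr p * weight_hat n y)"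
              by (intro ennreal_leI) simp
            moreover have "ennreal (weight_hat n y / weight_hat w y powr p) * ennreal ((c * i) powr p) = ennreal (weight_hat n y / weight_hat w y powr p * (c * i) powr p)"
              by (rule ennreal_mult[symmetric]) auto
            ultimately show ?thesis using True y by simp
          qed simp
        qed
        also have "\<dots> \<le> ennreal (E * i)" by (rule total)
        finally have "muck_left r * ennreal ((c * i) powr p) * ennreal (1 / c powr p) \<le> ennreal (E * i) * ennreal (1 / c powr p)"
          by (rule mult_right_mono) simp
        moreover have "ennreal ((c * i) powr p) * ennreal (1 / c powr p) = ennreal (i powr p)"
          using c by (simp add: ennreal_mult[symmetric] powr_mult)
        moreover have "ennreal (E * i) * ennreal (1 / c powr p) = ennreal (E * i * (1 / c powr p))"
          using E i by (intro ennreal_mult[symmetric]) auto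
        ultimately show ?thesis by (simp only: mult.assoc)
      qed
      have one: "ennreal (i powr p) \<le> ennreal (E * i * (1 / (kap 0 powr p * m0)))"
      proof -
        have m0_le: "ennreal m0 \<le> (\<integral>\<^sup>+y\<in>{0..<1}. ennreal (weight_hat n y) \<partial>lborel)"
        proof -
          have "ennreal m0 = ennreal (weight_hat n (1/2)) * ennreal (1/2)"
            unfolding m0_def by (rule ennreal_mult) auto
          also have "\<dots> = (\<integral>\<^sup>+y. ennreal (weight_hat n (1/2)) * indicator {0..<1/2::real} y \<partial>lborel)"
            by (subst nn_integral_cmult_indicator) auto
          also have "\<dots> \<le> (\<integral>\<^sup>+y\<in>{0..<1}. ennreal (weight_hat n y) \<partial>lborel)"
            by (intro nn_integral_mono) (auto simp: indicator_def intro!: ennreal_leI nu.hat_antimono)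
          finally show ?thesis .
        qed
        have "ennreal ((kap 0 * i) powr p) * ennreal m0 \<le> ennreal ((kap 0 * i) powr p) * (\<integral>\<^sup>+y\<in>{0..<1}. ennreal (weight_hat n y) \<partial>lborel)"
          by (intro mult_left_mono m0_le) simp
        also have "\<dots> = (\<integral>\<^sup>+y. ennreal ((kap 0 * i) powr p) * (ennreal (weight_hat n y) * indicator {0..<1} y) \<partial>lborel)"
          by (rule nn_integral_cmult[symmetric]) measurable
        also have "\<dots> \<le> (\<integral>\<^sup>+y\<in>{0..<1}. ennreal (cmod (hilbert_op w ?f (of_real y)) powr p * weight_hat n y) \<partial>lborel)"
        proof (intro nn_integral_mono)
          fix y
          show "ennreal ((kap 0 * i) powr p) * (ennreal (weight_hat n y) * indicator {0..<1} y) \<le>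
             ennreal (cmod (hilbert_op w ?f (of_real y)) powr p * weight_hat n y) * indicator {0..<1} y"
          proof (cases "y \<in> {0..<1}")
            case True
            then have y: "0 \<le> y" "y < 1" by auto
            have ry: "0 \<le> r * y" "r * y < 1"
            proof -
              show "0 \<le> r * y" using r y by simp
              have "r * y \<le> 1 * y" using r y by (intro mult_right_mono) auto
              then show "r * y < 1" using y by simp
            qed
            have "(\<Sum>n\<in>{0}. kap n * (r * y) ^ n) \<le> (\<Sum>n. kap n * (r * y) ^ n)"
              using ry kap_pos by (intro sum_le_suminf summable_kap) (auto simp: less_imp_le)
            then have "kap 0 * i \<le> (\<Sum>n. kap n * (r * y) ^ n) * i" using i by (intro mult_right_mono) auto
            also have "\<dots> \<le> cmod (hilbert_op w ?f (of_real y))" using y by (intro ge)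
            finally have "(kap 0 * i) powr p \<le> cmod (hilbert_op w ?f (of_real y)) powr p"
              using kap_pos[of 0] i pq by (intro powr_mono2) auto
            then have "(kap 0 * i) powr p * weight_hat n y \<le> cmod (hilbert_op w ?f (of_real y)) powr p * weight_hat n y"
              by (rule mult_right_mono) simp
            then have "ennreal ((kap 0 * i) powr p * weight_hat n y) \<le> ennreal (cmod (hilbert_op w ?f (of_real y)) powr p * weight_hat n y)"
              by (rule ennreal_leI)
            moreover have "ennreal ((kap 0 * i) powr p) * ennreal (weight_hat n y) = ennreal ((kap 0 * i) powr p * weight_hat n y)"
              by (rule ennreal_mult[symmetric]) auto
            ultimately show ?thesis using True by simp
          qed simp
        qed
        also have "\<dots> \<le> ennreal (E * i)" by (rule total)
        finally have "ennreal ((kap 0 * i) powr p * m0) \<le> ennreal (E * i)"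
          using m0 by (simp add: ennreal_mult)
        then have "(kap 0 * i) powr p * m0 \<le> E * i" using E i by (simp add: ennreal_le_iff)
        then have "i powr p * (kap 0 powr p * m0) \<le> E * i" by (simp add: powr_mult mult_ac)
        then have "i powr p \<le> E * i * (1 / (kap 0 powr p * m0))"
          using kap_pos[of 0] m0 by (simp add: pos_le_divide_eq)
        then show ?thesis by (rule ennreal_leI)
      qed
      have "(1 + muck_left r) * ennreal (i powr p) = ennreal (i powr p) + muck_left r * ennreal (i powr p)"
        by (simp add: distrib_right)
      also have "\<dots> \<le> ennreal (E * i * (1 / (kap 0 powr p * m0))) + ennreal (E * i * (1 / c powr p))"
        by (intro add_mono one left)
      also have "\<dots> = ennreal (E * i * (1 / (kap 0 powr p * m0)) + E * i * (1 / c powr p))"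
        using E i m0 by (intro ennreal_plus[symmetric]) auto
      also have "E * i * (1 / (kap 0 powr p * m0)) + E * i * (1 / c powr p) = E' * i"
        by (simp add: E'_def algebra_simps)
      finally have sum: "(1 + muck_left r) * ennreal (i powr p) \<le> ennreal (E' * i)" .
      have "(1 + muck_left r) * ennreal (i powr (p - 1)) \<le> ennreal E'"
      proof (cases "i = 0")
        case False
        then have ip: "0 < i" using i by simp
        have "(1 + muck_left r) * ennreal (i powr p) * ennreal (1 / i) \<le> ennreal (E' * i) * ennreal (1 / i)"
          by (intro mult_right_mono sum) simp
        moreover have "ennreal (i powr p) * ennreal (1 / i) = ennreal (i powr (p - 1))"
          using ip by (simp add: ennreal_mult[symmetric] powr_diff)
        moreover have "ennreal (E' * i) * ennreal (1 / i) = ennreal E'"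
          using ip E' by (simp add: ennreal_mult[symmetric])
        ultimately show ?thesis by (simp only: mult.assoc)
      qed simp
      then have "ennreal_powr ((1 + muck_left r) * ennreal (i powr (p - 1))) (q / p) \<le> ennreal_powr (ennreal E') (q / p)"
        using pq by (intro ennreal_powr_mono) auto
      then show ?thesis
        using i E' conj_exponents(2) by (simp add: ennreal_powr_mult powr_powr)
    qed
    have W: "muck_right r = (SUP N. I N)"
    proof -
      have "muck_right r = (\<integral>\<^sup>+t. (SUP N. ennreal (muck_weight t powr q) * indicator (S N) t) \<partial>lborel)"
        unfolding muck_right_def
      proof (intro nn_integral_cong)
        fix t
        show "ennreal (muck_weight t powr q) * indicator {r..<1} t = (SUP N. ennreal (muck_weight t powr q) * indicator (S N) t)"
        proof (cases "t \<in> {r..<1}")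
          case True
          obtain N :: nat where "muck_weight t \<le> real N" using real_arch_simple by blast
          then have "ennreal (muck_weight t powr q) * indicator {r..<1} t \<le> ennreal (muck_weight t powr q) * indicator (S N) t"
            using True by (simp add: S_def)
          then have "ennreal (muck_weight t powr q) * indicator {r..<1} t \<le> (SUP N. ennreal (muck_weight t powr q) * indicator (S N) t)"
            by (rule SUP_upper2[OF UNIV_I])
          moreover have "(SUP N. ennreal (muck_weight t powr q) * indicator (S N) t) \<le> ennreal (muck_weight t powr q) * indicator {r..<1} t"
            using True by (intro SUP_least) (auto simp: indicator_def)
          ultimately show ?thesis by (rule antisym)
        next
          case False
          then have "t \<notin> S N" for N by (auto simp: S_def)
          then show ?thesis using False by simp
        qed
      qed
      also have "\<dots> = (SUP N. I N)"
        unfolding I_def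
      proof (rule nn_integral_monotone_convergence_SUP)
        show "incseq (\<lambda>N t. ennreal (muck_weight t powr q) * indicator (S N) t)"
          by (intro incseq_SucI le_funI) (auto simp: indicator_def S_def)
      qed measurable
      finally show ?thesis .
    qed
    have "ennreal_powr (1 + muck_left r) (q / p) * muck_right r = (SUP N. ennreal_powr (1 + muck_left r) (q / p) * I N)"
      unfolding W by (rule SUP_mult_left_ennreal)
    also have "\<dots> \<le> ennreal (E' powr (q / p))" by (intro SUP_least level)
    finally have "ennreal_powr (ennreal_powr (1 + muck_left r) (q / p) * muck_right r) (1 / q) \<le> ennreal_powr (ennreal (E' powr (q / p))) (1 / q)"
      using pq by (intro ennreal_powr_mono) auto
    then show ?thesis using pq by (simp add: ennreal_powr_mult ennreal_powr_powr powr_powr)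
  qed
  have "muckenhoupt_sup p q w n \<le> ennreal (E' powr (1 / p))"
    unfolding muckenhoupt_sup_eq by (intro SUP_least main) auto
  also have "\<dots> < \<infinity>" by simp
  finally show ?thesis .
qed

end

section \<open>From Borel profiles to radial weights\<close>

text \<open>Lebesgue measure is complete, so that the two functions are measurable together; if they are not, then neither is
  integrable and both integrals are \<open>0\<close>.\<close>

lemma integrable_lebesgue_cong_AE:
  fixes f g :: "'a::euclidean_space \<Rightarrow> 'b::euclidean_space"
  assumes ae: "AE x in lebesgue. f x = g x"
  shows "integrable lebesgue f \<longleftrightarrow> integrable lebesgue g" "integral\<^sup>L lebesgue f = integral\<^sup>L lebesgue g"
proof -
  have ae': "AE x in lebesgue. g x = f x" using ae by (simp add: eq_commute)
  have m: "f \<in> borel_measurable lebesgue \<longleftrightarrow> g \<in> borel_measurable lebesgue"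
    using borel_measurable_AE[OF _ ae] borel_measurable_AE[OF _ ae'] by blast
  show "integrable lebesgue f \<longleftrightarrow> integrable lebesgue g"
  proof (cases "f \<in> borel_measurable lebesgue")
    case True
    then show ?thesis using m ae by (intro integrable_cong_AE) auto
  next
    case False
    then show ?thesis using m by (auto dest: borel_measurable_integrable)
  qed
  show "integral\<^sup>L lebesgue f = integral\<^sup>L lebesgue g"
  proof (cases "f \<in> borel_measurable lebesgue")
    case True
    then show ?thesis using m ae by (intro integral_cong_AE) auto
  next
    case False
    then have "\<not> integrable lebesgue f" "\<not> integrable lebesgue g"
      using m by (auto dest: borel_measurable_integrable)
    then show ?thesis by (simp add: not_integrable_integral_eq)
  qed
qed

text \<open>Equality of profiles up to what the definitions see of them. It lets a radial weight be replaced by a Borel one.\<close>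

definition agree :: "(real \<Rightarrow> real) \<Rightarrow> (real \<Rightarrow> real) \<Rightarrow> bool" where
  "agree v w \<longleftrightarrow> (AE t in lebesgue. t \<in> {0..<1} \<longrightarrow> v t = w t)"

lemma agreeD: "agree v w \<Longrightarrow> AE t in lebesgue. t \<in> {0..<1} \<longrightarrow> v t = w t"
  by (simp add: agree_def)

lemma weight_hat_agree:
  assumes "agree v w" "0 \<le> r"
  shows "weight_hat v r = weight_hat w r"
  unfolding weight_hat_def set_lebesgue_integral_def
proof (rule integrable_lebesgue_cong_AE(2))
  show "AE t in lebesgue. indicator {r..<1} t *\<^sub>R v t = indicator {r..<1} t *\<^sub>R w t"
    using agreeD[OF assms(1)] by eventually_elim (use assms(2) in \<open>auto split: split_indicator\<close>)
qed

lemma weight_moment_agree: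
  assumes "agree v w"
  shows "weight_moment v = weight_moment w"
proof
  fix x
  show "weight_moment v x = weight_moment w x"
    unfolding weight_moment_def set_lebesgue_integral_def
  proof (rule integrable_lebesgue_cong_AE(2))
    show "AE t in lebesgue. indicator {0..<1} t *\<^sub>R (t powr x * v t) = indicator {0..<1} t *\<^sub>R (t powr x * w t)"
      using agreeD[OF assms] by eventually_elim (auto split: split_indicator)
  qed
qed

lemma hilbert_kernel_agree:
  assumes "agree v w"
  shows "hilbert_kernel v = hilbert_kernel w"
  unfolding hilbert_kernel_def[abs_def] bergman_kernel_def[abs_def] weight_moment_agree[OF assms] ..

lemma hilbert_integrand_agree:
  assumes "agree v w"
  shows "AE t in lebesgue. indicator {0..<1} t *\<^sub>R hilbert_integrand v f z t = indicator {0..<1} t *\<^sub>R hilbert_integrand w f z t"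
  using agreeD[OF assms]
  by eventually_elim (auto simp: hilbert_integrand_def hilbert_kernel_agree[OF assms] split: split_indicator)

lemma hilbert_op_agree:
  assumes "agree v w"
  shows "hilbert_op v = hilbert_op w" "hilbert_well_defined v = hilbert_well_defined w"
proof -
  show "hilbert_op v = hilbert_op w"
  proof (intro ext)
    fix f z
    show "hilbert_op v f z = hilbert_op w f z"
      unfolding hilbert_op_def set_lebesgue_integral_def
      by (rule integrable_lebesgue_cong_AE(2)[OF hilbert_integrand_agree[OF assms]])
  qed
  show "hilbert_well_defined v = hilbert_well_defined w"
  proof (intro ext)
    fix f
    show "hilbert_well_defined v f = hilbert_well_defined w f"
      unfolding hilbert_well_defined_def set_integrable_def
      using integrable_lebesgue_cong_AE(1)[OF hilbert_integrand_agree[OF assms]] by simp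
  qed
qed

lemma hilbert_bounded_agree:
  assumes "agree v w"
  shows "hilbert_bounded v \<rho> X nX Y nY = hilbert_bounded w \<rho> X nX Y nY"
  unfolding hilbert_bounded_def hilbert_op_agree[OF assms] ..

lemma bergman_norm_agree:
  assumes "agree v w"
  shows "bergman_norm p v = bergman_norm p w"
proof
  fix f
  have "AE t in lborel. t \<in> {0..<1} \<longrightarrow> v t = w t"
    using agreeD[OF assms] by (simp only: AE_completion_iff)
  from AE_area_measure[OF AE_completion[OF AE_cmod[OF this]]]
  have "AE z in area_measure. z \<in> ball 0 1 \<longrightarrow> cmod z \<in> {0..<1} \<longrightarrow> v (cmod z) = w (cmod z)" .
  then have "AE z in area_measure. ennreal (cmod (f z) powr p * v (cmod z)) * indicator (ball 0 1) z =
      ennreal (cmod (f z) powr p * w (cmod z)) * indicator (ball 0 1) z"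
    by eventually_elim (auto split: split_indicator)
  then show "bergman_norm p v f = bergman_norm p w f"
    unfolding bergman_norm_def by (simp only: nn_integral_cong_AE)
qed

lemma Lp_hat_norm_agree:
  assumes "agree v w"
  shows "Lp_hat_norm p v = Lp_hat_norm p w"
proof
  fix f
  have "(\<integral>\<^sup>+t\<in>{0..<1}. ennreal (cmod (f t) powr p * weight_hat v t) \<partial>lebesgue) =
      (\<integral>\<^sup>+t\<in>{0..<1}. ennreal (cmod (f t) powr p * weight_hat w t) \<partial>lebesgue)"
    by (intro nn_integral_cong) (auto simp: weight_hat_agree[OF assms] split: split_indicator)
  then show "Lp_hat_norm p v f = Lp_hat_norm p w f" unfolding Lp_hat_norm_def by (simp only:)
qed

lemma muckenhoupt_sup_agree:
  assumes vw: "agree v w" and nm: "agree n m"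
  shows "muckenhoupt_sup p q v n = muckenhoupt_sup p q w m"
  unfolding muckenhoupt_sup_def
proof (rule SUP_cong[OF refl])
  fix r :: real assume r: "r \<in> {0<..<1}"
  have "(\<integral>\<^sup>+t\<in>{0..r}. ennreal (weight_hat n t / weight_hat v t powr p) \<partial>lebesgue) =
      (\<integral>\<^sup>+t\<in>{0..r}. ennreal (weight_hat m t / weight_hat w t powr p) \<partial>lebesgue)"
    by (intro nn_integral_cong) (auto simp: weight_hat_agree[OF vw] weight_hat_agree[OF nm] split: split_indicator)
  moreover have "(\<integral>\<^sup>+t\<in>{r..<1}. ennreal ((v t / weight_hat n t powr (1 / p)) powr q) \<partial>lebesgue) =
      (\<integral>\<^sup>+t\<in>{r..<1}. ennreal ((w t / weight_hat m t powr (1 / p)) powr q) \<partial>lebesgue)"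
  proof (intro nn_integral_cong_AE)
    show "AE t in lebesgue. ennreal ((v t / weight_hat n t powr (1 / p)) powr q) * indicator {r..<1} t =
      ennreal ((w t / weight_hat m t powr (1 / p)) powr q) * indicator {r..<1} t"
      using agreeD[OF vw]
      by eventually_elim (use r in \<open>auto simp: weight_hat_agree[OF nm] split: split_indicator\<close>)
  qed
  ultimately show "ennreal_powr (1 + (\<integral>\<^sup>+t\<in>{0..r}. ennreal (weight_hat n t / weight_hat v t powr p) \<partial>lebesgue)) (1 / p) *
      ennreal_powr (\<integral>\<^sup>+t\<in>{r..<1}. ennreal ((v t / weight_hat n t powr (1 / p)) powr q) \<partial>lebesgue) (1 / q) =
    ennreal_powr (1 + (\<integral>\<^sup>+t\<in>{0..r}. ennreal (weight_hat m t / weight_hat w t powr p) \<partial>lebesgue)) (1 / p) *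
      ennreal_powr (\<integral>\<^sup>+t\<in>{r..<1}. ennreal ((w t / weight_hat m t powr (1 / p)) powr q) \<partial>lebesgue) (1 / q)"
    by (simp only:)
qed

lemma radial_weight_borel_version:
  assumes "radial_weight v"
  obtains w where "borel_weight w" "agree v w"
proof -
  have v0: "\<And>r. r \<in> {0..<1} \<Longrightarrow> 0 \<le> v r" and int: "integrable lebesgue (\<lambda>t. indicator {0..<1} t *\<^sub>R v t)"
    and pos: "\<And>r. r \<in> {0..<1} \<Longrightarrow> 0 < weight_hat v r"
    using assms by (auto simp: radial_weight_def set_integrable_def)
  obtain g where g: "g \<in> borel_measurable lborel" "AE t in lborel. indicator {0..<1} t *\<^sub>R v t = g t"
    using completion_ex_borel_measurable_real[OF borel_measurable_integrable[OF int]] by blast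
  define w where "w t = max 0 (g t) * indicator {0..<1} t" for t :: real
  have [measurable]: "g \<in> borel_measurable borel" using g(1) by simp
  have w [measurable]: "w \<in> borel_measurable borel" unfolding w_def[abs_def] by measurable
  have ae: "AE t in lebesgue. indicator {0..<1} t *\<^sub>R v t = w t"
    using AE_completion[OF g(2)]
  proof eventually_elim
    case (elim t)
    then show ?case using v0[of t] by (auto simp: w_def split: split_indicator)
  qed
  have agree: "agree v w"
    unfolding agree_def using ae by eventually_elim auto
  have "borel_weight w"
  proof
    show "w \<in> borel_measurable borel" by (rule w)
    show "0 \<le> w x" for x unfolding w_def by simp
    show "w x = 0" if "x \<notin> {0..<1}" for x using that by (simp add: w_def)
    have "integrable lebesgue w" using int integrable_lebesgue_cong_AE(1)[OF ae] by simp
    then show "integrable lborel w" by (subst (asm) integrable_completion) auto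
    show "0 < weight_hat w r" if "0 \<le> r" "r < 1" for r
      using pos[of r] that weight_hat_agree[OF agree that(1)] by simp
  qed
  then show ?thesis using agree by (rule that)
qed

context weight_pair
begin

lemma Lp_hat_norm_eq: "Lp_hat_norm p n f = ennreal_powr (Lp_integral f) (1 / p)"
  unfolding Lp_hat_norm_def nn_integral_completion ..

lemma Lp_hat_space_iff:
  "f \<in> Lp_hat_space p n \<longleftrightarrow> f \<in> borel_measurable (lebesgue_on {0..<1}) \<and> Lp_integral f < \<infinity>"
  unfolding Lp_hat_space_def Lp_hat_norm_eq by simp

lemma bergman_norm_eq:
  "f holomorphic_on ball 0 1 \<Longrightarrow> bergman_norm p n f = ennreal_powr (ennreal (1 / pi) * disc_integral f) (1 / p)"
  unfolding bergman_norm_def nu.bergman_integral_lborel ..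

lemma bergman_space_iff:
  "f \<in> bergman_space p n \<longleftrightarrow> f holomorphic_on ball 0 1 \<and> disc_integral f < \<infinity>"
proof (cases "f holomorphic_on ball 0 1")
  case True
  have "ennreal (1 / pi) * disc_integral f < \<infinity> \<longleftrightarrow> disc_integral f < \<infinity>"
    by (auto simp: ennreal_mult_less_top)
  then show ?thesis using True unfolding bergman_space_def by (simp add: bergman_norm_eq)
qed (simp add: bergman_space_def)

lemma hilbert_bounded_if_muckenhoupt:
  assumes "muckenhoupt_sup p q w n < \<infinity>"
  shows "hilbert_bounded w (\<lambda>f. f) (Lp_hat_space p n) (Lp_hat_norm p n) (bergman_space p n) (bergman_norm p n)"
proof -
  obtain M where M: "0 \<le> M" "\<And>r. \<lbrakk>0 < r; r < 1\<rbrakk> \<Longrightarrow> (1 + muck_left r) * ennreal_powr (muck_right r) (p / q) \<le> ennreal M"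
    using muckenhoupt_bound[OF assms] by blast
  obtain B where B: "0 \<le> B" and bnd: "\<And>f :: real \<Rightarrow> complex. \<lbrakk>f \<in> borel_measurable (lebesgue_on {0..<1}); Lp_integral f < \<infinity>\<rbrakk> \<Longrightarrow>
    hilbert_well_defined w f \<and> hilbert_op w f holomorphic_on ball 0 1 \<and> disc_integral (hilbert_op w f) \<le> ennreal B * Lp_integral f"
    using hilbert_op_upper_bound[OF M] by blast
  show ?thesis
    unfolding hilbert_bounded_def
  proof (intro exI[of _ "(B / pi) powr (1 / p)"] conjI ballI)
    fix f assume "f \<in> Lp_hat_space p n"
    then have f: "f \<in> borel_measurable (lebesgue_on {0..<1})" "Lp_integral f < \<infinity>" by (auto simp: Lp_hat_space_iff)
    note b = bnd[OF f]
    show "hilbert_well_defined w f" using b by simp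
    have hol: "hilbert_op w f holomorphic_on ball 0 1" using b by simp
    have le: "disc_integral (hilbert_op w f) \<le> ennreal B * Lp_integral f" using b by simp
    have "ennreal B * Lp_integral f < \<infinity>" using f(2) by (simp add: ennreal_mult_less_top)
    then show "hilbert_op w f \<in> bergman_space p n"
      using hol order_le_less_trans[OF le] by (simp add: bergman_space_iff)
    have "ennreal (1 / pi) * disc_integral (hilbert_op w f) \<le> ennreal (1 / pi) * (ennreal B * Lp_integral f)"
      by (intro mult_left_mono le) simp
    also have "\<dots> = ennreal (B / pi) * Lp_integral f"
      using B by (simp add: mult.assoc[symmetric] ennreal_mult[symmetric])
    finally have "bergman_norm p n (hilbert_op w f) \<le> ennreal_powr (ennreal (B / pi) * Lp_integral f) (1 / p)"
      unfolding bergman_norm_eq[OF hol] using pq by (intro ennreal_powr_mono) auto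
    also have "\<dots> = ennreal ((B / pi) powr (1 / p)) * Lp_hat_norm p n f"
      using B by (simp add: ennreal_powr_mult Lp_hat_norm_eq)
    finally show "bergman_norm p n (hilbert_op w f) \<le> ennreal ((B / pi) powr (1 / p)) * Lp_hat_norm p n f" .
  qed simp
qed

lemma muckenhoupt_if_hilbert_bounded:
  assumes "hilbert_bounded w (\<lambda>f. f) (Lp_hat_space p n) (Lp_hat_norm p n) (bergman_space p n) (bergman_norm p n)"
  shows "muckenhoupt_sup p q w n < \<infinity>"
proof -
  obtain K where K: "0 \<le> K" and bnd: "\<And>f. f \<in> Lp_hat_space p n \<Longrightarrow> hilbert_op w f \<in> bergman_space p n \<and>
      bergman_norm p n (hilbert_op w f) \<le> ennreal K * Lp_hat_norm p n f"
    using assms unfolding hilbert_bounded_def by blast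
  show ?thesis
  proof (rule hilbert_op_lower_bound[of "pi * K powr p"])
    fix f :: "real \<Rightarrow> complex"
    assume f: "f \<in> borel_measurable (lebesgue_on {0..<1})" "Lp_integral f < \<infinity>"
    then have X: "f \<in> Lp_hat_space p n" by (simp add: Lp_hat_space_iff)
    have hol: "hilbert_op w f holomorphic_on ball 0 1" using bnd[OF X] by (simp add: bergman_space_iff)
    have "ennreal_powr (ennreal (1 / pi) * disc_integral (hilbert_op w f)) (1 / p) \<le> ennreal K * ennreal_powr (Lp_integral f) (1 / p)"
      using bnd[OF X] unfolding bergman_norm_eq[OF hol] Lp_hat_norm_eq by simp
    then have "ennreal_powr (ennreal_powr (ennreal (1 / pi) * disc_integral (hilbert_op w f)) (1 / p)) p \<le>
        ennreal_powr (ennreal K * ennreal_powr (Lp_integral f) (1 / p)) p"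
      using pq by (intro ennreal_powr_mono) auto
    then have le: "ennreal (1 / pi) * disc_integral (hilbert_op w f) \<le> ennreal (K powr p) * Lp_integral f"
      using pq K unfolding ennreal_powr_powr by (simp add: ennreal_powr_mult[of "ennreal K"] ennreal_powr_powr)
    have "disc_integral (hilbert_op w f) = ennreal pi * (ennreal (1 / pi) * disc_integral (hilbert_op w f))"
      by (simp add: mult.assoc[symmetric] ennreal_mult[symmetric])
    also have "\<dots> \<le> ennreal pi * (ennreal (K powr p) * Lp_integral f)" by (intro mult_left_mono le) simp
    also have "\<dots> = ennreal (pi * K powr p) * Lp_integral f"
      by (simp add: mult.assoc[symmetric] ennreal_mult)
    finally show "hilbert_op w f holomorphic_on ball 0 1 \<and> disc_integral (hilbert_op w f) \<le> ennreal (pi * K powr p) * Lp_integral f"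
      using hol by simp
  qed simp
qed

text \<open>The restriction map from the Bergman space to the space on the radius is bounded for every radial weight; this reduces the
  last assertion of the theorem to the first.\<close>

lemma restrict_bounded:
  assumes f: "f \<in> bergman_space p n"
  shows "restrict_to_radius f \<in> Lp_hat_space p n"
    "Lp_hat_norm p n (restrict_to_radius f) \<le> ennreal ((pi * (p + q) powr p) powr (1 / p)) * bergman_norm p n f"
proof -
  have hol: "f holomorphic_on ball 0 1" and fin: "disc_integral f < \<infinity>"
    using f by (auto simp: bergman_space_iff)
  have le: "Lp_integral (restrict_to_radius f) \<le> ennreal ((p + q) powr p) * disc_integral f"
    unfolding restrict_to_radius_def by (rule nu.radial_embedding[OF hol pq])
  have "continuous_on {0..<1} (restrict_to_radius f)"
    unfolding restrict_to_radius_def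
    by (rule continuous_on_compose2[OF holomorphic_on_imp_continuous_on[OF hol]]) (auto intro!: continuous_intros)
  then have "restrict_to_radius f \<in> borel_measurable (lebesgue_on {0..<1})"
    by (rule continuous_imp_measurable_on_sets_lebesgue) simp
  moreover have "ennreal ((p + q) powr p) * disc_integral f < \<infinity>" using fin by (simp add: ennreal_mult_less_top)
  ultimately show "restrict_to_radius f \<in> Lp_hat_space p n"
    using order_le_less_trans[OF le] by (simp add: Lp_hat_space_iff)
  have "ennreal ((p + q) powr p) * disc_integral f = ennreal (pi * (p + q) powr p) * (ennreal (1 / pi) * disc_integral f)"
    by (simp add: mult.assoc[symmetric] ennreal_mult[symmetric])
  then have "Lp_hat_norm p n (restrict_to_radius f) \<le> ennreal_powr (ennreal (pi * (p + q) powr p) * (ennreal (1 / pi) * disc_integral f)) (1 / p)"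
    unfolding Lp_hat_norm_eq using pq le by (intro ennreal_powr_mono) auto
  also have "\<dots> = ennreal ((pi * (p + q) powr p) powr (1 / p)) * bergman_norm p n f"
    unfolding bergman_norm_eq[OF hol] by (simp add: ennreal_powr_mult[of "ennreal (pi * (p + q) powr p)"])
  finally show "Lp_hat_norm p n (restrict_to_radius f) \<le> ennreal ((pi * (p + q) powr p) powr (1 / p)) * bergman_norm p n f" .
qed

lemma hilbert_bounded_on_bergman:
  assumes "hilbert_bounded w (\<lambda>f. f) (Lp_hat_space p n) (Lp_hat_norm p n) (bergman_space p n) (bergman_norm p n)"
  shows "hilbert_bounded w restrict_to_radius (bergman_space p n) (bergman_norm p n) (bergman_space p n) (bergman_norm p n)"
proof -
  obtain K where K: "0 \<le> K" and bnd: "\<And>f. f \<in> Lp_hat_space p n \<Longrightarrow> hilbert_well_defined w f \<and> hilbert_op w f \<in> bergman_space p n \<and>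
      bergman_norm p n (hilbert_op w f) \<le> ennreal K * Lp_hat_norm p n f"
    using assms unfolding hilbert_bounded_def by blast
  let ?E = "(pi * (p + q) powr p) powr (1 / p)"
  show ?thesis
    unfolding hilbert_bounded_def
  proof (intro exI[of _ "K * ?E"] conjI ballI)
    show "0 \<le> K * ?E" using K by simp
    fix f assume f: "f \<in> bergman_space p n"
    note b = bnd[OF restrict_bounded(1)[OF f]]
    show "hilbert_well_defined w (restrict_to_radius f)" "hilbert_op w (restrict_to_radius f) \<in> bergman_space p n"
      using b by auto
    have "bergman_norm p n (hilbert_op w (restrict_to_radius f)) \<le> ennreal K * Lp_hat_norm p n (restrict_to_radius f)"
      using b by simp
    also have "\<dots> \<le> ennreal K * (ennreal ?E * bergman_norm p n f)"
      by (intro mult_left_mono restrict_bounded(2) f) simp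
    also have "\<dots> = ennreal (K * ?E) * bergman_norm p n f"
      using K by (simp add: ennreal_mult mult.assoc)
    finally show "bergman_norm p n (hilbert_op w (restrict_to_radius f)) \<le> ennreal (K * ?E) * bergman_norm p n f" .
  qed
qed

end

theorem theorem4:
  fixes p p' :: real and \<omega> \<nu> :: "real \<Rightarrow> real"
  assumes "1 < p"
    and "1 / p + 1 / p' = 1"
    and "\<omega> \<in> D_hat"
    and "radial_weight \<nu>"
  shows "(hilbert_bounded \<omega> (\<lambda>f. f) (Lp_hat_space p \<nu>) (Lp_hat_norm p \<nu>)
            (bergman_space p \<nu>) (bergman_norm p \<nu>)
          \<longleftrightarrow> muckenhoupt_sup p p' \<omega> \<nu> < \<infinity>)
       \<and> (muckenhoupt_sup p p' \<omega> \<nu> < \<infinity> \<longrightarrow>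
            hilbert_bounded \<omega> restrict_to_radius (bergman_space p \<nu>) (bergman_norm p \<nu>)
              (bergman_space p \<nu>) (bergman_norm p \<nu>))"
proof -
  have q: "1 < p'"
  proof -
    have "1 / p' = 1 - 1 / p" using assms(2) by simp
    moreover have "0 < 1 / p" "1 / p < 1" using assms(1) by auto
    ultimately have "0 < 1 / p'" "1 / p' < 1" by auto
    then show ?thesis by simp
  qed
  obtain C where \<omega>: "radial_weight \<omega>" and C: "1 \<le> C"
    and doubling: "\<And>r. r \<in> {0..<1} \<Longrightarrow> weight_hat \<omega> r \<le> C * weight_hat \<omega> ((1 + r) / 2)"
    using assms(3) by (auto simp: D_hat_def)
  obtain w where w: "borel_weight w" and \<omega>w: "agree \<omega> w" by (rule radial_weight_borel_version[OF \<omega>])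
  obtain n where n: "borel_weight n" and \<nu>n: "agree \<nu> n" by (rule radial_weight_borel_version[OF assms(4)])
  interpret weight_pair w n C p p'
  proof (intro weight_pair.intro doubling_weight.intro w n)
    show "doubling_weight_axioms w C"
    proof
      show "weight_hat w r \<le> C * weight_hat w ((1 + r) / 2)" if "0 \<le> r" "r < 1" for r
        using doubling[of r] that weight_hat_agree[OF \<omega>w, of r] weight_hat_agree[OF \<omega>w, of "(1 + r) / 2"] by simp
    qed (rule C)
    show "weight_pair_axioms p p'" using assms q by unfold_locales auto
  qed
  have spaces: "Lp_hat_space p \<nu> = Lp_hat_space p n" "bergman_space p \<nu> = bergman_space p n"
    unfolding Lp_hat_space_def bergman_space_def Lp_hat_norm_agree[OF \<nu>n] bergman_norm_agree[OF \<nu>n] by auto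
  have "(hilbert_bounded w (\<lambda>f. f) (Lp_hat_space p n) (Lp_hat_norm p n) (bergman_space p n) (bergman_norm p n)
      \<longleftrightarrow> muckenhoupt_sup p p' w n < \<infinity>)
    \<and> (muckenhoupt_sup p p' w n < \<infinity> \<longrightarrow>
        hilbert_bounded w restrict_to_radius (bergman_space p n) (bergman_norm p n) (bergman_space p n) (bergman_norm p n))"
    using hilbert_bounded_if_muckenhoupt muckenhoupt_if_hilbert_bounded hilbert_bounded_on_bergman by blast
  then show ?thesis
    unfolding hilbert_bounded_agree[OF \<omega>w] spaces Lp_hat_norm_agree[OF \<nu>n] bergman_norm_agree[OF \<nu>n]
      muckenhoupt_sup_agree[OF \<omega>w \<nu>n] .
qed

end
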